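(* Let $\Delta$ be a $(d-1)$-dimensional Buchsbaum simplicial complex (over $\mathbf{k}$) and let $\theta_1,\dots,\theta_d$ be a linear system of parameters for $\mathbf{k}[\Delta]$. Then for all $0\le j\le d$, $$\dim_{\mathbf{k}}\left(\operatorname{Soc}\,\mathbf{k}[\Delta]/(\theta_1,\dots,\theta_d)\right)_j\;\ge\;\binom{d}{j}\beta_{j-1}(\Delta).$$ In particular, $h'_j(\Delta)\ge\binom{d}{j}\beta_{j-1}(\Delta)$, or, equivalently, $h_j(\Delta)\ge\binom{d}{j}\sum_{i=0}^{j}(-1)^{j-i}\beta_{i-1}(\Delta)$.
   Context: $\mathbf{k}$ is an infinite field of arbitrary characteristic. A simplicial complex $\Delta$ on $[n]$ is a collection of subsets (faces) of $[n]$ closed under inclusion and containing all singletons; $\dim F=|F|-1$ and $\dim\Delta$ is the maximal dimension of a face. $f_i$ is the number of $i$-dimensional faces ($f_{-1}=1$), and, for $\dim\Delta=d-1$, the $h$-vector $(h_0,\dots,h_d)$ is defined by $\sum_{i=0}^d h_i x^{d-i}=\sum_{i=0}^d f_{i-1}(x-1)^{d-i}$. $\beta_i(\Delta)=\dim_{\mathbf{k}}\widetilde H_i(\Delta;\mathbf{k})$ are the reduced Betti numbers, and $$h'_j(\Delta)=h_j(\Delta)+\binom{d}{j}\sum_{i=0}^{j-1}(-1)^{j-i-1}\beta_{i-1}(\Delta),\qquad 0\le j\le d.$$ Let $S=\mathbf{k}[x_1,\dots,x_n]$, $\mathfrak{M}=(x_1,\dots,x_n)$. The Stanley–Reisner ring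 is $\mathbf{k}[\Delta]=S/I_\Delta$, where $I_\Delta$ is generated by the squarefree monomials $x_{i_1}\cdots x_{i_k}$ with $\{i_1<\dots<i_k\}\notin\Delta$; it is graded with $\deg x_i=1$ and has Krull dimension $d$. A homogeneous system of parameters (h.s.o.p.) of a Noetherian graded $S$-module $M$ of Krull dimension $d$ is a sequence $\theta_1,\dots,\theta_d$ of homogeneous elements of $\mathfrak{M}$ with $\dim M/(\theta_1,\dots,\theta_d)M=0$; it is linear (l.s.o.p.) if all $\theta_i$ have degree 1. $M$ is Buchsbaum if every h.s.o.p. satisfies $(\theta_1,\dots,\theta_{i-1})M:\theta_i=(\theta_1,\dots,\theta_{i-1})M:\mathfrak{M}$ for all $i$. $\Delta$ is Buchsbaum (over $\mathbf{k}$) if $\mathbf{k}[\Delta]$ is a Buchsbaum $S$-module. (Equivalently, by Schenzel: $\Delta$ is pure and for each vertex $v$ the link $L$ of $v$ is Cohen–Macaulay over $\mathbf{k}$, i.e. $\widetilde H_i(\operatorname{lk}_L F;\mathbf{k})=0$ for all $F\in L$ and $i<\dim L-|F|$.) The socle is $\operatorname{Soc} M=\{y\in M:\mathfrak{M}y=0\}$, and a subscript $j$ denotes the degree-$j$ component. *)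

theory Defs
  imports
    "HOL-Library.Poly_Mapping"
    "HOL-Computational_Algebra.Polynomial"
    "HOL-Algebra.QuotRing"
    "Jordan_Normal_Form.VS_Connect"
begin

section \<open>Modules over a ring\<close>

text \<open>
  Modules are the \<open>module\<close> records of HOL-Algebra. Such a record also has the fields \<open>mult\<close>
  and \<open>one\<close>, which play no role in the module axioms. In a quotient we still keep those of the
  quotient ring, so that the quotient of a ring by an ideal is the ring quotient \<open>Quot\<close> with a
  scalar multiplication added.
\<close>

definition quot_module :: "('r, 'm) module \<Rightarrow> 'm set \<Rightarrow> ('r, 'm set) module" where
  "quot_module M N =
    \<lparr>carrier = carrier (M Quot N), mult = mult (M Quot N), one = one (M Quot N),
     zero = zero (M Quot N), add = add (M Quot N),
     smult = (\<lambda>r X. \<Union>x\<in>X. N +>\<^bsub>M\<^esub> (r \<odot>\<^bsub>M\<^esub> x))\<rparr>"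

text \<open>The submodule \<open>(T)M\<close>, for a subset \<open>T\<close> of the ring.\<close>

definition ideal_times :: "'r ring \<Rightarrow> 'r set \<Rightarrow> ('r, 'm) module \<Rightarrow> 'm set" where
  "ideal_times R T M =
    LinearCombinations.module.span R M {t \<odot>\<^bsub>M\<^esub> m | t m. t \<in> T \<and> m \<in> carrier M}"

text \<open>The submodule \<open>N : T\<close> of \<open>M\<close>.\<close>

definition colon :: "('r, 'm) module \<Rightarrow> 'm set \<Rightarrow> 'r set \<Rightarrow> 'm set" where
  "colon M N T = {m \<in> carrier M. \<forall>t\<in>T. t \<odot>\<^bsub>M\<^esub> m \<in> N}"

definition annihilator :: "'r ring \<Rightarrow> ('r, 'm) module \<Rightarrow> 'r set" where
  "annihilator R M = {r \<in> carrier R. \<forall>m\<in>carrier M. r \<odot>\<^bsub>M\<^esub> m = \<zero>\<^bsub>M\<^esub>}"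

text \<open>A strict chain \<open>P\<^sub>0 \<subset> \<dots> \<subset> P\<^sub>r\<close> of primes containing the annihilator of \<open>M\<close> has length \<open>r\<close>.
  It corresponds to a chain of primes of \<open>R/Ann M\<close>, whose Krull dimension is that of \<open>M\<close>.\<close>

definition prime_chain :: "'r ring \<Rightarrow> ('r, 'm) module \<Rightarrow> 'r set list \<Rightarrow> bool" where
  "prime_chain R M Ps \<longleftrightarrow>
    sorted_wrt (\<subset>) Ps \<and> (\<forall>P\<in>set Ps. primeideal P R \<and> annihilator R M \<subseteq> P)"

text \<open>\<open>has_krull_dim R M d\<close> holds for no \<open>d\<close> if \<open>M = 0\<close> or if the dimension is infinite.\<close>

definition has_krull_dim :: "'r ring \<Rightarrow> ('r, 'm) module \<Rightarrow> nat \<Rightarrow> bool" where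
  "has_krull_dim R M d \<longleftrightarrow>
    (\<exists>Ps. prime_chain R M Ps \<and> length Ps = d + 1) \<and>
    (\<forall>Ps. prime_chain R M Ps \<longrightarrow> length Ps \<le> d + 1)"


section \<open>The polynomial ring\<close>

text \<open>A monomial is a finitely supported exponent function on variable indices.\<close>

type_synonym 'k mpoly = "(nat \<Rightarrow>\<^sub>0 nat) \<Rightarrow>\<^sub>0 'k"

definition poly_ring :: "nat \<Rightarrow> 'k::field mpoly ring" where
  "poly_ring n =
    \<lparr>carrier = {p. \<forall>m \<in> Poly_Mapping.keys p. Poly_Mapping.keys m \<subseteq> {1..n}},
     mult = (*), one = 1, zero = 0, add = (+)\<rparr>"

definition Const :: "'k::field \<Rightarrow> 'k mpoly" where
  "Const c = Poly_Mapping.single 0 c"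

definition Var :: "nat \<Rightarrow> 'k::field mpoly" where
  "Var i = Poly_Mapping.single (Poly_Mapping.single i 1) 1"

definition mon_degree :: "(nat \<Rightarrow>\<^sub>0 nat) \<Rightarrow> nat" where
  "mon_degree m = (\<Sum>i\<in>Poly_Mapping.keys m. Poly_Mapping.lookup m i)"

text \<open>The degree-\<open>j\<close> component; it contains \<open>0\<close>.\<close>

definition poly_component :: "nat \<Rightarrow> nat \<Rightarrow> 'k::field mpoly set" where
  "poly_component n j =
    {p \<in> carrier (poly_ring n). \<forall>m \<in> Poly_Mapping.keys p. mon_degree m = j}"

definition max_ideal :: "nat \<Rightarrow> 'k::field mpoly set" where
  "max_ideal n = Idl\<^bsub>poly_ring n\<^esub> (Var ` {1..n})"

definition regular_module :: "nat \<Rightarrow> ('k::field mpoly, 'k mpoly) module" where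
  "regular_module n =
    \<lparr>carrier = carrier (poly_ring n), mult = (*), one = 1, zero = 0, add = (+), smult = (*)\<rparr>"


section \<open>Systems of parameters, Buchsbaum modules, socles\<close>

definition hsop :: "nat \<Rightarrow> ('k::field mpoly, 'm) module \<Rightarrow> 'k mpoly list \<Rightarrow> bool" where
  "hsop n M \<theta>s \<longleftrightarrow>
    has_krull_dim (poly_ring n) M (length \<theta>s) \<and>
    (\<forall>\<theta>\<in>set \<theta>s. \<theta> \<in> max_ideal n \<and> (\<exists>j. \<theta> \<in> poly_component n j)) \<and>
    has_krull_dim (poly_ring n) (quot_module M (ideal_times (poly_ring n) (set \<theta>s) M)) 0"

definition lsop :: "nat \<Rightarrow> ('k::field mpoly, 'm) module \<Rightarrow> 'k mpoly list \<Rightarrow> bool" where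
  "lsop n M \<theta>s \<longleftrightarrow> hsop n M \<theta>s \<and> set \<theta>s \<subseteq> poly_component n 1"

text \<open>List indices start at \<open>0\<close>, so \<open>take i \<theta>s\<close> are the elements preceding \<open>\<theta>s ! i\<close>.\<close>

definition buchsbaum_module :: "nat \<Rightarrow> ('k::field mpoly, 'm) module \<Rightarrow> bool" where
  "buchsbaum_module n M \<longleftrightarrow>
    (\<forall>\<theta>s. hsop n M \<theta>s \<longrightarrow>
      (\<forall>i<length \<theta>s.
        colon M (ideal_times (poly_ring n) (set (take i \<theta>s)) M) {\<theta>s ! i} =
        colon M (ideal_times (poly_ring n) (set (take i \<theta>s)) M) (max_ideal n)))"

definition socle :: "nat \<Rightarrow> ('k::field mpoly, 'm) module \<Rightarrow> 'm set" where
  "socle n M = {y \<in> carrier M. \<forall>t\<in>max_ideal n. t \<odot>\<^bsub>M\<^esub> y = \<zero>\<^bsub>M\<^esub>}"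

text \<open>\<open>k_space M V\<close> is a subset \<open>V\<close> of an \<open>S\<close>-module \<open>M\<close>, with scalars restricted to constants;
  \<open>class_ring\<close> is the field type seen as a ring record.\<close>

definition k_space :: "('k::field mpoly, 'm) module \<Rightarrow> 'm set \<Rightarrow> ('k, 'm) module" where
  "k_space M V =
    \<lparr>carrier = V, mult = mult M, one = one M, zero = zero M, add = add M,
     smult = (\<lambda>c x. Const c \<odot>\<^bsub>M\<^esub> x)\<rparr>"

definition k_dim :: "('k::field, 'm) module \<Rightarrow> nat" where
  "k_dim V = vectorspace.dim class_ring V"


section \<open>Simplicial complexes\<close>

text \<open>The empty face is always present (\<open>f\<^sub>-\<^sub>1 = 1\<close>).\<close>

definition simplicial_complex :: "nat \<Rightarrow> nat set set \<Rightarrow> bool" where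
  "simplicial_complex n \<Delta> \<longleftrightarrow>
    \<Delta> \<subseteq> Pow {1..n} \<and> {} \<in> \<Delta> \<and> (\<forall>i\<in>{1..n}. {i} \<in> \<Delta>) \<and>
    (\<forall>F\<in>\<Delta>. \<forall>G. G \<subseteq> F \<longrightarrow> G \<in> \<Delta>)"

definition face_dim :: "nat set \<Rightarrow> int" where
  "face_dim F = int (card F) - 1"

definition complex_dim :: "nat set set \<Rightarrow> int" where
  "complex_dim \<Delta> = Max (face_dim ` \<Delta>)"

definition faces :: "nat set set \<Rightarrow> int \<Rightarrow> nat set set" where
  "faces \<Delta> i = {F \<in> \<Delta>. face_dim F = i}"

definition f_num :: "nat set set \<Rightarrow> int \<Rightarrow> nat" where
  "f_num \<Delta> i = card (faces \<Delta> i)"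

text \<open>The numbers \<open>h\<^sub>j\<close>, for \<open>j \<le> d\<close>, are read off from
  \<open>\<Sum>\<^sub>i h\<^sub>i x\<^sup>d\<^sup>-\<^sup>i = \<Sum>\<^sub>i f\<^sub>i\<^sub>-\<^sub>1 (x - 1)\<^sup>d\<^sup>-\<^sup>i\<close>. Here and below \<open>d\<close> is meant to be \<open>complex_dim \<Delta> + 1\<close>.\<close>

definition h_poly :: "nat set set \<Rightarrow> nat \<Rightarrow> int poly" where
  "h_poly \<Delta> d = (\<Sum>i\<le>d. Polynomial.smult (int (f_num \<Delta> (int i - 1))) ([:-1, 1:] ^ (d - i)))"

definition h_num :: "nat set set \<Rightarrow> nat \<Rightarrow> nat \<Rightarrow> int" where
  "h_num \<Delta> d j = Polynomial.coeff (h_poly \<Delta> d) (d - j)"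

text \<open>Augmented chain complex with coefficients in the field; faces are oriented by the order
  of their vertices, and the empty face spans the chains of dimension \<open>-1\<close>.\<close>

definition chains :: "nat set set \<Rightarrow> int \<Rightarrow> (nat set \<Rightarrow>\<^sub>0 'k::field) set" where
  "chains \<Delta> i = {c. Poly_Mapping.keys c \<subseteq> faces \<Delta> i}"

definition boundary :: "(nat set \<Rightarrow>\<^sub>0 'k::field) \<Rightarrow> (nat set \<Rightarrow>\<^sub>0 'k)" where
  "boundary c = (\<Sum>F\<in>Poly_Mapping.keys c. \<Sum>v\<in>F.
    Poly_Mapping.single (F - {v}) ((-1) ^ card {u\<in>F. u < v} * Poly_Mapping.lookup c F))"

definition cycle_space :: "nat set set \<Rightarrow> int \<Rightarrow> ('k::field, nat set \<Rightarrow>\<^sub>0 'k) module" where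
  "cycle_space \<Delta> i =
    \<lparr>carrier = {c \<in> chains \<Delta> i. boundary c = 0}, mult = undefined, one = undefined,
     zero = 0, add = (+), smult = (\<lambda>a c. Poly_Mapping.map ((*) a) c)\<rparr>"

definition reduced_homology ::
    "nat set set \<Rightarrow> int \<Rightarrow> ('k::field, (nat set \<Rightarrow>\<^sub>0 'k) set) module" where
  "reduced_homology \<Delta> i = quot_module (cycle_space \<Delta> i) (boundary ` chains \<Delta> (i + 1))"

definition betti :: "'k::field itself \<Rightarrow> nat set set \<Rightarrow> int \<Rightarrow> nat" where
  "betti TYPE('k) \<Delta> i =
    k_dim (reduced_homology \<Delta> i :: ('k, (nat set \<Rightarrow>\<^sub>0 'k) set) module)"

definition h'_num :: "'k::field itself \<Rightarrow> nat set set \<Rightarrow> nat \<Rightarrow> nat \<Rightarrow> int" where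
  "h'_num TYPE('k) \<Delta> d j =
    h_num \<Delta> d j + int (d choose j) *
      (\<Sum>i<j. (-1) ^ (j - i - 1) * int (betti TYPE('k) \<Delta> (int i - 1)))"


section \<open>Stanley--Reisner rings\<close>

definition SR_ideal :: "nat \<Rightarrow> nat set set \<Rightarrow> 'k::field mpoly set" where
  "SR_ideal n \<Delta> = Idl\<^bsub>poly_ring n\<^esub> {\<Prod>i\<in>F. Var i | F. F \<subseteq> {1..n} \<and> F \<notin> \<Delta>}"

text \<open>The Stanley--Reisner ring as a module over the polynomial ring.\<close>

definition SR_module :: "nat \<Rightarrow> nat set set \<Rightarrow> ('k::field mpoly, 'k mpoly set) module" where
  "SR_module n \<Delta> = quot_module (regular_module n) (SR_ideal n \<Delta>)"

definition SR_component :: "nat \<Rightarrow> nat set set \<Rightarrow> nat \<Rightarrow> 'k::field mpoly set set" where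
  "SR_component n \<Delta> j =
    (\<lambda>p. SR_ideal n \<Delta> +>\<^bsub>regular_module n\<^esub> p) ` poly_component n j"

definition buchsbaum_complex :: "'k::field itself \<Rightarrow> nat \<Rightarrow> nat set set \<Rightarrow> bool" where
  "buchsbaum_complex TYPE('k) n \<Delta> \<longleftrightarrow>
    buchsbaum_module n (SR_module n \<Delta> :: ('k mpoly, 'k mpoly set) module)"

text \<open>The quotient of the Stanley--Reisner ring by \<open>(\<theta>\<^sub>1, \<dots>, \<theta>\<^sub>d)\<close> and its graded pieces.\<close>

definition SR_quot ::
    "nat \<Rightarrow> nat set set \<Rightarrow> 'k::field mpoly list \<Rightarrow> ('k mpoly, 'k mpoly set set) module" where
  "SR_quot n \<Delta> \<theta>s =
    quot_module (SR_module n \<Delta>) (ideal_times (poly_ring n) (set \<theta>s) (SR_module n \<Delta>))"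

definition SR_quot_component ::
    "nat \<Rightarrow> nat set set \<Rightarrow> 'k::field mpoly list \<Rightarrow> nat \<Rightarrow> 'k mpoly set set set" where
  "SR_quot_component n \<Delta> \<theta>s j =
    (\<lambda>x. ideal_times (poly_ring n) (set \<theta>s) (SR_module n \<Delta>) +>\<^bsub>SR_module n \<Delta>\<^esub> x)
      ` SR_component n \<Delta> j"

definition socle_component ::
    "nat \<Rightarrow> nat set set \<Rightarrow> 'k::field mpoly list \<Rightarrow> nat \<Rightarrow> ('k, 'k mpoly set set) module" where
  "socle_component n \<Delta> \<theta>s j =
    k_space (SR_quot n \<Delta> \<theta>s) (socle n (SR_quot n \<Delta> \<theta>s) \<inter> SR_quot_component n \<Delta> \<theta>s j)"

end

theory Submission
  imports Defs
    "HOL-Library.Function_Algebras"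
    "HOL-Computational_Algebra.Polynomial_FPS"
begin

text \<open>
  For a face \<open>F\<close> let \<open>st F\<close> be its star. The partition complex
  \<open>0 \<rightarrow> k[\<Delta>] \<rightarrow> \<Oplus>\<^sub>v k[st v] \<rightarrow> \<Oplus>\<^sub>e k[st e] \<rightarrow> \<dots>\<close>, with the faces of size \<open>j\<close> in position \<open>j\<close>,
  is exact in positive polynomial degrees, and in degree \<open>0\<close> it is the augmented simplicial cochain
  complex of \<open>\<Delta>\<close>. Reduce it modulo \<open>\<theta>\<^sub>1, \<dots>, \<theta>\<^sub>i\<close> and let \<open>h\<^sub>i(j, l)\<close> be the dimension of its
  cohomology in position \<open>j\<close> and degree \<open>l\<close>. Each \<open>x\<^sub>v\<close> kills this cohomology: multiplication by
  \<open>x\<^sub>v\<close> is a well-defined map from \<open>k[st F]\<close> to \<open>k[st (F - v)]\<close>, which gives a null-homotopy.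
  By the Buchsbaum property, \<open>\<theta>\<^sub>1, \<dots>, \<theta>\<^sub>d\<close> is a regular sequence on \<open>k[st F]\<close> for \<open>F \<noteq> \<emptyset>\<close>.
  Hence the long exact cohomology sequence of multiplication by \<open>\<theta>\<^sub>i\<^sub>+\<^sub>1\<close> splits into short ones:
  \<open>h\<^sub>i\<^sub>+\<^sub>1(j, l) = h\<^sub>i(j, l) + h\<^sub>i(j + 1, l - 1)\<close>, so \<open>h\<^sub>i(j, l) = (i choose l) \<beta>\<^sub>j\<^sub>+\<^sub>l\<^sub>-\<^sub>1\<close>.
  In position \<open>0\<close> the cohomology is the kernel of \<open>\<theta>\<^sub>i\<^sub>+\<^sub>1\<close> on \<open>k[\<Delta>]/(\<theta>\<^sub>1, \<dots>, \<theta>\<^sub>i)\<close> if \<open>i < d\<close>,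
  which yields the Hilbert function \<open>h'\<close> of the full quotient, and for \<open>i = d\<close> it lies in the socle.
\<close>

section \<open>Dimensions of subspaces\<close>

text \<open>The passage to stars shapes the proof. The Buchsbaum condition only says that a relation
  \<open>t q = 0\<close> modulo the preceding parameters forces \<open>x_v q = 0\<close> modulo
  them. On the star of \<open>v\<close> the variable \<open>x_v\<close> can be cancelled, but only
  modulo forms that do not involve it. In general a form involving \<open>x_v\<close> has to be
  eliminated from the others and postponed, which replaces the system by another basis of the same
  span. The Buchsbaum hypothesis speaks of all systems of parameters and covers the new one, so
  regularity is proved for all such bases at once. A parameter need not be a nonzerodivisor on the
  face ring itself, so multiplication by it may fail to be injective in position 0. The cohomology
  sequence still works, because the argument for position \<open>j\<close> uses injectivity only in
  positions above \<open>j\<close>. It splits because a linear form is a combination of variables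
  and therefore acts as zero on cohomology. Quotients are handled degree by degree as pairs of
  finite-dimensional subspaces of polynomials or of families of polynomials; cosets occur only where
  the definitions are translated.\<close>

locale scalar_space = vs: vector_space scale
  for scale :: "'a::field \<Rightarrow> 'b::ab_group_add \<Rightarrow> 'b" (infixr \<open>*s\<close> 75)
begin

text \<open>\<open>vs.dim\<close> is the cardinality of a basis and degenerates when that basis is
  infinite. The polynomials form an infinite-dimensional space, so the dimension counts carry this
  finiteness condition on the subspace concerned.\<close>

definition fin_spanned :: "'b set \<Rightarrow> bool" where
  "fin_spanned V \<longleftrightarrow> (\<exists>B. finite B \<and> V \<subseteq> vs.span B)"

lemma fin_spanned_mono: "fin_spanned V \<Longrightarrow> U \<subseteq> V \<Longrightarrow> fin_spanned U"
  unfolding fin_spanned_def by blast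

lemma obtain_finite_basis:
  assumes "fin_spanned V"
  obtains B where "finite B" "B \<subseteq> V" "\<not> vs.dependent B" "V \<subseteq> vs.span B" "card B = vs.dim V"
proof -
  obtain B where B: "B \<subseteq> V" "\<not> vs.dependent B" "V \<subseteq> vs.span B" "card B = vs.dim V"
    by (rule vs.basis_exists)
  obtain C where C: "finite C" "V \<subseteq> vs.span C" using assms unfolding fin_spanned_def by blast
  have "finite B" using vs.independent_span_bound[OF C(1) B(2)] B(1) C(2) by blast
  with B that show thesis by blast
qed

text \<open>\<open>B\<close> represents a basis of \<open>A/A0\<close>. It comes from extending a
  basis of \<open>A0\<close> to one of \<open>A\<close>; quotient dimensions appear below as
  differences \<open>vs.dim A - vs.dim A0\<close>.\<close>

lemma obtain_complement:
  assumes "fin_spanned A" "vs.subspace A0" "A0 \<subseteq> A"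
  obtains B where "finite B" "B \<subseteq> A" "A \<subseteq> vs.span (A0 \<union> B)" "vs.dim A = vs.dim A0 + card B"
proof -
  obtain B0 where B0: "finite B0" "B0 \<subseteq> A0" "\<not> vs.dependent B0" "A0 \<subseteq> vs.span B0" "card B0 = vs.dim A0"
    using obtain_finite_basis[OF fin_spanned_mono[OF assms(1,3)]] by blast
  obtain B where B: "B0 \<subseteq> B" "B \<subseteq> A" "\<not> vs.dependent B" "A \<subseteq> vs.span B"
    using vs.maximal_independent_subset_extend[of B0 A] B0 assms(3) by blast
  obtain C where C: "finite C" "A \<subseteq> vs.span C" using assms(1) unfolding fin_spanned_def by blast
  have fin: "finite B" using vs.independent_span_bound[OF C(1) B(3)] B(2) C(2) by blast
  have "vs.dim A = card B" using vs.basis_card_eq_dim[OF B(2,4,3)] by simp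
  moreover have "card B = card B0 + card (B - B0)"
    using B(1) fin by (metis card_Diff_subset card_mono finite_subset le_add_diff_inverse)
  moreover have "A \<subseteq> vs.span (A0 \<union> (B - B0))"
    using B(4) vs.span_mono[of B "A0 \<union> (B - B0)"] B0(2) by blast
  ultimately show thesis using that[of "B - B0"] fin B(2) B0(5) by auto
qed

lemma dim_subset_le:
  assumes "fin_spanned A" "vs.subspace A0" "A0 \<subseteq> A"
  shows "vs.dim A0 \<le> vs.dim A"
  by (rule obtain_complement[OF assms]) simp

lemma dim_le_add_card:
  assumes "fin_spanned U" "finite B" "A \<subseteq> vs.span (U \<union> B)"
  shows "vs.dim A \<le> vs.dim U + card B"
proof -
  obtain C where C: "finite C" "U \<subseteq> vs.span C" "card C = vs.dim U"
    using obtain_finite_basis[OF assms(1)] by metis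
  have "U \<union> B \<subseteq> vs.span (C \<union> B)" using C(2) vs.span_mono[of C "C \<union> B"] vs.span_superset[of "C \<union> B"] by blast
  then have "A \<subseteq> vs.span (C \<union> B)" using assms(3) vs.span_minimal[OF _ vs.subspace_span] by blast
  then have "vs.dim A \<le> card (C \<union> B)" using vs.dim_le_card C(1) assms(2) by blast
  also have "\<dots> \<le> card C + card B" by (rule card_Un_le)
  finally show ?thesis using C(3) by simp
qed

end

section \<open>Comparison of quotients along linear relations\<close>

locale two_vector_spaces = v1: scalar_space s1 + v2: scalar_space s2
  for s1 :: "'k::field \<Rightarrow> 'b::ab_group_add \<Rightarrow> 'b" and s2 :: "'k \<Rightarrow> 'c::ab_group_add \<Rightarrow> 'c"
begin

text \<open>A linear relation \<open>G\<close> between \<open>A\<close> and \<open>W\<close> that is total on both sides and matches \<open>A0\<close> with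
  \<open>W0\<close> is the graph of an isomorphism \<open>A/A0 \<cong> W/W0\<close>. Working with relations avoids the choice of
  representatives in diagram chases.\<close>

definition relates :: "'b set \<Rightarrow> 'b set \<Rightarrow> 'c set \<Rightarrow> 'c set \<Rightarrow> ('b \<Rightarrow> 'c \<Rightarrow> bool) \<Rightarrow> bool" where
  "relates A A0 W W0 G \<longleftrightarrow>
    v1.vs.subspace A \<and> v1.vs.subspace A0 \<and> A0 \<subseteq> A \<and> v1.fin_spanned A \<and>
    v2.vs.subspace W \<and> v2.vs.subspace W0 \<and> W0 \<subseteq> W \<and> v2.fin_spanned W \<and>
    (\<forall>z w z' w' c. G z w \<longrightarrow> G z' w' \<longrightarrow> G (z + s1 c z') (w + s2 c w')) \<and>
    (\<forall>z\<in>A. \<exists>w\<in>W. G z w) \<and> (\<forall>w\<in>W. \<exists>z\<in>A. G z w) \<and>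
    (\<forall>z\<in>A. \<forall>w\<in>W. G z w \<longrightarrow> (z \<in> A0 \<longleftrightarrow> w \<in> W0))"

text \<open>Partners in \<open>W\<close> of a complement of \<open>A0\<close> in \<open>A\<close>
  span \<open>W\<close> modulo \<open>W0\<close>, which bounds one quotient dimension by the other.
  The conditions on \<open>G\<close> are symmetric, so exchanging the sides yields equality.\<close>

lemma relates_dim_le:
  assumes "relates A A0 W W0 G"
  shows "v2.vs.dim W + v1.vs.dim A0 \<le> v1.vs.dim A + v2.vs.dim W0"
proof -
  have A: "v1.vs.subspace A" "v1.vs.subspace A0" "A0 \<subseteq> A" "v1.fin_spanned A"
    and W: "v2.vs.subspace W" "v2.vs.subspace W0" "W0 \<subseteq> W" "v2.fin_spanned W"
    and G: "\<And>z w z' w' c. G z w \<Longrightarrow> G z' w' \<Longrightarrow> G (z + s1 c z') (w + s2 c w')"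
    and tot: "\<And>z. z \<in> A \<Longrightarrow> \<exists>w\<in>W. G z w" "\<And>w. w \<in> W \<Longrightarrow> \<exists>z\<in>A. G z w"
    and m: "\<And>z w. z \<in> A \<Longrightarrow> w \<in> W \<Longrightarrow> G z w \<Longrightarrow> z \<in> A0 \<longleftrightarrow> w \<in> W0"
    using assms unfolding relates_def by blast+
  obtain B where B: "finite B" "B \<subseteq> A" "A \<subseteq> v1.vs.span (A0 \<union> B)" "v1.vs.dim A = v1.vs.dim A0 + card B"
    using v1.obtain_complement[OF A(4,2,3)] by blast
  obtain f where f: "\<And>b. b \<in> B \<Longrightarrow> f b \<in> W \<and> G b (f b)"
    using tot(1) B(2) by (metis subsetD)
  have G00: "G 0 0"
  proof -
    obtain w where "G 0 w" using tot(1) v1.vs.subspace_0[OF A(1)] by blast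
    from G[OF this this, of "-1"] show ?thesis by simp
  qed
  let ?X = "v2.vs.span (W0 \<union> f ` B)"
  have "v1.vs.span (A0 \<union> B) \<subseteq> {z. \<exists>w\<in>W. G z w \<and> w \<in> ?X}"
  proof (rule v1.vs.span_minimal)
    show "A0 \<union> B \<subseteq> {z. \<exists>w\<in>W. G z w \<and> w \<in> ?X}"
    proof
      fix z assume "z \<in> A0 \<union> B"
      then show "z \<in> {z. \<exists>w\<in>W. G z w \<and> w \<in> ?X}"
      proof
        assume "z \<in> A0"
        then obtain w where "w \<in> W" "G z w" using tot(1) A(3) by blast
        moreover then have "w \<in> W0" using m \<open>z \<in> A0\<close> A(3) by blast
        ultimately show ?thesis using v2.vs.span_base[of w "W0 \<union> f ` B"] by blast
      next
        assume "z \<in> B"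
        then show ?thesis using f v2.vs.span_base[of "f z" "W0 \<union> f ` B"] by blast
      qed
    qed
    show "v1.vs.subspace {z. \<exists>w\<in>W. G z w \<and> w \<in> ?X}"
    proof (rule v1.vs.subspaceI)
      show "0 \<in> {z. \<exists>w\<in>W. G z w \<and> w \<in> ?X}"
        using G00 v2.vs.subspace_0[OF W(1)] v2.vs.span_zero by blast
    next
      fix x y assume "x \<in> {z. \<exists>w\<in>W. G z w \<and> w \<in> ?X}" "y \<in> {z. \<exists>w\<in>W. G z w \<and> w \<in> ?X}"
      then obtain u v where "u \<in> W" "v \<in> W" "G x u" "G y v" "u \<in> ?X" "v \<in> ?X" by blast
      then have "G (x + y) (u + v) \<and> u + v \<in> W \<and> u + v \<in> ?X"
        using G[of x u y v 1] v2.vs.subspace_add[OF W(1)] v2.vs.span_add by simp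
      then show "x + y \<in> {z. \<exists>w\<in>W. G z w \<and> w \<in> ?X}" by blast
    next
      fix c x assume "x \<in> {z. \<exists>w\<in>W. G z w \<and> w \<in> ?X}"
      then obtain u where "u \<in> W" "G x u" "u \<in> ?X" by blast
      then have "G (s1 c x) (s2 c u) \<and> s2 c u \<in> W \<and> s2 c u \<in> ?X"
        using G[OF G00, of x u c] v2.vs.subspace_scale[OF W(1)] v2.vs.span_scale by simp
      then show "s1 c x \<in> {z. \<exists>w\<in>W. G z w \<and> w \<in> ?X}" by blast
    qed
  qed
  then have sub: "\<And>z. z \<in> A \<Longrightarrow> \<exists>w\<in>W. G z w \<and> w \<in> ?X" using B(3) by blast
  have "W \<subseteq> ?X"
  proof
    fix w assume w: "w \<in> W"
    obtain z where z: "z \<in> A" "G z w" using tot(2) w by blast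
    obtain w' where w': "w' \<in> W" "G z w'" "w' \<in> ?X" using sub z(1) by blast
    \<comment> \<open>Both \<open>w\<close> and \<open>w'\<close> are partners of \<open>z\<close>,
      so their difference is a partner of \<open>0\<close> and lies in \<open>W0\<close>: the
      relation is single-valued modulo \<open>W0\<close>.\<close>
    have "G 0 (w - w')" using G[OF z(2) w'(2), of "-1"] by simp
    then have "w - w' \<in> W0"
      using m[of 0 "w - w'"] v1.vs.subspace_0 A(1,2) v2.vs.subspace_diff[OF W(1) w w'(1)] by blast
    then have "w - w' \<in> ?X" by (simp add: v2.vs.span_base)
    then have "(w - w') + w' \<in> ?X" using w'(3) v2.vs.span_add by blast
    then show "w \<in> ?X" by simp
  qed
  then have "v2.vs.dim W \<le> v2.vs.dim W0 + card (f ` B)"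
    using v2.dim_le_add_card[OF v2.fin_spanned_mono[OF W(4,3)]] B(1) by blast
  also have "\<dots> \<le> v2.vs.dim W0 + card B" using card_image_le[OF B(1)] by simp
  finally show ?thesis using B(4) by simp
qed

lemma relates_dim:
  assumes "relates A A0 W W0 G"
  shows "int (v1.vs.dim A) - int (v1.vs.dim A0) = int (v2.vs.dim W) - int (v2.vs.dim W0)"
proof -
  interpret swap: two_vector_spaces s2 s1 ..
  have "swap.relates W W0 A A0 (\<lambda>w z. G z w)"
    using assms unfolding relates_def swap.relates_def by (elim conjE) (intro conjI; (assumption | metis))
  from swap.relates_dim_le[OF this] relates_dim_le[OF assms] show ?thesis by linarith
qed

end

section \<open>Dimensions of record-based vector spaces\<close>

context scalar_space
begin

text \<open>Bridge from the module records of the definitions to subspaces of a type: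
  \<open>\<phi>\<close> presents \<open>X\<close> as \<open>V/W\<close>. Only the operations on
  images of \<open>V\<close> are prescribed, so the axioms for \<open>X\<close> are derived on the
  way and one lemma serves both homology and the socle.\<close>

lemma k_dim_eq_dim_diff:
  fixes X :: "('a, 'm) module" and \<phi> :: "'b \<Rightarrow> 'm"
  assumes V: "vs.subspace V" "fin_spanned V" and W: "vs.subspace W" "W \<subseteq> V"
    and carr: "carrier X = \<phi> ` V" and zero: "zero X = \<phi> 0"
    and add: "\<And>a b. a \<in> V \<Longrightarrow> b \<in> V \<Longrightarrow> \<phi> a \<oplus>\<^bsub>X\<^esub> \<phi> b = \<phi> (a + b)"
    and smult: "\<And>c a. a \<in> V \<Longrightarrow> c \<odot>\<^bsub>X\<^esub> \<phi> a = \<phi> (c *s a)"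
    and eq: "\<And>a b. a \<in> V \<Longrightarrow> b \<in> V \<Longrightarrow> \<phi> a = \<phi> b \<longleftrightarrow> a - b \<in> W"
  shows "k_dim X = vs.dim V - vs.dim W"
proof -
  note V_closed = vs.subspace_0[OF V(1)] vs.subspace_add[OF V(1)] vs.subspace_scale[OF V(1)] vs.subspace_neg[OF V(1)]
  interpret X: abelian_group X
  proof (rule abelian_groupI)
    show "\<exists>y\<in>carrier X. y \<oplus>\<^bsub>X\<^esub> x = \<zero>\<^bsub>X\<^esub>" if x: "x \<in> carrier X" for x
    proof -
      obtain a where a: "a \<in> V" "x = \<phi> a" using x unfolding carr by blast
      then have "\<phi> (- a) \<oplus>\<^bsub>X\<^esub> x = \<zero>\<^bsub>X\<^esub>" by (simp add: add V_closed zero)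
      then show ?thesis unfolding carr using imageI[OF V_closed(4)[OF a(1)], of \<phi>] by blast
    qed
  qed (auto simp: carr zero add V_closed ac_simps)
  interpret X: Module.module "class_ring :: 'a ring" X
  proof (rule Module.moduleI)
    show "cring (class_ring :: 'a ring)" using class_field unfolding field_def domain_def by blast
  qed (auto simp: carr add smult V_closed vs.scale_left_distrib vs.scale_right_distrib X.abelian_group_axioms)
  interpret X: vectorspace "class_ring :: 'a ring" X
    unfolding vectorspace_def using X.module_axioms class_field by blast
  have span_sub: "X.span (\<phi> ` A) = \<phi> ` (vs.span (A \<union> W))" if A: "A \<subseteq> V" for A
  proof
    have AW: "vs.span (A \<union> W) \<subseteq> V" using vs.span_minimal[OF _ V(1)] A W(2) by blast
    have "submodule class_ring (\<phi> ` (vs.span (A \<union> W))) X"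
    proof (unfold_locales)
      show "\<phi> ` (vs.span (A \<union> W)) \<subseteq> carrier X" unfolding carr using AW by blast
      show "\<zero>\<^bsub>X\<^esub> \<in> \<phi> ` (vs.span (A \<union> W))" using zero vs.span_zero by blast
    next
      fix v w assume "v \<in> \<phi> ` (vs.span (A \<union> W))" "w \<in> \<phi> ` (vs.span (A \<union> W))"
      then show "v \<oplus>\<^bsub>X\<^esub> w \<in> \<phi> ` (vs.span (A \<union> W))"
        using AW by (auto simp: add subset_iff intro!: imageI vs.span_add)
    next
      fix c :: 'a and v assume "c \<in> carrier class_ring" "v \<in> \<phi> ` (vs.span (A \<union> W))"
      then show "c \<odot>\<^bsub>X\<^esub> v \<in> \<phi> ` (vs.span (A \<union> W))"
        using AW by (auto simp: smult subset_iff intro!: imageI vs.span_scale)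
    qed
    then show "X.span (\<phi> ` A) \<subseteq> \<phi> ` (vs.span (A \<union> W))"
      by (rule X.span_is_subset[rotated]) (use vs.span_superset in blast)
    have sm: "submodule class_ring (X.span (\<phi> ` A)) X"
      using X.span_is_submodule[of "\<phi> ` A"] A unfolding carr by blast
    have own: "\<phi> ` A \<subseteq> X.span (\<phi> ` A)" using X.in_own_span[of "\<phi> ` A"] A unfolding carr by blast
    have "vs.span (A \<union> W) \<subseteq> {v \<in> V. \<phi> v \<in> X.span (\<phi> ` A)}"
    proof (rule vs.span_minimal)
      have "\<phi> w = \<zero>\<^bsub>X\<^esub>" if "w \<in> W" for w
        using that W(2) eq[of w 0] V_closed(1) zero by auto
      then show "A \<union> W \<subseteq> {v \<in> V. \<phi> v \<in> X.span (\<phi> ` A)}"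
        using own A W(2) submodule.zero_closed[OF sm] by auto
      show "vs.subspace {v \<in> V. \<phi> v \<in> X.span (\<phi> ` A)}"
        using submodule.zero_closed[OF sm] submodule.m_closed[OF sm] submodule.smult_closed[OF sm]
        by (intro vs.subspaceI) (auto simp: V_closed zero add[symmetric] smult[symmetric])
    qed
    then show "\<phi> ` (vs.span (A \<union> W)) \<subseteq> X.span (\<phi> ` A)" by blast
  qed
  obtain B where B: "finite B" "B \<subseteq> V" "V \<subseteq> vs.span (W \<union> B)" "vs.dim V = vs.dim W + card B"
    using obtain_complement[OF V(2) W] by blast
  have genB: "X.span (\<phi> ` B) = carrier X"
  proof -
    have "vs.span (B \<union> W) = V" using B(2,3) W(2) vs.span_minimal[OF _ V(1)]
      by (simp add: Un_commute subset_antisym)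
    then show ?thesis using span_sub[OF B(2)] carr by simp
  qed
  \<comment> \<open>\<open>X.dim\<close> is the least size of a finite generating set, so all of
    them must be bounded below. A generating set lifts to a set of the same size in \<open>V\<close>
    that spans \<open>V\<close> together with \<open>W\<close>.\<close>
  have ge: "vs.dim V - vs.dim W \<le> card A" if A: "finite A" "A \<subseteq> carrier X" "X.span A = carrier X" for A
  proof -
    obtain A' where A': "A' \<subseteq> V" "finite A'" "card A' = card A" "A = \<phi> ` A'"
      using A(1,2) unfolding carr by (metis card_image finite_imageD subset_image_inj)
    have "V \<subseteq> vs.span (W \<union> A')"
    proof
      fix v assume v: "v \<in> V"
      then have "\<phi> v \<in> \<phi> ` (vs.span (A' \<union> W))" using span_sub[OF A'(1)] A(3) A'(4) carr by auto
      then obtain u where u: "u \<in> vs.span (A' \<union> W)" "\<phi> v = \<phi> u" by blast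
      have "u \<in> V" using u(1) vs.span_minimal[OF _ V(1), of "A' \<union> W"] A'(1) W(2) by blast
      then have "v - u \<in> W" using eq u(2) v by blast
      then have "(v - u) + u \<in> vs.span (A' \<union> W)" using u(1) by (intro vs.span_add) (simp_all add: vs.span_base)
      then show "v \<in> vs.span (W \<union> A')" by (simp add: Un_commute)
    qed
    then have "vs.dim V \<le> vs.dim W + card A'"
      using dim_le_add_card[OF fin_spanned_mono[OF V(2) W(2)] A'(2)] by blast
    then show ?thesis using A'(3) by simp
  qed
  have img: "finite (\<phi> ` B)" "\<phi> ` B \<subseteq> carrier X" "card (\<phi> ` B) \<le> card B"
    using B(1,2) by (auto simp: carr card_image_le)
  have card: "card (\<phi> ` B) = vs.dim V - vs.dim W"
    using ge[OF img(1,2) genB] img(3) B(4) by simp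
  show ?thesis
    unfolding k_dim_def X.dim_def
    by (rule Least_equality) (use ge card img genB in auto)
qed

end

section \<open>Quotient modules\<close>

locale quotient_by_submodule = Module.module R M for R :: "'r ring" (structure) and M :: "('r, 'm) module" (structure) +
  fixes N
  assumes submodule: "submodule R N M"
begin

lemma N_subset: "N \<subseteq> carrier M"
  and N_zero: "\<zero>\<^bsub>M\<^esub> \<in> N"
  and N_add: "a \<in> N \<Longrightarrow> b \<in> N \<Longrightarrow> a \<oplus>\<^bsub>M\<^esub> b \<in> N"
  and N_smult: "r \<in> carrier R \<Longrightarrow> a \<in> N \<Longrightarrow> r \<odot>\<^bsub>M\<^esub> a \<in> N"
  using submodule unfolding submodule_def by auto

lemma N_neg: "a \<in> N \<Longrightarrow> \<ominus>\<^bsub>M\<^esub> a \<in> N"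
proof -
  assume a: "a \<in> N"
  then have "(\<ominus> \<one>) \<odot>\<^bsub>M\<^esub> a \<in> N" by (simp add: N_smult)
  moreover have "a \<in> carrier M" using a N_subset by blast
  ultimately show ?thesis by (simp add: smult_l_minus)
qed

lemma abelian_subgroup: "abelian_subgroup N M"
proof (rule abelian_subgroupI3)
  show "additive_subgroup N M"
  proof (rule additive_subgroup.intro, rule group.subgroupI)
    show "Group.group (add_monoid M)" by (rule M.a_group)
    show "N \<subseteq> carrier (add_monoid M)" using N_subset by simp
    show "N \<noteq> {}" using N_zero by blast
    show "inv\<^bsub>add_monoid M\<^esub> a \<in> N" if "a \<in> N" for a
      using N_neg[OF that] unfolding a_inv_def .
    show "a \<otimes>\<^bsub>add_monoid M\<^esub> b \<in> N" if "a \<in> N" "b \<in> N" for a b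
      using N_add[OF that] by simp
  qed
  show "abelian_group M" ..
qed

sublocale N: abelian_subgroup N M by (rule abelian_subgroup)

lemma mem_coset_iff:
  assumes "a \<in> carrier M" "b \<in> carrier M"
  shows "a \<in> N +>\<^bsub>M\<^esub> b \<longleftrightarrow> a \<ominus>\<^bsub>M\<^esub> b \<in> N"
  unfolding a_minus_def
  using N.a_rcos_module_imp[OF assms(2)] N.a_rcos_module_rev[OF assms(2,1)] by metis

lemma coset_eq_iff:
  assumes "a \<in> carrier M" "b \<in> carrier M"
  shows "N +>\<^bsub>M\<^esub> a = N +>\<^bsub>M\<^esub> b \<longleftrightarrow> a \<ominus>\<^bsub>M\<^esub> b \<in> N"
  unfolding mem_coset_iff[OF assms, symmetric]
  using N.a_rcos_self[OF assms(1)] M.a_repr_independence[OF _ assms(2) N.a_subgroup] by metis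

lemma carrier_quot_module: "carrier (quot_module M N) = (\<lambda>a. N +>\<^bsub>M\<^esub> a) ` carrier M"
  unfolding quot_module_def FactRing_def A_RCOSETS_def' by auto

lemma zero_quot_module: "\<zero>\<^bsub>quot_module M N\<^esub> = N +>\<^bsub>M\<^esub> \<zero>\<^bsub>M\<^esub>"
  unfolding quot_module_def FactRing_def by (simp add: M.a_coset_add_zero N_subset)

lemma add_quot_module:
  assumes "a \<in> carrier M" "b \<in> carrier M"
  shows "(N +>\<^bsub>M\<^esub> a) \<oplus>\<^bsub>quot_module M N\<^esub> (N +>\<^bsub>M\<^esub> b) = N +>\<^bsub>M\<^esub> (a \<oplus>\<^bsub>M\<^esub> b)"
  unfolding quot_module_def FactRing_def using N.a_rcos_sum[OF assms] by simp

text \<open>The union in \<open>quot_module\<close> runs over all members of a coset; since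
  \<open>N\<close> is closed under scalars, each of them contributes the same coset.\<close>

lemma smult_quot_module:
  assumes "r \<in> carrier R" "a \<in> carrier M"
  shows "r \<odot>\<^bsub>quot_module M N\<^esub> (N +>\<^bsub>M\<^esub> a) = N +>\<^bsub>M\<^esub> (r \<odot>\<^bsub>M\<^esub> a)"
proof -
  have eq: "N +>\<^bsub>M\<^esub> (r \<odot>\<^bsub>M\<^esub> x) = N +>\<^bsub>M\<^esub> (r \<odot>\<^bsub>M\<^esub> a)" if x: "x \<in> N +>\<^bsub>M\<^esub> a" for x
  proof -
    have xM: "x \<in> carrier M" using x assms(2) N_subset M.a_r_coset_subset_G by blast
    have "x \<ominus>\<^bsub>M\<^esub> a \<in> N" using mem_coset_iff[OF xM assms(2)] x by simp
    then have "r \<odot>\<^bsub>M\<^esub> (x \<ominus>\<^bsub>M\<^esub> a) \<in> N" by (rule N_smult[OF assms(1)])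
    then have "(r \<odot>\<^bsub>M\<^esub> x) \<ominus>\<^bsub>M\<^esub> (r \<odot>\<^bsub>M\<^esub> a) \<in> N"
      using xM assms by (simp add: a_minus_def smult_r_distr smult_r_minus)
    then show ?thesis using coset_eq_iff xM assms by simp
  qed
  have "N +>\<^bsub>M\<^esub> a \<noteq> {}" using N.a_rcos_self[OF assms(2)] by blast
  from SUP_eq_const[OF this eq] show ?thesis unfolding quot_module_def by simp
qed

lemma module_quot_module: "Module.module R (quot_module M N)"
proof -
  note defs = carrier_quot_module zero_quot_module add_quot_module smult_quot_module
  interpret Q: abelian_group "quot_module M N"
  proof (rule abelian_groupI)
    show "\<exists>y\<in>carrier (quot_module M N). y \<oplus>\<^bsub>quot_module M N\<^esub> x = \<zero>\<^bsub>quot_module M N\<^esub>"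
      if x: "x \<in> carrier (quot_module M N)" for x
    proof -
      obtain a where a: "a \<in> carrier M" "x = N +>\<^bsub>M\<^esub> a" using x unfolding carrier_quot_module by blast
      then have "(N +>\<^bsub>M\<^esub> (\<ominus>\<^bsub>M\<^esub> a)) \<oplus>\<^bsub>quot_module M N\<^esub> x = \<zero>\<^bsub>quot_module M N\<^esub>"
        by (simp add: defs M.l_neg)
      then show ?thesis using a(1) unfolding carrier_quot_module by auto
    qed
  qed (auto simp: defs M.a_ac)
  show ?thesis
    by (rule Module.moduleI)
      (auto simp: defs R.is_cring Q.abelian_group_axioms smult_l_distr smult_r_distr smult_assoc1)
qed

end

section \<open>Spaces of finitely supported functions\<close>

abbreviation (input) "lookup \<equiv> Poly_Mapping.lookup"
abbreviation (input) "keys \<equiv> Poly_Mapping.keys"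
abbreviation (input) "single \<equiv> Poly_Mapping.single"
abbreviation "smul c \<equiv> Poly_Mapping.map ((*) c)"

lemma lookup_map_times: "lookup (smul c p) x = (c::'k::field) * lookup p x"
  by (transfer) (simp add: when_def)

global_interpretation pm: scalar_space "\<lambda>c::'k::field. smul c :: ('a \<Rightarrow>\<^sub>0 'k) \<Rightarrow> _"
  by unfold_locales (auto intro!: poly_mapping_eqI simp: lookup_map_times lookup_add algebra_simps)

definition family_scale :: "'k::field \<Rightarrow> ('i \<Rightarrow> 'a \<Rightarrow>\<^sub>0 'k) \<Rightarrow> 'i \<Rightarrow> 'a \<Rightarrow>\<^sub>0 'k" where
  "family_scale c y = (\<lambda>i. smul c (y i))"

lemma sum_apply_fun: "(\<Sum>x\<in>A. f x) i = (\<Sum>x\<in>A. f x i)"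
  by (induction A rule: infinite_finite_induct) auto

global_interpretation fam: scalar_space "family_scale :: 'k::field \<Rightarrow> ('i \<Rightarrow> 'a \<Rightarrow>\<^sub>0 'k) \<Rightarrow> _"
  by unfold_locales
    (auto intro!: ext poly_mapping_eqI simp: family_scale_def lookup_map_times lookup_add algebra_simps)

definition supported_on :: "'a set \<Rightarrow> ('a \<Rightarrow>\<^sub>0 'k::field) set" where
  "supported_on X = {p. keys p \<subseteq> X}"

lemma supported_on_iff: "p \<in> supported_on X \<longleftrightarrow> (\<forall>x. x \<notin> X \<longrightarrow> lookup p x = 0)"
  by (auto simp: supported_on_def in_keys_iff)

lemma subspace_supported_on: "pm.vs.subspace (supported_on X)"
  by (rule pm.vs.subspaceI) (auto simp: supported_on_iff lookup_add lookup_map_times)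

lemma supported_on_expand:
  assumes "finite X" "p \<in> supported_on X"
  shows "p = (\<Sum>x\<in>X. smul (lookup p x) (single x 1))"
proof (rule poly_mapping_eqI)
  fix y
  have "lookup (\<Sum>x\<in>X. smul (lookup p x) (single x 1)) y
      = (\<Sum>x\<in>X. if x = y then lookup p x else 0)"
    by (auto simp: lookup_sum lookup_map_times lookup_single when_def intro!: sum.cong)
  then show "lookup p y = lookup (\<Sum>x\<in>X. smul (lookup p x) (single x 1)) y"
    using assms by (auto simp: supported_on_iff)
qed

lemma supported_on_span:
  assumes "finite X"
  shows "supported_on X \<subseteq> pm.vs.span ((\<lambda>x. single x (1::'k::field)) ` X)"
proof
  fix p :: "'a \<Rightarrow>\<^sub>0 'k" assume "p \<in> supported_on X"
  then show "p \<in> pm.vs.span ((\<lambda>x. single x 1) ` X)"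
    by (subst supported_on_expand[OF assms])
      (assumption, rule pm.vs.span_sum, intro pm.vs.span_scale pm.vs.span_base imageI)
qed

lemma fin_spanned_supported_on: "finite X \<Longrightarrow> pm.fin_spanned (supported_on X)"
  unfolding pm.fin_spanned_def using supported_on_span finite_imageI by blast

lemma dim_supported_on:
  assumes "finite X"
  shows "pm.vs.dim (supported_on X :: ('a \<Rightarrow>\<^sub>0 'k::field) set) = card X"
proof (rule pm.vs.dim_unique)
  let ?e = "\<lambda>x. single x (1::'k)"
  have inj: "inj_on ?e X" by (rule inj_onI) (metis keys_single singleton_inject zero_neq_one)
  show "?e ` X \<subseteq> supported_on X" by (auto simp: supported_on_def)
  show "supported_on X \<subseteq> pm.vs.span (?e ` X)" by (rule supported_on_span[OF assms])
  show "card (?e ` X) = card X" by (rule card_image[OF inj])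
  show "pm.vs.independent (?e ` X)"
  proof
    assume "pm.vs.dependent (?e ` X)"
    then obtain x where x: "x \<in> X" "?e x \<in> pm.vs.span (?e ` X - {?e x})"
      unfolding pm.vs.dependent_def by blast
    have "pm.vs.span (?e ` X - {?e x}) \<subseteq> supported_on (X - {x})"
      by (rule pm.vs.span_minimal[OF _ subspace_supported_on]) (auto simp: supported_on_def)
    with x(2) show False by (auto simp: supported_on_def)
  qed
qed

lemma fin_spanned_family:
  assumes "finite I" "finite X" "\<And>y. y \<in> V \<Longrightarrow> (\<forall>i. y i \<in> supported_on X) \<and> (\<forall>i. i \<notin> I \<longrightarrow> y i = 0)"
  shows "fam.fin_spanned (V :: ('i \<Rightarrow> 'a \<Rightarrow>\<^sub>0 'k::field) set)"
proof -
  define e where "e = (\<lambda>(i :: 'i, x :: 'a) j. if j = i then single x (1::'k) else 0 :: 'a \<Rightarrow>\<^sub>0 'k)"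
  have "y \<in> fam.vs.span (e ` (I \<times> X))" if y: "y \<in> V" for y
  proof -
    have "y = (\<Sum>i\<in>I. \<Sum>x\<in>X. family_scale (lookup (y i) x) (e (i, x)))"
    proof
      fix j
      have "(\<Sum>i\<in>I. \<Sum>x\<in>X. family_scale (lookup (y i) x) (e (i, x))) j
          = (\<Sum>i\<in>I. if i = j then (\<Sum>x\<in>X. smul (lookup (y i) x) (single x 1)) else 0)"
        by (auto simp: sum_apply_fun family_scale_def e_def intro!: sum.cong)
      also have "\<dots> = (\<Sum>i\<in>I. if i = j then y i else 0)"
        using assms(3)[OF y]
        by (intro sum.cong) (auto simp: supported_on_expand[OF assms(2), symmetric] simp del: map_single)
      also have "\<dots> = y j" using assms(1) assms(3)[OF y] by auto
      finally show "y j = (\<Sum>i\<in>I. \<Sum>x\<in>X. family_scale (lookup (y i) x) (e (i, x))) j" by simp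
    qed
    also have "\<dots> \<in> fam.vs.span (e ` (I \<times> X))"
      by (intro fam.vs.span_sum fam.vs.span_scale fam.vs.span_base imageI) auto
    finally show ?thesis .
  qed
  then show ?thesis unfolding fam.fin_spanned_def
    using assms(1,2) by (intro exI[of _ "e ` (I \<times> X)"]) auto
qed

section \<open>Annihilators under the coordinate pairing\<close>

definition pairing :: "('a \<Rightarrow>\<^sub>0 'k::field) \<Rightarrow> ('a \<Rightarrow>\<^sub>0 'k) \<Rightarrow> 'k" where
  "pairing p q = (\<Sum>x\<in>keys p. lookup p x * lookup q x)"

lemma pairing_eq: "finite X \<Longrightarrow> keys p \<subseteq> X \<Longrightarrow> pairing p q = (\<Sum>x\<in>X. lookup p x * lookup q x)"
  unfolding pairing_def by (rule sum.mono_neutral_left) (auto simp: in_keys_iff)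

lemma pairing_add_left: "pairing (p + p') q = pairing p q + pairing p' q"
proof -
  let ?X = "keys p \<union> keys p'"
  have "keys (p + p') \<subseteq> ?X" by (rule keys_add)
  then show ?thesis
    by (simp add: pairing_eq[of ?X] lookup_add algebra_simps sum.distrib)
qed

lemma pairing_scale_left: "pairing (smul c p) q = c * pairing p q"
proof -
  have "keys (smul c p) \<subseteq> keys p" by (auto simp: in_keys_iff lookup_map_times)
  then show ?thesis
    by (simp add: pairing_eq[of "keys p"] lookup_map_times sum_distrib_left mult.assoc)
qed

lemma pairing_add_right: "pairing p (q + q') = pairing p q + pairing p q'"
  by (simp add: pairing_def lookup_add algebra_simps sum.distrib)

lemma pairing_scale_right: "pairing p (smul c q) = c * pairing p q"
  by (simp add: pairing_def lookup_map_times sum_distrib_left algebra_simps)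

text \<open>The coordinate basis identifies the functions on a finite set with their own dual, so
  that chains and cochains can share one space.\<close>

definition annih :: "'a set \<Rightarrow> ('a \<Rightarrow>\<^sub>0 'k::field) set \<Rightarrow> ('a \<Rightarrow>\<^sub>0 'k) set" where
  "annih X V = {q \<in> supported_on X. \<forall>p\<in>V. pairing p q = 0}"

lemma subspace_annih: "pm.vs.subspace (annih X V)"
  unfolding annih_def
  by (rule pm.vs.subspaceI)
    (auto simp: pairing_add_right pairing_scale_right pm.vs.subspace_add pm.vs.subspace_scale
      subspace_supported_on pm.vs.subspace_0, simp add: pairing_def)

lemma annih_span: "annih X (pm.vs.span V) = annih X V"
proof -
  have "pairing p q = 0" if q: "\<forall>p\<in>V. pairing p q = 0" and p: "p \<in> pm.vs.span V" for p q
  proof -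
    have "pm.vs.span V \<subseteq> {p. pairing p q = 0}"
    proof (rule pm.vs.span_minimal)
      show "pm.vs.subspace {p. pairing p q = 0}"
        by (rule pm.vs.subspaceI) (auto simp: pairing_add_left pairing_scale_left, simp add: pairing_def)
    qed (use q in blast)
    with p show ?thesis by blast
  qed
  then show ?thesis unfolding annih_def using pm.vs.span_superset by blast
qed

lemma vector_space_field: "vector_space ((*) :: 'k::field \<Rightarrow> 'k \<Rightarrow> 'k)"
  by unfold_locales (auto simp: algebra_simps)

text \<open>The functional that is \<open>1\<close> on \<open>b\<close> and \<open>0\<close> on
  \<open>B\<close> extends to the whole space; its values on the coordinate vectors of
  \<open>X\<close> are the coefficients of \<open>q\<close>.\<close>

lemma exists_pairing_separating:
  fixes b :: "'a \<Rightarrow>\<^sub>0 'k::field"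
  assumes "finite X" "insert b B \<subseteq> supported_on X" "pm.vs.independent (insert b B)" "b \<notin> B"
  obtains q where "q \<in> annih X B" "pairing b q = 1"
proof -
  interpret pair: vector_space_pair "\<lambda>c::'k. smul c :: ('a \<Rightarrow>\<^sub>0 'k) \<Rightarrow> _" "(*) :: 'k \<Rightarrow> 'k \<Rightarrow> 'k"
    unfolding vector_space_pair_def using pm.vs.vector_space_axioms vector_space_field by blast
  obtain f :: "('a \<Rightarrow>\<^sub>0 'k) \<Rightarrow> 'k" where lin: "Vector_Spaces.linear (\<lambda>c. smul c) (*) f"
    and f: "\<forall>x\<in>insert b B. f x = (if x = b then 1 else 0)"
    using pair.linear_independent_extend[OF assms(3), of "\<lambda>x. if x = b then 1 else 0"] by blast
  interpret f: Vector_Spaces.linear "\<lambda>c. smul c" "(*)" f by (rule lin)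
  define q where "q = (\<Sum>x\<in>X. single x (f (single x 1)))"
  have lq: "lookup q x = (if x \<in> X then f (single x 1) else 0)" for x
    unfolding q_def using assms(1) by (simp add: lookup_sum lookup_single when_def)
  have pq: "pairing p q = f p" if "p \<in> supported_on X" for p
  proof -
    have "f p = (\<Sum>x\<in>X. lookup p x * f (single x 1))"
      by (subst supported_on_expand[OF assms(1) that]) (simp add: f.sum f.scale del: map_single)
    then show ?thesis using pairing_eq[OF assms(1), of p q] that by (simp add: lq supported_on_def)
  qed
  have "q \<in> annih X B"
    unfolding annih_def using assms(2,4) f pq by (auto simp: supported_on_iff lq subset_iff)
  moreover have "pairing b q = 1" using pq[of b] assms(2) f by auto
  ultimately show thesis by (rule that)
qed

text \<open>Each further independent vector lowers the dimension of the annihilator by exactly one: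
  the separating \<open>q\<close> spans a complement of the new annihilator, and \<open>q\<close>
  itself is not in it.\<close>

lemma dim_annih_independent:
  fixes B :: "('a \<Rightarrow>\<^sub>0 'k::field) set"
  assumes "finite X" "finite B" "B \<subseteq> supported_on X" "pm.vs.independent B"
  shows "pm.vs.dim (annih X B) + card B = card X"
  using assms(2-)
proof (induction B rule: finite_induct)
  case empty
  then show ?case using dim_supported_on[OF assms(1)] by (simp add: annih_def)
next
  case (insert b B)
  let ?U = "annih X B" and ?U' = "annih X (insert b B)"
  have IH: "pm.vs.dim ?U + card B = card X"
    using insert pm.vs.independent_mono[OF insert.prems(2), of B] by auto
  have fin: "pm.fin_spanned (annih X V)" for V :: "('a \<Rightarrow>\<^sub>0 'k) set"
    by (rule pm.fin_spanned_mono[OF fin_spanned_supported_on[OF assms(1)]]) (auto simp: annih_def)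
  have sub: "?U' \<subseteq> ?U" by (auto simp: annih_def)
  obtain q where q: "q \<in> ?U" "pairing b q = 1"
    by (rule exists_pairing_separating[OF assms(1) insert.prems insert.hyps(2)])
  have "?U \<subseteq> pm.vs.span (?U' \<union> {q})"
  proof
    fix u assume u: "u \<in> ?U"
    let ?v = "u - smul (pairing b u) q"
    have "?v \<in> ?U"
      by (intro pm.vs.subspace_diff pm.vs.subspace_scale subspace_annih u q)
    moreover have "pairing b ?v = 0"
      using pairing_add_right[of b ?v "smul (pairing b u) q"] q(2)
      by (simp add: pairing_scale_right)
    ultimately have "?v \<in> ?U'" by (auto simp: annih_def)
    then have "?v + smul (pairing b u) q \<in> pm.vs.span (?U' \<union> {q})"
      by (intro pm.vs.span_add pm.vs.span_scale pm.vs.span_base) auto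
    then show "u \<in> pm.vs.span (?U' \<union> {q})" by simp
  qed
  then have le: "pm.vs.dim ?U \<le> pm.vs.dim ?U' + 1"
    using pm.dim_le_add_card[OF fin, of "{q}" ?U] by simp
  obtain C where C: "finite C" "C \<subseteq> ?U" "?U \<subseteq> pm.vs.span (?U' \<union> C)"
      "pm.vs.dim ?U = pm.vs.dim ?U' + card C"
    by (rule pm.obtain_complement[OF fin subspace_annih sub])
  have "C \<noteq> {}"
  proof
    assume "C = {}"
    then have "q \<in> ?U'" using C(3) q(1) pm.vs.span_eq_iff[THEN iffD2, OF subspace_annih, of X "insert b B"] by auto
    then show False using q(2) by (auto simp: annih_def)
  qed
  then have "card C \<ge> 1" using C(1) by (simp add: Suc_leI card_gt_0_iff)
  then show ?case using le C(4) IH insert.hyps by simp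
qed

lemma dim_annih:
  fixes V :: "('a \<Rightarrow>\<^sub>0 'k::field) set"
  assumes "finite X" "V \<subseteq> supported_on X" "pm.vs.subspace V"
  shows "pm.vs.dim (annih X V) + pm.vs.dim V = card X"
proof -
  obtain B where B: "finite B" "B \<subseteq> V" "pm.vs.independent B" "V \<subseteq> pm.vs.span B" "card B = pm.vs.dim V"
    by (rule pm.obtain_finite_basis[OF pm.fin_spanned_mono[OF fin_spanned_supported_on[OF assms(1)] assms(2)]])
  have "pm.vs.span B = V" using B(2,4) pm.vs.span_minimal[OF _ assms(3)] by blast
  then have "annih X V = annih X B" using annih_span by metis
  then show ?thesis using dim_annih_independent[OF assms(1) B(1) _ B(3)] B(2,5) assms(2) by auto
qed

text \<open>The instances of \<open>relates\<close> that occur: cochains with cochains, cochains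
  with polynomials or with simplicial cochains, and polynomials with polynomials.\<close>

global_interpretation fam_fam: two_vector_spaces
  "family_scale :: 'k::field \<Rightarrow> (nat set \<Rightarrow> 'k mpoly) \<Rightarrow> _"
  "family_scale :: 'k::field \<Rightarrow> (nat set \<Rightarrow> 'k mpoly) \<Rightarrow> _" ..

global_interpretation fam_pm: two_vector_spaces
  "family_scale :: 'k::field \<Rightarrow> (nat set \<Rightarrow> 'k mpoly) \<Rightarrow> _"
  "\<lambda>c::'k. smul c :: ('a \<Rightarrow>\<^sub>0 'k) \<Rightarrow> _" ..

global_interpretation pm_pm: two_vector_spaces
  "\<lambda>c::'k::field. smul c :: ('a \<Rightarrow>\<^sub>0 'k) \<Rightarrow> _"
  "\<lambda>c::'k. smul c :: ('b \<Rightarrow>\<^sub>0 'k) \<Rightarrow> _" ..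

section \<open>Homogeneous polynomials and graded ideals\<close>

definition mons :: "nat \<Rightarrow> int \<Rightarrow> (nat \<Rightarrow>\<^sub>0 nat) set" where
  "mons n l = {m. keys m \<subseteq> {1..n} \<and> int (mon_degree m) = l}"

text \<open>Degrees are integers, so that the components of negative degree vanish and no boundary cases
  arise in the recursions below.\<close>

definition homog :: "nat \<Rightarrow> int \<Rightarrow> 'k::field mpoly set" where
  "homog n l = supported_on (mons n l)"

lemma mon_degree_eq: "keys m \<subseteq> {1..n} \<Longrightarrow> mon_degree m = (\<Sum>i=1..n. lookup m i)"
  unfolding mon_degree_def by (rule sum.mono_neutral_left) (auto simp: in_keys_iff)

lemma keys_add_nat: "keys (a + b :: nat \<Rightarrow>\<^sub>0 nat) = keys a \<union> keys b"
  by (auto simp: in_keys_iff lookup_add)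

lemma mon_degree_add: "mon_degree (a + b) = mon_degree a + mon_degree b"
proof -
  have "mon_degree c = (\<Sum>i\<in>keys a \<union> keys b. lookup c i)" if "keys c \<subseteq> keys a \<union> keys b" for c
    unfolding mon_degree_def using that by (intro sum.mono_neutral_left) (auto simp: in_keys_iff)
  then show ?thesis by (simp add: keys_add_nat lookup_add sum.distrib)
qed

lemma mon_degree_single: "mon_degree (single i k) = k"
  by (simp add: mon_degree_def)

lemma finite_mons: "finite (mons n l)"
proof -
  let ?F = "{f. \<forall>i. (i \<in> {1..n} \<longrightarrow> f i \<in> {..nat l}) \<and> (i \<notin> {1..n} \<longrightarrow> f i = (0::nat))}"
  have fin: "finite ?F" by (rule finite_set_of_finite_funs) auto
  have inj: "inj (lookup :: (nat \<Rightarrow>\<^sub>0 nat) \<Rightarrow> nat \<Rightarrow> nat)"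
    by (rule injI) (simp add: poly_mapping_eqI)
  have "mons n l \<subseteq> lookup -` ?F"
  proof
    fix m assume m: "m \<in> mons n l"
    have "lookup m i \<le> nat l" if "i \<in> {1..n}" for i
    proof -
      have "lookup m i \<le> (\<Sum>i=1..n. lookup m i)" using that by (intro member_le_sum) auto
      also have "\<dots> = mon_degree m" using m mon_degree_eq[of m n] by (simp add: mons_def)
      also have "\<dots> = nat l" using m by (auto simp: mons_def)
      finally show ?thesis .
    qed
    then show "m \<in> lookup -` ?F"
      using m by (auto simp: mons_def in_keys_iff subset_iff)
  qed
  then show ?thesis using finite_vimageI[OF fin inj] by (rule finite_subset)
qed

lemma mons_0: "mons n 0 = {0}"
proof -
  have "m = 0" if "mon_degree m = 0" for m :: "nat \<Rightarrow>\<^sub>0 nat"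
  proof (rule poly_mapping_eqI)
    fix i show "lookup m i = lookup 0 i"
      using that by (cases "i \<in> keys m") (auto simp: mon_degree_def in_keys_iff)
  qed
  then have "mons n 0 \<subseteq> {0}" unfolding mons_def by force
  moreover have "0 \<in> mons n 0" by (simp add: mons_def mon_degree_def)
  ultimately show ?thesis by blast
qed

lemma mons_add: "a \<in> mons n l \<Longrightarrow> b \<in> mons n l' \<Longrightarrow> a + b \<in> mons n (l + l')"
  by (auto simp: mons_def keys_add_nat mon_degree_add)

lemma single_in_mons: "v \<in> {1..n} \<Longrightarrow> single v 1 \<in> mons n 1"
  by (auto simp: mons_def mon_degree_single)

lemma mons_1D:
  assumes "m \<in> mons n 1"
  obtains v where "v \<in> {1..n}" "m = single v 1"
proof -
  have deg: "(\<Sum>i\<in>keys m. lookup m i) = 1"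
    using assms unfolding mons_def mon_degree_def by (simp del: of_nat_sum add: of_nat_eq_1_iff)
  then have "keys m \<noteq> {}" by auto
  then obtain v where v: "v \<in> keys m" by blast
  have "(\<Sum>i\<in>keys m - {v}. lookup m i) + lookup m v = 1"
    using deg v by (simp add: sum.remove add.commute)
  moreover have "lookup m v \<ge> 1" using v by (simp add: in_keys_iff Suc_leI)
  ultimately have 1: "lookup m v = 1" "(\<Sum>i\<in>keys m - {v}. lookup m i) = 0" by linarith+
  then have "\<forall>i\<in>keys m - {v}. lookup m i = 0" by simp
  then have "m = single v 1"
    using 1(1) by (intro poly_mapping_eqI) (auto simp: lookup_single when_def in_keys_iff)
  then show thesis using that v assms by (auto simp: mons_def)
qed

lemma homog_subspace: "pm.vs.subspace (homog n l)"
  unfolding homog_def by (rule subspace_supported_on)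

lemmas homog_0 = pm.vs.subspace_0[OF homog_subspace]
  and homog_add = pm.vs.subspace_add[OF homog_subspace]
  and homog_diff = pm.vs.subspace_diff[OF homog_subspace]
  and homog_smul = pm.vs.subspace_scale[OF homog_subspace]
  and homog_sum = pm.vs.subspace_sum[OF homog_subspace]

lemma homog_fin_spanned: "pm.fin_spanned (homog n l)"
  unfolding homog_def by (rule fin_spanned_supported_on[OF finite_mons])

lemma homog_mult: "p \<in> homog n l \<Longrightarrow> q \<in> homog n l' \<Longrightarrow> p * q \<in> homog n (l + l')"
  using keys_mult[of p q] mons_add by (fastforce simp: homog_def supported_on_def)

lemma homog_mult1: "p \<in> homog n 1 \<Longrightarrow> q \<in> homog n (l - 1) \<Longrightarrow> p * q \<in> homog n l"
  using homog_mult[of p n 1 q "l - 1"] by simp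

lemma Var_homog: "v \<in> {1..n} \<Longrightarrow> Var v \<in> homog n 1"
  using single_in_mons by (auto simp: homog_def supported_on_def Var_def)

lemma smul_conv: "smul c p = single 0 (c::'k::field) * (p :: 'k mpoly)"
  by (rule mult_map_scale_conv_mult)

lemma smul_mult_left: "smul c p * q = smul c (p * (q :: 'k::field mpoly))"
  and smul_mult_right: "p * smul c q = smul c (p * q)"
  by (simp_all add: smul_conv mult.assoc mult.left_commute)

text \<open>Reduces multiplication by linear forms to multiplication by variables, for which
  contractions and division are available.\<close>

lemma linear_form_expand:
  fixes t :: "'k::field mpoly"
  assumes "t \<in> homog n 1"
  shows "t = (\<Sum>v=1..n. smul (lookup t (single v 1)) (Var v))"
proof -
  have "mons n 1 = (\<lambda>v. single v 1) ` {1..n}"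
    using mons_1D single_in_mons by (auto elim: mons_1D)
  moreover have "inj_on (\<lambda>v. single v (1::nat)) {1..n}"
    by (rule inj_onI) (metis keys_single singleton_inject zero_neq_one)
  moreover have "t = (\<Sum>x\<in>mons n 1. smul (lookup t x) (single x 1))"
    using supported_on_expand[OF finite_mons, of t n 1] assms unfolding homog_def by blast
  ultimately show ?thesis by (simp add: sum.reindex Var_def del: map_single)
qed

lemma lookup_single_mult:
  fixes p :: "'k::field mpoly"
  shows "lookup (single a c * p) (a + m) = c * lookup p m"
proof -
  have "single a c * p = (\<Sum>x\<in>keys p. single (a + x) (c * lookup p x))"
    by (subst supported_on_expand[of "keys p" p]) (auto simp: supported_on_def sum_distrib_left mult_single)
  then have "lookup (single a c * p) (a + m) = (\<Sum>x\<in>keys p. if x = m then c * lookup p x else 0)"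
    by (auto simp: lookup_sum lookup_single when_def intro!: sum.cong)
  then show ?thesis by (simp add: in_keys_iff)
qed

lemma lookup_var_mult:
  fixes p :: "'k::field mpoly"
  shows "lookup (Var u * p) m = (if lookup m u = 0 then 0 else lookup p (m - single u 1))"
proof (cases "lookup m u = 0")
  case True
  have "m \<notin> keys (Var u * p)"
  proof
    assume "m \<in> keys (Var u * p)"
    then obtain b where "m = single u 1 + b"
      using keys_mult[of "Var u" p] by (auto simp: Var_def)
    then show False using True by (simp add: lookup_add)
  qed
  then show ?thesis using True by (simp add: in_keys_iff)
next
  case False
  then have "m = single u 1 + (m - single u 1)"
    by (intro poly_mapping_eqI) (auto simp: lookup_add lookup_minus lookup_single when_def)
  then show ?thesis using False lookup_single_mult[of "single u 1" 1 p "m - single u 1"]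
    by (simp add: Var_def)
qed

section \<open>Graded pieces of ideals generated by nonfaces and linear forms\<close>

definition down_closed :: "nat set set \<Rightarrow> bool" where
  "down_closed \<Gamma> \<longleftrightarrow> (\<forall>A B. A \<in> \<Gamma> \<longrightarrow> B \<subseteq> A \<longrightarrow> B \<in> \<Gamma>)"

text \<open>For down-closed \<open>\<Gamma>\<close> this is a graded piece of the Stanley-Reisner
  ideal, given by all its monomials instead of the squarefree generators; it is thus a coordinate
  subspace.\<close>

definition nonface :: "nat \<Rightarrow> nat set set \<Rightarrow> int \<Rightarrow> 'k::field mpoly set" where
  "nonface n \<Gamma> l = supported_on {m \<in> mons n l. keys m \<notin> \<Gamma>}"

text \<open>The degree \<open>l\<close> component of the ideal \<open>I\<^sub>\<Gamma> + (U)\<close>, for a set \<open>U\<close> of linear forms.\<close>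

definition gr_ideal :: "nat \<Rightarrow> nat set set \<Rightarrow> 'k::field mpoly set \<Rightarrow> int \<Rightarrow> 'k mpoly set" where
  "gr_ideal n \<Gamma> U l = pm.vs.span (nonface n \<Gamma> l \<union> {u * q | u q. u \<in> U \<and> q \<in> homog n (l - 1)})"

lemma gr_ideal_subspace: "pm.vs.subspace (gr_ideal n \<Gamma> U l)"
  unfolding gr_ideal_def by (rule pm.vs.subspace_span)

lemmas gr_ideal_0 = pm.vs.subspace_0[OF gr_ideal_subspace]
  and gr_ideal_add = pm.vs.subspace_add[OF gr_ideal_subspace]
  and gr_ideal_diff = pm.vs.subspace_diff[OF gr_ideal_subspace]
  and gr_ideal_smul = pm.vs.subspace_scale[OF gr_ideal_subspace]
  and gr_ideal_sum = pm.vs.subspace_sum[OF gr_ideal_subspace]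

lemma nonface_gr_ideal: "p \<in> nonface n \<Gamma> l \<Longrightarrow> p \<in> gr_ideal n \<Gamma> U l"
  unfolding gr_ideal_def by (simp add: pm.vs.span_base)

lemma mult_gr_ideal: "u \<in> U \<Longrightarrow> q \<in> homog n (l - 1) \<Longrightarrow> u * q \<in> gr_ideal n \<Gamma> U l"
  unfolding gr_ideal_def by (rule pm.vs.span_base) blast

lemma gr_ideal_least:
  assumes "nonface n \<Gamma> l \<subseteq> V" "\<And>u q. u \<in> U \<Longrightarrow> q \<in> homog n (l - 1) \<Longrightarrow> u * q \<in> V" "pm.vs.subspace V"
  shows "gr_ideal n \<Gamma> U l \<subseteq> V"
  unfolding gr_ideal_def using assms by (intro pm.vs.span_minimal) auto

lemma gr_ideal_homog: "U \<subseteq> homog n 1 \<Longrightarrow> gr_ideal n \<Gamma> U l \<subseteq> homog n l"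
proof (rule gr_ideal_least)
  show "nonface n \<Gamma> l \<subseteq> homog n l" by (auto simp: nonface_def homog_def supported_on_def)
qed (auto simp: homog_subspace intro: homog_mult1)

lemma gr_ideal_mono: "\<Gamma>' \<subseteq> \<Gamma> \<Longrightarrow> U \<subseteq> U' \<Longrightarrow> gr_ideal n \<Gamma> U l \<subseteq> gr_ideal n \<Gamma>' U' l"
proof (rule gr_ideal_least)
  assume "\<Gamma>' \<subseteq> \<Gamma>"
  then have "nonface n \<Gamma> l \<subseteq> nonface n \<Gamma>' l" by (auto simp: nonface_def supported_on_def)
  then show "nonface n \<Gamma> l \<subseteq> gr_ideal n \<Gamma>' U' l" using nonface_gr_ideal by blast
qed (auto intro: mult_gr_ideal gr_ideal_subspace)

lemma gr_ideal_empty: "gr_ideal n \<Gamma> {} l = nonface n \<Gamma> l"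
  unfolding gr_ideal_def by (simp add: nonface_def pm.vs.span_eq_iff[THEN iffD2, OF subspace_supported_on])

lemma mem_gr_ideal_insert:
  assumes "p \<in> gr_ideal n \<Gamma> (insert t U) l"
  obtains p' q where "p' \<in> gr_ideal n \<Gamma> U l" "q \<in> homog n (l - 1)" "p = p' + t * q"
proof -
  let ?V = "{p' + t * q | p' q. p' \<in> gr_ideal n \<Gamma> U l \<and> q \<in> homog n (l - 1)}"
  have in_V: "p' + t * q \<in> ?V" if "p' \<in> gr_ideal n \<Gamma> U l" "q \<in> homog n (l - 1)" for p' q
    using that by blast
  have "gr_ideal n \<Gamma> (insert t U) l \<subseteq> ?V"
  proof (rule gr_ideal_least)
    show "nonface n \<Gamma> l \<subseteq> ?V"
      using in_V[OF nonface_gr_ideal homog_0] by auto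
    show "u * q \<in> ?V" if "u \<in> insert t U" "q \<in> homog n (l - 1)" for u q
    proof (cases "u = t")
      case True
      then show ?thesis using in_V[OF gr_ideal_0 that(2)] by simp
    next
      case False
      then show ?thesis using that in_V[OF mult_gr_ideal[OF _ that(2)] homog_0] by auto
    qed
    have "pm.vs.subspace {x + y | x y. x \<in> gr_ideal n \<Gamma> U l \<and> y \<in> (\<lambda>q. t * q) ` homog n (l - 1)}"
    proof (rule pm.vs.subspace_sums[OF gr_ideal_subspace])
      show "pm.vs.subspace ((\<lambda>q. t * q) ` homog n (l - 1))"
        by (rule pm.vs.subspaceI)
          (auto simp: smul_mult_right[symmetric] distrib_left[symmetric]
            intro: homog_add homog_smul intro!: imageI, metis homog_0 imageI mult_zero_right)
    qed
    also have "{x + y | x y. x \<in> gr_ideal n \<Gamma> U l \<and> y \<in> (\<lambda>q. t * q) ` homog n (l - 1)} = ?V" by blast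
    finally show "pm.vs.subspace ?V" .
  qed
  then show thesis using assms that by blast
qed

text \<open>Multiplying by a fixed \<open>q\<close> is linear, so only the span of the forms
  matters. This permits replacing parameters by another basis of their span.\<close>

lemma gr_ideal_span_cong:
  fixes U U' :: "'k::field mpoly set"
  assumes "U \<subseteq> pm.vs.span U'"
  shows "gr_ideal n \<Gamma> U l \<subseteq> gr_ideal n \<Gamma> U' l"
proof (rule gr_ideal_least)
  fix u q :: "'k mpoly" assume u: "u \<in> U" and q: "q \<in> homog n (l - 1)"
  have "pm.vs.span U' \<subseteq> {u. u * q \<in> gr_ideal n \<Gamma> U' l}"
    by (rule pm.vs.span_minimal, use q in \<open>auto intro: mult_gr_ideal\<close>)
      (auto intro!: pm.vs.subspaceI simp: distrib_right smul_mult_left intro: gr_ideal_add gr_ideal_smul gr_ideal_0)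
  then show "u * q \<in> gr_ideal n \<Gamma> U' l" using u assms by blast
qed (auto intro: nonface_gr_ideal gr_ideal_subspace)

lemma Var_mult_nonface:
  assumes "v \<in> {1..n}" "p \<in> nonface n \<Gamma>' l" "\<And>A. insert v A \<in> \<Gamma> \<Longrightarrow> A \<in> \<Gamma>'"
  shows "Var v * p \<in> nonface n \<Gamma> (l + 1)"
proof -
  have "m \<in> mons n (l + 1) \<and> keys m \<notin> \<Gamma>" if m: "m \<in> keys (Var v * p)" for m
  proof -
    obtain b where b: "b \<in> keys p" "m = single v 1 + b"
      using m keys_mult[of "Var v" p] by (auto simp: Var_def)
    have "b \<in> mons n l" "keys b \<notin> \<Gamma>'" using b(1) assms(2) by (auto simp: nonface_def supported_on_def)
    moreover have "keys m = insert v (keys b)" by (simp add: b(2) keys_add_nat)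
    ultimately show ?thesis
      using mons_add[OF single_in_mons[OF assms(1)], of b l] b(2) assms(3) by (auto simp: add.commute)
  qed
  then show ?thesis by (auto simp: nonface_def supported_on_def)
qed

text \<open>The condition linking the complexes covers two cases:
  \<open>\<Gamma>' = \<Gamma>\<close> down-closed, which gives the ideal property, and
  \<open>\<Gamma>'\<close> the star of \<open>v\<close> in \<open>\<Gamma>\<close>, whose larger
  ideal is carried back into that of \<open>\<Gamma>\<close> by \<open>Var v\<close>.\<close>

lemma Var_mult_gr_ideal:
  assumes "v \<in> {1..n}" "p \<in> gr_ideal n \<Gamma>' U l" "\<And>A. insert v A \<in> \<Gamma> \<Longrightarrow> A \<in> \<Gamma>'"
  shows "Var v * p \<in> gr_ideal n \<Gamma> U (l + 1)"
proof -
  have "gr_ideal n \<Gamma>' U l \<subseteq> {p. Var v * p \<in> gr_ideal n \<Gamma> U (l + 1)}"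
  proof (rule gr_ideal_least)
    show "nonface n \<Gamma>' l \<subseteq> {p. Var v * p \<in> gr_ideal n \<Gamma> U (l + 1)}"
      using Var_mult_nonface[OF assms(1) _ assms(3)] nonface_gr_ideal by blast
    show "u * q \<in> {p. Var v * p \<in> gr_ideal n \<Gamma> U (l + 1)}" if "u \<in> U" "q \<in> homog n (l - 1)" for u q
    proof -
      have "Var v * q \<in> homog n (l + 1 - 1)" using homog_mult1[OF Var_homog[OF assms(1)] that(2)] by simp
      from mult_gr_ideal[OF that(1) this] show ?thesis by (simp add: mult.left_commute)
    qed
    show "pm.vs.subspace {p. Var v * p \<in> gr_ideal n \<Gamma> U (l + 1)}"
      by (rule pm.vs.subspaceI)
        (auto simp: distrib_left smul_mult_right intro: gr_ideal_0 gr_ideal_add gr_ideal_smul)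
  qed
  with assms(2) show ?thesis by blast
qed

lemma down_closed_insert: "down_closed \<Gamma> \<Longrightarrow> insert v A \<in> \<Gamma> \<Longrightarrow> A \<in> \<Gamma>"
  unfolding down_closed_def by blast

lemma linear_mult_gr_ideal:
  assumes "t \<in> homog n 1" "p \<in> gr_ideal n \<Gamma> U l" "down_closed \<Gamma>"
  shows "t * p \<in> gr_ideal n \<Gamma> U (l + 1)"
proof -
  have "Var v * p \<in> gr_ideal n \<Gamma> U (l + 1)" if "v \<in> {1..n}" for v
    using Var_mult_gr_ideal[OF that assms(2)] down_closed_insert[OF assms(3)] by blast
  then have "(\<Sum>v=1..n. smul (lookup t (single v 1)) (Var v * p)) \<in> gr_ideal n \<Gamma> U (l + 1)"
    by (intro gr_ideal_sum gr_ideal_smul)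
  also have "(\<Sum>v=1..n. smul (lookup t (single v 1)) (Var v * p))
      = (\<Sum>v=1..n. smul (lookup t (single v 1)) (Var v)) * p"
    by (simp add: sum_distrib_right smul_mult_left)
  finally show ?thesis using linear_form_expand[OF assms(1)] by simp
qed

section \<open>Regularity on stars\<close>

text \<open>Division by the variable of index \<open>v\<close>, discarding the monomials it does not
  divide. This linear map is a left inverse of multiplication by \<open>Var v\<close> and commutes
  with multiplication by linear forms free of that variable.\<close>

definition lower :: "nat \<Rightarrow> 'k::field mpoly \<Rightarrow> 'k mpoly" where
  "lower v p = Poly_Mapping.map_key (\<lambda>m. single v 1 + m) p"

lemma lookup_lower: "lookup (lower v p) m = lookup p (single v 1 + m)"
  unfolding lower_def by (simp add: map_key.rep_eq inj_def)

lemma lower_add: "lower v (p + q) = lower v p + lower v q"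
  and lower_smul: "lower v (smul c p) = smul c (lower v p)"
  and lower_0: "lower v 0 = 0"
  by (rule poly_mapping_eqI; simp add: lookup_lower lookup_add lookup_map_times)+

lemma lower_sum: "lower v (\<Sum>x\<in>A. f x) = (\<Sum>x\<in>A. lower v (f x))"
  by (induction A rule: infinite_finite_induct) (auto simp: lower_add lower_0)

lemma lower_homog: "p \<in> homog n (l + 1) \<Longrightarrow> lower v p \<in> homog n l"
proof -
  assume p: "p \<in> homog n (l + 1)"
  have "m \<in> mons n l" if "m \<in> keys (lower v p)" for m
  proof -
    have "single v 1 + m \<in> keys p" using that by (simp add: in_keys_iff lookup_lower)
    then have "single v 1 + m \<in> mons n (l + 1)" using p by (auto simp: homog_def supported_on_def)
    then show ?thesis by (auto simp: mons_def keys_add_nat mon_degree_add mon_degree_single)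
  qed
  then show ?thesis by (auto simp: homog_def supported_on_def)
qed

lemma lower_Var_mult: "lower v (Var v * p) = p"
  by (rule poly_mapping_eqI) (simp add: lookup_lower Var_def lookup_single_mult)

lemma lower_Var_mult_other: "u \<noteq> v \<Longrightarrow> lower v (Var u * p) = Var u * lower v p"
proof (rule poly_mapping_eqI)
  fix m :: "nat \<Rightarrow>\<^sub>0 nat" assume "u \<noteq> v"
  then have "lookup (single v 1 + m) u = lookup m u" by (simp add: lookup_add lookup_single)
  moreover have "single v 1 + m - single u 1 = single v 1 + (m - single u 1)" if "lookup m u \<noteq> 0"
    using that \<open>u \<noteq> v\<close>
    by (intro poly_mapping_eqI) (auto simp: lookup_add lookup_minus lookup_single when_def)
  ultimately show "lookup (lower v (Var u * p)) m = lookup (Var u * lower v p) m"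
    by (simp add: lookup_lower lookup_var_mult)
qed

abbreviation (input) "var_coeff v t \<equiv> lookup t (single v 1)"

lemma lower_linear_mult:
  assumes "t \<in> homog n 1" "var_coeff v t = 0"
  shows "lower v (t * q) = t * lower v q"
proof -
  have "lower v (smul (var_coeff u t) (Var u * q)) = smul (var_coeff u t) (Var u * lower v q)" for u
    using assms(2) by (cases "u = v") (auto simp: lower_smul lower_Var_mult_other lower_0)
  then have "lower v ((\<Sum>u=1..n. smul (var_coeff u t) (Var u)) * q)
      = (\<Sum>u=1..n. smul (var_coeff u t) (Var u)) * lower v q"
    by (simp add: sum_distrib_right smul_mult_left lower_sum)
  then show ?thesis using linear_form_expand[OF assms(1)] by simp
qed

text \<open>When \<open>\<Delta>\<close> is down-closed, the star of a nonface is the empty family;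
  \<open>down_closed\<close> therefore admits the empty family, so that nonfaces need no separate
  treatment.\<close>

definition star :: "nat set set \<Rightarrow> nat set \<Rightarrow> nat set set" where
  "star \<Delta> F = {A. A \<union> F \<in> \<Delta>}"

lemma star_empty: "star \<Delta> {} = \<Delta>"
  and star_insert: "star \<Delta> (insert v F) = star (star \<Delta> F) {v}"
  and mem_star: "A \<in> star \<Delta> F \<longleftrightarrow> A \<union> F \<in> \<Delta>"
  by (auto simp: star_def)

lemma down_closed_star: "down_closed \<Delta> \<Longrightarrow> down_closed (star \<Delta> F)"
  unfolding down_closed_def star_def by (blast intro: Un_mono)

lemma star_mono: "down_closed \<Delta> \<Longrightarrow> F \<subseteq> G \<Longrightarrow> star \<Delta> G \<subseteq> star \<Delta> F"
  unfolding down_closed_def star_def by blast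

lemma star_subset: "down_closed \<Gamma> \<Longrightarrow> star \<Gamma> F \<subseteq> \<Gamma>"
  using star_mono[of \<Gamma> "{}" F] by (simp add: star_empty)

text \<open>Whether a support belongs to \<open>star \<Gamma> {v}\<close> does not depend on its
  containing \<open>v\<close>, so dividing a nonface monomial by the variable leaves a nonface
  monomial. As the forms in \<open>U\<close> avoid the variable, it can be cancelled modulo the
  whole ideal.\<close>

lemma lower_gr_ideal:
  assumes "U \<subseteq> homog n 1" "\<And>u. u \<in> U \<Longrightarrow> var_coeff v u = 0" "p \<in> gr_ideal n (star \<Gamma> {v}) U (l + 1)"
  shows "lower v p \<in> gr_ideal n (star \<Gamma> {v}) U l"
proof -
  let ?I = "gr_ideal n (star \<Gamma> {v}) U"
  have "?I (l + 1) \<subseteq> {p. lower v p \<in> ?I l}"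
  proof (rule gr_ideal_least)
    show "nonface n (star \<Gamma> {v}) (l + 1) \<subseteq> {p. lower v p \<in> ?I l}"
    proof
      fix p :: "'a mpoly" assume p: "p \<in> nonface n (star \<Gamma> {v}) (l + 1)"
      have "m \<in> mons n l \<and> keys m \<notin> star \<Gamma> {v}" if "m \<in> keys (lower v p)" for m
      proof -
        have "single v 1 + m \<in> keys p" using that by (simp add: in_keys_iff lookup_lower)
        then have "single v 1 + m \<in> mons n (l + 1)" "keys (single v 1 + m) \<notin> star \<Gamma> {v}"
          using p by (auto simp: nonface_def supported_on_def)
        then show ?thesis
          by (auto simp: mons_def keys_add_nat mon_degree_add mon_degree_single mem_star)
      qed
      then have "lower v p \<in> nonface n (star \<Gamma> {v}) l" by (auto simp: nonface_def supported_on_def)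
      then show "p \<in> {p. lower v p \<in> ?I l}" using nonface_gr_ideal by blast
    qed
    show "u * q \<in> {p. lower v p \<in> ?I l}"
      if "u \<in> U" "q \<in> homog n (l + 1 - 1)" for u q
    proof -
      have "lower v q \<in> homog n (l - 1)" using lower_homog[of q n "l - 1"] that(2) by simp
      from mult_gr_ideal[OF that(1) this, of \<Gamma>] show ?thesis
        using lower_linear_mult[of u n v q] assms(1,2) that(1) mult_gr_ideal[OF that(1) \<open>lower v q \<in> _\<close>]
        by auto
    qed
    show "pm.vs.subspace {p. lower v p \<in> ?I l}"
      by (rule pm.vs.subspaceI)
        (auto simp: lower_add lower_0 lower_smul intro: gr_ideal_0 gr_ideal_add gr_ideal_smul)
  qed
  with assms(3) show ?thesis by blast
qed

section \<open>Regular and weakly regular linear forms\<close>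

definition regular_on :: "nat \<Rightarrow> nat set set \<Rightarrow> 'k::field mpoly set \<Rightarrow> 'k mpoly \<Rightarrow> bool" where
  "regular_on n \<Gamma> U t \<longleftrightarrow>
    (\<forall>l. \<forall>q\<in>homog n l. t * q \<in> gr_ideal n \<Gamma> U (l + 1) \<longrightarrow> q \<in> gr_ideal n \<Gamma> U l)"

text \<open>Graded form of the Buchsbaum inclusion between colon modules, with the maximal ideal
  tested on the variables.\<close>

definition weakly_regular_on :: "nat \<Rightarrow> nat set set \<Rightarrow> 'k::field mpoly set \<Rightarrow> 'k mpoly \<Rightarrow> bool" where
  "weakly_regular_on n \<Gamma> U t \<longleftrightarrow>
    (\<forall>l. \<forall>q\<in>homog n l. t * q \<in> gr_ideal n \<Gamma> U (l + 1) \<longrightarrow>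
      (\<forall>v\<in>{1..n}. Var v * q \<in> gr_ideal n \<Gamma> U (l + 1)))"

lemma regular_imp_weakly_regular:
  assumes "regular_on n \<Gamma> U t" "down_closed \<Gamma>"
  shows "weakly_regular_on n \<Gamma> U t"
  using assms linear_mult_gr_ideal Var_homog unfolding regular_on_def weakly_regular_on_def by blast

text \<open>On a star of \<open>v\<close> a linear form involving \<open>x\<^sub>v\<close> is regular modulo forms which do not: compare
  coefficients of powers of \<open>x\<^sub>v\<close>, starting from the highest.\<close>

lemma regular_on_star_leading:
  assumes U: "U \<subseteq> homog n 1" "\<And>u. u \<in> U \<Longrightarrow> var_coeff v u = 0"
    and t: "t \<in> homog n 1" "var_coeff v t \<noteq> 0"
    and v: "v \<in> {1..n}" and \<Gamma>: "down_closed \<Gamma>"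
  shows "regular_on n (star \<Gamma> {v}) U t"
  unfolding regular_on_def
proof (intro allI ballI impI)
  let ?I = "gr_ideal n (star \<Gamma> {v}) U"
  fix l q assume q: "q \<in> homog n l" and tq: "t * q \<in> ?I (l + 1)"
  define c where "c = var_coeff v t"
  define t' where "t' = t - smul c (Var v)"
  have t': "t' \<in> homog n 1" "var_coeff v t' = 0"
    using t(1) Var_homog[OF v] by (auto simp: t'_def c_def lookup_minus lookup_map_times Var_def
        intro: homog_diff homog_smul simp del: map_single)
  have teq: "t = smul c (Var v) + t'" by (simp add: t'_def)
  define q' where "q' k = ((lower v) ^^ k) q" for k
  have q': "q' k \<in> homog n (l - int k)" for k
  proof (induction k)
    case 0
    then show ?case using q by (simp add: q'_def)
  next
    case (Suc k)
    then show ?case using lower_homog[of "q' k" n "l - int (Suc k)" v] by (simp add: q'_def)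
  qed
  \<comment> \<open>Dividing the product \<open>Suc k\<close> times leaves \<open>c\<close> times
    the \<open>k\<close>-th quotient of \<open>q\<close> plus \<open>t'\<close> times the next
    quotient. As \<open>c\<close> is invertible, membership passes from \<open>q' (Suc k)\<close>
    down to \<open>q' k\<close>.\<close>
  have low: "((lower v) ^^ Suc k) (t * q) = smul c (q' k) + t' * q' (Suc k)" for k
  proof (induction k)
    case 0
    then show ?case
      by (simp add: teq q'_def distrib_right lower_add smul_mult_left lower_smul lower_Var_mult
          lower_linear_mult[OF t'])
  next
    case (Suc k)
    have "((lower v) ^^ Suc (Suc k)) (t * q) = lower v (smul c (q' k) + t' * q' (Suc k))"
      using Suc by simp
    also have "\<dots> = smul c (q' (Suc k)) + t' * q' (Suc (Suc k))"
      by (simp add: lower_add lower_smul lower_linear_mult[OF t'] q'_def)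
    finally show ?case .
  qed
  have mem: "((lower v) ^^ k) (t * q) \<in> ?I (l + 1 - int k)" for k
  proof (induction k)
    case 0
    then show ?case using tq by simp
  next
    case (Suc k)
    then show ?case using lower_gr_ideal[OF U, of "((lower v) ^^ k) (t * q)" \<Gamma> "l + 1 - int (Suc k)"]
      by (simp add: algebra_simps)
  qed
  have step: "q' k \<in> ?I (l - int k)"
    if "q' (Suc k) \<in> ?I (l - int (Suc k))" for k
  proof -
    have "t' * q' (Suc k) \<in> ?I (l - int k)"
      using linear_mult_gr_ideal[OF t'(1) that down_closed_star[OF \<Gamma>]] by simp
    moreover have "smul c (q' k) + t' * q' (Suc k) \<in> ?I (l - int k)"
      using mem[of "Suc k"] low[of k] by simp
    ultimately have "smul c (q' k) \<in> ?I (l - int k)"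
      using gr_ideal_diff by fastforce
    then have "smul (inverse c) (smul c (q' k)) \<in> ?I (l - int k)"
      by (rule gr_ideal_smul)
    then show ?thesis using t(2) by (simp add: c_def pm.vs.scale_scale)
  qed
  \<comment> \<open>After \<open>nat l + 1\<close> divisions the degree is negative and the quotient
    vanishes, which starts the descent.\<close>
  have "mons n (l - int (nat l + 1)) = {}" by (auto simp: mons_def)
  then have "q' (nat l + 1) = 0" using q'[of "nat l + 1"] by (simp add: homog_def supported_on_def)
  then have "q' (nat l + 1) \<in> ?I (l - int (nat l + 1))"
    by (simp add: gr_ideal_0)
  moreover have "q' 0 \<in> ?I l"
    if "q' k \<in> ?I (l - int k)" for k
    using that
  proof (induction k)
    case 0
    then show ?case by simp
  next
    case (Suc k)
    then show ?case using step by blast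
  qed
  ultimately have "q' 0 \<in> ?I l" by blast
  then show "q \<in> ?I l" by (simp add: q'_def)
qed

text \<open>Multiplication by the variable carries the relation from the star to
  \<open>\<Gamma>\<close>. Weak regularity there costs a second factor, and on the star both factors
  can be cancelled because \<open>U\<close> avoids the variable.\<close>

lemma regular_on_star_without:
  assumes U: "U \<subseteq> homog n 1" "\<And>u. u \<in> U \<Longrightarrow> var_coeff v u = 0"
    and v: "v \<in> {1..n}" and \<Gamma>: "down_closed \<Gamma>"
    and weak: "weakly_regular_on n \<Gamma> U t"
  shows "regular_on n (star \<Gamma> {v}) U t"
  unfolding regular_on_def
proof (intro allI ballI impI)
  let ?I = "gr_ideal n (star \<Gamma> {v}) U"
  fix l q assume q: "q \<in> homog n l" and tq: "t * q \<in> ?I (l + 1)"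
  have "Var v * (t * q) \<in> gr_ideal n \<Gamma> U (l + 1 + 1)"
    using Var_mult_gr_ideal[OF v tq, of \<Gamma>] by (simp add: mem_star)
  then have "t * (Var v * q) \<in> gr_ideal n \<Gamma> U (l + 1 + 1)" by (simp add: mult.left_commute)
  then have "Var v * (Var v * q) \<in> gr_ideal n \<Gamma> U (l + 1 + 1)"
    using weak v homog_mult[OF Var_homog[OF v] q] unfolding weakly_regular_on_def
    by (metis add.commute)
  then have "Var v * (Var v * q) \<in> ?I (l + 1 + 1)"
    using gr_ideal_mono[OF star_subset[OF \<Gamma>] subset_refl] by blast
  from lower_gr_ideal[OF U lower_gr_ideal[OF U this]]
  show "q \<in> ?I l" by (simp add: lower_Var_mult)
qed

text \<open>Linear changes of basis of the parameters. They generate the same ideal in the same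
  number, so each is again a system of parameters to which the Buchsbaum hypothesis applies.\<close>

definition admissible :: "nat \<Rightarrow> 'k::field mpoly list \<Rightarrow> 'k mpoly list \<Rightarrow> bool" where
  "admissible n \<theta>s ts \<longleftrightarrow> length ts = length \<theta>s \<and> set ts \<subseteq> homog n 1 \<and>
    pm.vs.span (set ts) = pm.vs.span (set \<theta>s)"

text \<open>If a form \<open>u\<close> preceding \<open>t\<close> involves \<open>x\<^sub>v\<close>, use it to eliminate \<open>x\<^sub>v\<close> from the others and move
  it behind \<open>t\<close>.\<close>

lemma regular_on_star:
  assumes \<Gamma>: "down_closed \<Gamma>" and v: "v \<in> {1..n}"
    and weak: "\<And>us t rest. admissible n \<theta>s (us @ t # rest) \<Longrightarrow> weakly_regular_on n \<Gamma> (set us) t"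
    and adm: "admissible n \<theta>s (us @ t # rest)"
  shows "regular_on n (star \<Gamma> {v}) (set us) t"
proof (cases "\<forall>u\<in>set us. var_coeff v u = 0")
  case True
  then show ?thesis
    using regular_on_star_without[OF _ _ v \<Gamma> weak[OF adm]] adm by (auto simp: admissible_def)
next
  case False
  let ?I = "gr_ideal n (star \<Gamma> {v})"
  from False obtain us1 u us2 where us: "us = us1 @ u # us2" and cu: "var_coeff v u \<noteq> 0"
    by (metis split_list)
  have lin: "set us \<subseteq> homog n 1" "t \<in> homog n 1" "set rest \<subseteq> homog n 1" "u \<in> homog n 1"
    using adm us by (auto simp: admissible_def)
  \<comment> \<open>Gaussian elimination of the variable of index \<open>v\<close> with pivot
    \<open>u\<close>.\<close>
  define elim where "elim w = w - smul (var_coeff v w / var_coeff v u) u" for w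
  have elim_lin: "elim w \<in> homog n 1" if "w \<in> homog n 1" for w
    unfolding elim_def by (intro homog_diff homog_smul that lin)
  have elim_coeff: "var_coeff v (elim w) = 0" for w
    using cu by (simp add: elim_def lookup_minus lookup_map_times)
  have elim_eq: "w = elim w + smul (var_coeff v w / var_coeff v u) u" for w
    by (simp add: elim_def)
  have span_elim: "pm.vs.span (insert u (elim ` A \<union> B)) = pm.vs.span (insert u (A \<union> B))" for A B
  proof (rule antisym; rule pm.vs.span_minimal[OF _ pm.vs.subspace_span]; rule subsetI)
    fix x assume "x \<in> insert u (elim ` A \<union> B)"
    then show "x \<in> pm.vs.span (insert u (A \<union> B))"
      unfolding elim_def by (auto intro!: pm.vs.span_diff pm.vs.span_scale intro: pm.vs.span_base)
  next
    fix x assume "x \<in> insert u (A \<union> B)"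
    moreover have "x \<in> pm.vs.span (insert u (elim ` A \<union> B))" if "x \<in> A"
      by (subst elim_eq) (use that in \<open>auto intro!: pm.vs.span_add pm.vs.span_scale intro: pm.vs.span_base\<close>)
    ultimately show "x \<in> pm.vs.span (insert u (elim ` A \<union> B))" by (auto intro: pm.vs.span_base)
  qed
  define us' where "us' = map elim (us1 @ us2)"
  have us': "set us' \<subseteq> homog n 1" "\<And>w. w \<in> set us' \<Longrightarrow> var_coeff v w = 0"
    using lin(1) elim_lin elim_coeff by (auto simp: us'_def us)
  have "insert u (elim ` (insert t (set us1 \<union> set us2)) \<union> set rest) = set (us' @ elim t # u # rest)"
    "insert u (insert t (set us1 \<union> set us2) \<union> set rest) = set (us @ t # rest)"
    by (auto simp: us'_def us)
  then have "pm.vs.span (set (us' @ elim t # u # rest)) = pm.vs.span (set (us @ t # rest))"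
    using span_elim by metis
  then have adm': "admissible n \<theta>s (us' @ elim t # u # rest)"
    using adm us'(1) lin elim_lin unfolding admissible_def by (auto simp: us'_def us)
  \<comment> \<open>\<open>us'\<close> and \<open>elim t\<close> avoid the variable whereas
    \<open>u\<close> involves it. Hence \<open>elim t\<close> followed by \<open>u\<close> is a
    regular sequence modulo \<open>us'\<close>: the first by weak regularity for the new basis, the
    second by its leading coefficient.\<close>
  have R1: "regular_on n (star \<Gamma> {v}) (set us') (elim t)"
    by (rule regular_on_star_without[OF us' v \<Gamma> weak[OF adm']])
  have R2: "regular_on n (star \<Gamma> {v}) (insert (elim t) (set us')) u"
    by (rule regular_on_star_leading[OF _ _ lin(4) cu v \<Gamma>]) (use us' elim_lin lin elim_coeff in auto)
  have "pm.vs.span (insert u (set us')) = pm.vs.span (set us)"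
    using span_elim[of "set us1 \<union> set us2" "{}"] by (simp add: us'_def us image_Un)
  then have J: "?I (set us) l = ?I (insert u (set us')) l" for l
    by (intro antisym gr_ideal_span_cong) (metis pm.vs.span_superset)+
  show ?thesis
    unfolding regular_on_def J
  proof (intro allI ballI impI)
    fix l q assume q: "q \<in> homog n l"
      and tq: "t * q \<in> ?I (insert u (set us')) (l + 1)"
    define c where "c = var_coeff v t / var_coeff v u"
    have "u * smul c q \<in> ?I (insert u (set us')) (l + 1)"
      by (rule mult_gr_ideal) (use q homog_smul in auto)
    moreover have "elim t * q = t * q - u * smul c q"
      by (simp add: elim_def c_def left_diff_distrib smul_mult_left smul_mult_right)
    ultimately have "elim t * q \<in> ?I (insert u (set us')) (l + 1)"
      using tq gr_ideal_diff by metis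
    \<comment> \<open>Modulo \<open>u\<close> the forms \<open>t\<close> and \<open>elim t\<close>
      agree. What follows is the exchange law for regular sequences: if \<open>elim t\<close> and
      then \<open>u\<close> are regular modulo \<open>us'\<close>, then \<open>elim t\<close> is
      regular modulo \<open>us'\<close> and \<open>u\<close>.\<close>
    then obtain j r where j: "j \<in> ?I (set us') (l + 1)"
      and r: "r \<in> homog n l" "elim t * q = j + u * r"
      by (rule mem_gr_ideal_insert) simp
    have "j \<in> ?I (insert (elim t) (set us')) (l + 1)"
      using j gr_ideal_mono[OF subset_refl subset_insertI] by blast
    moreover have "elim t * q \<in> ?I (insert (elim t) (set us')) (l + 1)"
      by (rule mult_gr_ideal) (use q in auto)
    moreover have "u * r = elim t * q - j" using r(2) by simp
    ultimately have "u * r \<in> ?I (insert (elim t) (set us')) (l + 1)"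
      using gr_ideal_diff by metis
    then have "r \<in> ?I (insert (elim t) (set us')) l"
      using R2 r(1) unfolding regular_on_def by blast
    then obtain j' s where j': "j' \<in> ?I (set us') l"
      and s: "s \<in> homog n (l - 1)" "r = j' + elim t * s"
      by (rule mem_gr_ideal_insert)
    have us_hom: "u * s \<in> homog n l" by (rule homog_mult1[OF lin(4) s(1)])
    have "elim t * (q - u * s) = j + u * j'"
      using r(2) s(2) by (simp add: algebra_simps)
    also have "\<dots> \<in> ?I (set us') (l + 1)"
      by (intro gr_ideal_add j linear_mult_gr_ideal lin j' down_closed_star \<Gamma>)
    finally have "q - u * s \<in> ?I (set us') l"
      using R1 homog_diff[OF q us_hom] unfolding regular_on_def by blast
    then have "q - u * s \<in> ?I (insert u (set us')) l"
      using gr_ideal_mono[OF subset_refl subset_insertI] by blast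
    moreover have "u * s \<in> ?I (insert u (set us')) l"
      by (rule mult_gr_ideal) (use s in auto)
    ultimately have "(q - u * s) + u * s \<in> ?I (insert u (set us')) l"
      by (rule gr_ideal_add)
    then show "q \<in> ?I (insert u (set us')) l" by simp
  qed
qed

text \<open>The star of \<open>insert v F\<close> is the star of \<open>v\<close> inside the star of
  \<open>F\<close>. Regularity on the star of \<open>F\<close> for every admissible system gives
  weak regularity there, which is what adding \<open>v\<close> requires; hence the sequence stays
  arbitrary in the induction.\<close>

lemma regular_on_all_stars:
  assumes \<Delta>: "down_closed \<Delta>" and F: "F \<subseteq> {1..n}" "F \<noteq> {}"
    and weak: "\<And>us t rest. admissible n \<theta>s (us @ t # rest) \<Longrightarrow> weakly_regular_on n \<Delta> (set us) t"
    and adm: "admissible n \<theta>s (us @ t # rest)"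
  shows "regular_on n (star \<Delta> F) (set us) t"
  using finite_subset[OF F(1) finite_atLeastAtMost] F(2,1) adm
proof (induction F arbitrary: us t rest rule: finite_ne_induct)
  case (singleton v)
  then show ?case using regular_on_star[OF \<Delta> _ weak singleton(2)] by simp
next
  case (insert v F)
  have "weakly_regular_on n (star \<Delta> F) (set us) t" if "admissible n \<theta>s (us @ t # rest)" for us t rest
    using regular_imp_weakly_regular[OF insert.IH[OF _ that] down_closed_star[OF \<Delta>]] insert.prems(1) by simp
  moreover have "v \<in> {1..n}" using insert.prems(1) by simp
  ultimately show ?case
    unfolding star_insert[of \<Delta> v F] using regular_on_star[OF down_closed_star[OF \<Delta>]] insert.prems(2)
    by blast
qed

section \<open>The partition complex\<close>

definition eps :: "nat \<Rightarrow> nat set \<Rightarrow> 'b::comm_ring_1" where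
  "eps u F = (-1) ^ card {w \<in> F. w < u}"

text \<open>The coboundary of the full simplex on \<open>{1..n}\<close>; the complex
  \<open>\<Delta>\<close> enters later, through the cochains regarded as null. The coefficient ring
  is left open because both polynomial and scalar values occur.\<close>

definition cobd :: "nat \<Rightarrow> (nat set \<Rightarrow> 'b::comm_ring_1) \<Rightarrow> nat set \<Rightarrow> 'b" where
  "cobd n y F = (if F \<subseteq> {1..n} then \<Sum>u\<in>F. eps u F * y (F - {u}) else 0)"

text \<open>The cone operator with apex \<open>v\<close>, which contracts the full simplex.\<close>

definition contr :: "nat \<Rightarrow> nat \<Rightarrow> (nat set \<Rightarrow> 'b::comm_ring_1) \<Rightarrow> nat set \<Rightarrow> 'b" where
  "contr n v y F = (if v \<in> F \<or> \<not> F \<subseteq> {1..n} then 0 else eps v (insert v F) * y (insert v F))"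

lemma eps_square: "eps u F * eps u F = 1"
  by (simp add: eps_def flip: power_add mult_2 power_mult)

lemma eps_square': "eps u F * (eps u F * x) = x"
  by (simp add: eps_square flip: mult.assoc)

text \<open>Exactly one of the two signs notices the other vertex: for \<open>u < v\<close> deleting
  \<open>u\<close> shifts the position of \<open>v\<close>, otherwise inserting \<open>v\<close>
  shifts the position of \<open>u\<close>.\<close>

lemma eps_swap:
  assumes "finite F" "u \<in> F" "v \<notin> F"
  shows "(eps v (insert v F) :: 'b::comm_ring_1) * eps u (insert v F) = - (eps u F * eps v (insert v (F - {u})))"
proof -
  have "u \<noteq> v" using assms by blast
  have "{w \<in> insert v G. w < v} = {w \<in> G. w < v}" for G by auto
  then have v: "eps v (insert v G) = (-1 :: 'b) ^ card {w \<in> G. w < v}" for G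
    unfolding eps_def by metis
  show ?thesis
  proof (cases "u < v")
    case True
    have 1: "{w \<in> insert v F. w < u} = {w \<in> F. w < u}" using True by auto
    have "{w \<in> F. w < v} = insert u {w \<in> F - {u}. w < v}" using assms True by auto
    moreover have "card (insert u {w \<in> F - {u}. w < v}) = Suc (card {w \<in> F - {u}. w < v})"
      using assms(1) by (intro card_insert_disjoint) auto
    ultimately have 2: "card {w \<in> F. w < v} = Suc (card {w \<in> F - {u}. w < v})" by simp
    show ?thesis unfolding v eps_def[of u] 1 2 by simp
  next
    case False
    then have "{w \<in> insert v F. w < u} = insert v {w \<in> F. w < u}" using \<open>u \<noteq> v\<close> by auto
    moreover have "card (insert v {w \<in> F. w < u}) = Suc (card {w \<in> F. w < u})"
      using assms by (intro card_insert_disjoint) auto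
    ultimately have 1: "card {w \<in> insert v F. w < u} = Suc (card {w \<in> F. w < u})" by simp
    have 2: "{w \<in> F. w < v} = {w \<in> F - {u}. w < v}" using False by auto
    show ?thesis unfolding v eps_def[of u] 1 2 by simp
  qed
qed

text \<open>If \<open>v\<close> lies in \<open>F\<close>, only the summand deleting \<open>v\<close>
  survives. Otherwise the summands of the two composites cancel in pairs by \<open>eps_swap\<close>,
  except the one that inserts and deletes \<open>v\<close>.\<close>

lemma contr_homotopy:
  assumes F: "F \<subseteq> {1..n}" and v: "v \<in> {1..n}"
  shows "cobd n (contr n v y) F + contr n v (cobd n y) F = y F"
proof (cases "v \<in> F")
  case True
  have fin: "finite F" using F finite_subset by blast
  have "cobd n (contr n v y) F = (\<Sum>u\<in>F. if u = v then y F else 0)"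
    unfolding cobd_def
  proof (subst if_P[OF F], rule sum.cong[OF refl])
    fix u assume "u \<in> F"
    then show "eps u F * contr n v y (F - {u}) = (if u = v then y F else 0)"
      using True F by (auto simp: contr_def insert_absorb eps_square')
  qed
  then show ?thesis using True fin by (simp add: contr_def)
next
  case False
  have fin: "finite F" using F finite_subset by blast
  have Fv: "insert v F \<subseteq> {1..n}" using F v by simp
  have "contr n v (cobd n y) F = eps v (insert v F) * (\<Sum>u\<in>insert v F. eps u (insert v F) * y (insert v F - {u}))"
    using False F Fv by (simp add: contr_def cobd_def)
  also have "(\<Sum>u\<in>insert v F. eps u (insert v F) * y (insert v F - {u})) =
      eps v (insert v F) * y F + (\<Sum>u\<in>F. eps u (insert v F) * y (insert v (F - {u})))"
    using fin False by (subst sum.insert) (auto intro!: sum.cong simp: insert_Diff_if)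
  also have "eps v (insert v F) * \<dots> =
      y F + (\<Sum>u\<in>F. (eps v (insert v F) * eps u (insert v F)) * y (insert v (F - {u})))"
    by (simp add: distrib_left eps_square' sum_distrib_left mult.assoc)
  also have "\<dots> = y F - (\<Sum>u\<in>F. eps u F * (eps v (insert v (F - {u})) * y (insert v (F - {u}))))"
  proof -
    have "(\<Sum>u\<in>F. (eps v (insert v F) * eps u (insert v F)) * y (insert v (F - {u}))) =
        (\<Sum>u\<in>F. - (eps u F * (eps v (insert v (F - {u})) * y (insert v (F - {u})))))"
      by (rule sum.cong[OF refl], subst eps_swap[OF fin _ False]) (auto simp: mult.assoc)
    then show ?thesis by (simp add: sum_negf)
  qed
  also have "(\<Sum>u\<in>F. eps u F * (eps v (insert v (F - {u})) * y (insert v (F - {u})))) = cobd n (contr n v y) F"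
    using False F by (auto simp: cobd_def contr_def intro!: sum.cong)
  finally show ?thesis by simp
qed

lemma cobd_add: "cobd n (y + z) = cobd n y + cobd n z"
  by (rule ext) (simp add: cobd_def distrib_left sum.distrib)

lemma cobd_diff: "cobd n (y - z) = cobd n y - cobd n z"
  by (rule ext) (simp add: cobd_def right_diff_distrib sum_subtractf)

lemma cobd_zero: "cobd n 0 = 0"
  by (rule ext) (simp add: cobd_def)

lemma cobd_scale: "cobd n (family_scale c y) = family_scale c (cobd n y)" for y :: "nat set \<Rightarrow> 'k::field mpoly"
proof
  fix F
  have "(\<Sum>u\<in>A. smul c (g u)) = smul c (\<Sum>u\<in>A. g u)" for A and g :: "nat \<Rightarrow> 'k mpoly"
    by (simp add: pm.vs.scale_sum_right)
  then show "cobd n (family_scale c y) F = family_scale c (cobd n y) F"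
    by (simp add: cobd_def family_scale_def smul_mult_right)
qed

lemma cobd_cobd: "cobd n (cobd n y) = 0"
proof -
  text \<open>For \<open>v \<in> F\<close> the homotopy reduces \<open>D D y\<close> at \<open>F\<close> to values of \<open>D D\<close> on smaller sets; this
    avoids sorting the double sum, where antisymmetry alone is not enough in characteristic \<open>2\<close>.\<close>
  have "cobd n (cobd n y) F = 0" if "F \<subseteq> {1..n}" for F and y :: "nat set \<Rightarrow> 'b::comm_ring_1"
    using that
  proof (induction "card F" arbitrary: F y rule: less_induct)
    case less
    show ?case
    proof (cases "F = {}")
      case True
      then show ?thesis by (simp add: cobd_def)
    next
      case False
      then obtain v where v: "v \<in> F" by blast
      have vn: "v \<in> {1..n}" using v less.prems by blast
      let ?D = "cobd n" and ?s = "contr n v"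
      have hom: "?s (?D z) G = z G - ?D (?s z) G" if "G \<subseteq> {1..n}" for z :: "nat set \<Rightarrow> 'b" and G
        using contr_homotopy[OF that vn, of z] by (metis add_diff_cancel_left')
      have cobd_cong: "?D z G = ?D z' G" if "\<And>G. G \<subseteq> {1..n} \<Longrightarrow> z G = z' G" for z z' :: "nat set \<Rightarrow> 'b" and G
      proof (cases "G \<subseteq> {1..n}")
        case True
        then have "z (G - {u}) = z' (G - {u})" for u using that by blast
        then show ?thesis by (simp add: cobd_def)
      qed (simp add: cobd_def)
      have "?D (?D y) F = ?D (?s (?D (?D y))) F"
        using hom[OF less.prems, of "?D (?D y)"] v by (simp add: contr_def)
      also have "\<dots> = (\<Sum>u\<in>F. eps u F * ?s (?D (?D y)) (F - {u}))"
        using less.prems by (simp add: cobd_def[of n "?s (?D (?D y))"])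
      also have "\<dots> = 0"
      proof (rule sum.neutral, rule ballI)
        fix u assume u: "u \<in> F"
        let ?G = "F - {u}"
        have G: "?G \<subseteq> {1..n}" using less.prems by blast
        have "card ?G < card F"
          using u finite_subset[OF less.prems] by (intro card_Diff1_less) auto
        then have IH: "?D (?D (?s y)) ?G = 0" using less.hyps G by blast
        \<comment> \<open>Using the homotopy twice rewrites this value as
          \<open>?D (?D (?s y)) ?G\<close>. The induction hypothesis is therefore needed for the
          family \<open>?s y\<close> in place of \<open>y\<close>.\<close>
        have "?s (?D (?D y)) ?G = ?D y ?G - ?D (?s (?D y)) ?G" by (rule hom[OF G])
        also have "?D (?s (?D y)) ?G = ?D (y - ?D (?s y)) ?G"
          by (rule cobd_cong) (simp add: hom)
        also have "?D y ?G - \<dots> = 0" using IH by (simp add: cobd_diff)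
        finally show "eps u F * ?s (?D (?D y)) ?G = 0" by simp
      qed
      finally show ?thesis .
    qed
  qed
  moreover have "cobd n (cobd n y) F = 0" if "\<not> F \<subseteq> {1..n}" for F
    using that by (simp add: cobd_def)
  ultimately show ?thesis by (metis (no_types, lifting) ext zero_fun_apply)
qed

lemma eps_mult_mem:
  assumes "pm.vs.subspace V" "p \<in> V"
  shows "eps u F * p \<in> V"
  using assms pm.vs.subspace_neg[OF assms] by (cases "even (card {w \<in> F. w < u})") (auto simp: eps_def)

definition mul :: "'k::field mpoly \<Rightarrow> (nat set \<Rightarrow> 'k mpoly) \<Rightarrow> nat set \<Rightarrow> 'k mpoly" where
  "mul t y = (\<lambda>F. t * y F)"

lemma mul_add: "mul t (y + z) = mul t y + mul t z"
  and mul_diff: "mul t (y - z) = mul t y - mul t z"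
  and mul_scale: "mul t (family_scale c y) = family_scale c (mul t y)"
  by (auto simp: mul_def family_scale_def distrib_left right_diff_distrib smul_mult_right)

lemma cobd_mul: "cobd n (mul t y) = mul t (cobd n y)"
  by (rule ext) (simp add: cobd_def mul_def sum_distrib_left mult.left_commute)

lemma eps_lookup: "lookup (eps u F * p) a = eps u F * lookup (p :: 'k::field mpoly) a"
  by (cases "even (card {w \<in> F. w < u})") (auto simp: eps_def)

lemma lookup_cobd: "lookup (cobd n y F) a = cobd n (\<lambda>G. lookup (y G :: 'k::field mpoly) a) F"
  by (simp add: cobd_def lookup_sum eps_lookup)

text \<open>The Buchsbaum property enters this locale through \<open>regular\<close> alone; the rest
  is linear algebra in each degree. The empty set is excluded there because its star is
  \<open>\<Delta>\<close>, on which the parameters need not be a regular sequence.\<close>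

locale partition_complex =
  fixes n :: nat and \<Delta> :: "nat set set" and \<theta>s :: "'k::field mpoly list"
  assumes down_closed: "down_closed \<Delta>"
    and faces_subset: "\<Delta> \<subseteq> Pow {1..n}"
    and empty_face: "{} \<in> \<Delta>"
    and linear: "set \<theta>s \<subseteq> homog n 1"
    and regular: "i < length \<theta>s \<Longrightarrow> F \<subseteq> {1..n} \<Longrightarrow> F \<noteq> {} \<Longrightarrow>
      regular_on n (star \<Delta> F) (set (take i \<theta>s)) (\<theta>s ! i)"
begin

text \<open>The complex modulo \<open>\<theta>\<^sub>1, \<dots>, \<theta>\<^sub>i\<close> is represented by families of polynomials indexed by all
  subsets of \<open>{1..n}\<close>, modulo \<open>null_cochains i\<close>. Indices \<open>F \<notin> \<Delta>\<close> contribute nothing, because their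
  star is empty and \<open>J i F l\<close> is everything.\<close>

definition J :: "nat \<Rightarrow> nat set \<Rightarrow> int \<Rightarrow> 'k mpoly set" where
  "J i F l = gr_ideal n (star \<Delta> F) (set (take i \<theta>s)) l"

definition cochains :: "int \<Rightarrow> int \<Rightarrow> (nat set \<Rightarrow> 'k mpoly) set" where
  "cochains j l = {y. \<forall>F. y F \<in> homog n l \<and> (y F \<noteq> 0 \<longrightarrow> F \<subseteq> {1..n} \<and> int (card F) = j)}"

definition null_cochains :: "nat \<Rightarrow> int \<Rightarrow> int \<Rightarrow> (nat set \<Rightarrow> 'k mpoly) set" where
  "null_cochains i j l = {y \<in> cochains j l. \<forall>F. y F \<in> J i F l}"

definition cocycles :: "nat \<Rightarrow> int \<Rightarrow> int \<Rightarrow> (nat set \<Rightarrow> 'k mpoly) set" where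
  "cocycles i j l = {y \<in> cochains j l. cobd n y \<in> null_cochains i (j + 1) l}"

definition coboundaries :: "nat \<Rightarrow> int \<Rightarrow> int \<Rightarrow> (nat set \<Rightarrow> 'k mpoly) set" where
  "coboundaries i j l = {cobd n y + w | y w. y \<in> cochains (j - 1) l \<and> w \<in> null_cochains i j l}"

definition h :: "nat \<Rightarrow> int \<Rightarrow> int \<Rightarrow> int" where
  "h i j l = int (fam.vs.dim (cocycles i j l)) - int (fam.vs.dim (coboundaries i j l))"

lemma J_subspace: "pm.vs.subspace (J i F l)"
  unfolding J_def by (rule gr_ideal_subspace)

lemmas J_0 = pm.vs.subspace_0[OF J_subspace]
  and J_add = pm.vs.subspace_add[OF J_subspace]
  and J_diff = pm.vs.subspace_diff[OF J_subspace]
  and J_smul = pm.vs.subspace_scale[OF J_subspace]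

lemma take_linear: "set (take i \<theta>s) \<subseteq> homog n 1"
  using linear set_take_subset by fast

lemma J_homog: "J i F l \<subseteq> homog n l"
  unfolding J_def by (rule gr_ideal_homog[OF take_linear])

lemma J_mono: "F \<subseteq> G \<Longrightarrow> J i F l \<subseteq> J i G l"
  unfolding J_def by (rule gr_ideal_mono[OF star_mono[OF down_closed] subset_refl])

lemma set_take_Suc: "i < length \<theta>s \<Longrightarrow> set (take (Suc i) \<theta>s) = insert (\<theta>s ! i) (set (take i \<theta>s))"
  by (simp add: take_Suc_conv_app_nth)

lemma J_Suc: "J i F l \<subseteq> J (Suc i) F l"
  unfolding J_def
  by (rule gr_ideal_mono[OF subset_refl]) (use set_take_subset_set_take[of i "Suc i" \<theta>s] in auto)

lemma nth_linear: "i < length \<theta>s \<Longrightarrow> \<theta>s ! i \<in> homog n 1"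
  using linear by auto

lemma mult_J_Suc: "i < length \<theta>s \<Longrightarrow> q \<in> homog n (l - 1) \<Longrightarrow> \<theta>s ! i * q \<in> J (Suc i) F l"
  unfolding J_def set_take_Suc by (rule mult_gr_ideal) auto

lemma mem_J_Suc:
  assumes "i < length \<theta>s" "p \<in> J (Suc i) F l"
  obtains p' q where "p' \<in> J i F l" "q \<in> homog n (l - 1)" "p = p' + \<theta>s ! i * q"
  using assms unfolding J_def set_take_Suc[OF assms(1)] by (metis mem_gr_ideal_insert)

lemma cochains_subspace: "fam.vs.subspace (cochains j l)"
proof (rule fam.vs.subspaceI)
  fix x y assume "x \<in> cochains j l" "y \<in> cochains j l"
  moreover have "x F \<noteq> 0 \<or> y F \<noteq> 0" if "x F + y F \<noteq> 0" for F using that by auto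
  ultimately show "x + y \<in> cochains j l" unfolding cochains_def by (simp add: homog_add) blast
qed (auto simp: cochains_def homog_0 family_scale_def homog_smul)

lemma null_cochains_subspace: "fam.vs.subspace (null_cochains i j l)"
  using cochains_subspace[of j l] unfolding null_cochains_def fam.vs.subspace_def
  by (auto simp: J_0 J_add J_smul family_scale_def)

lemma cocycles_subspace: "fam.vs.subspace (cocycles i j l)"
  using cochains_subspace[of j l] null_cochains_subspace[of i "j + 1" l]
  unfolding cocycles_def fam.vs.subspace_def by (auto simp: cobd_add cobd_scale cobd_zero)

lemma coboundaries_subspace: "fam.vs.subspace (coboundaries i j l)"
proof -
  have "fam.vs.subspace (cobd n ` cochains (j - 1) l)"
    using cochains_subspace[of "j - 1" l] unfolding fam.vs.subspace_def
    by (auto simp: cobd_add[symmetric] cobd_scale[symmetric]) (metis cobd_zero imageI)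
  from fam.vs.subspace_sums[OF this null_cochains_subspace[of i j l]]
  have "fam.vs.subspace {x + y | x y. x \<in> cobd n ` cochains (j - 1) l \<and> y \<in> null_cochains i j l}" .
  also have "{x + y | x y. x \<in> cobd n ` cochains (j - 1) l \<and> y \<in> null_cochains i j l} = coboundaries i j l"
    unfolding coboundaries_def by blast
  finally show ?thesis .
qed

lemma cochains_fin_spanned: "fam.fin_spanned (cochains j l)"
  by (rule fin_spanned_family[of "Pow {1..n}" "mons n l"]) (auto simp: cochains_def finite_mons homog_def)

lemma null_sub_cochains: "null_cochains i j l \<subseteq> cochains j l"
  and cocycles_sub_cochains: "cocycles i j l \<subseteq> cochains j l"
  by (auto simp: null_cochains_def cocycles_def)

lemma cobd_cochains: "y \<in> cochains j l \<Longrightarrow> cobd n y \<in> cochains (j + 1) l"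
proof -
  assume y: "y \<in> cochains j l"
  have "F \<subseteq> {1..n} \<and> int (card F) = j + 1" if nz: "cobd n y F \<noteq> 0" for F
  proof -
    have F: "F \<subseteq> {1..n}" using nz by (auto simp: cobd_def split: if_splits)
    have "\<exists>u\<in>F. y (F - {u}) \<noteq> 0"
      by (rule ccontr) (use nz F in \<open>simp add: cobd_def\<close>)
    then obtain u where u: "u \<in> F" "y (F - {u}) \<noteq> 0" by blast
    have "int (card (F - {u})) = j" using y u(2) by (auto simp: cochains_def)
    moreover have "card F = Suc (card (F - {u}))"
      using u(1) finite_subset[OF F finite_atLeastAtMost] by (rule card.remove[rotated])
    ultimately show ?thesis using F by simp
  qed
  moreover have "cobd n y F \<in> homog n l" for F
    using y unfolding cobd_def cochains_def
    by (auto intro!: homog_sum eps_mult_mem[OF homog_subspace] homog_0)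
  ultimately show ?thesis by (auto simp: cochains_def)
qed

lemma cobd_null: "y \<in> null_cochains i j l \<Longrightarrow> cobd n y \<in> null_cochains i (j + 1) l"
proof -
  assume y: "y \<in> null_cochains i j l"
  have "cobd n y F \<in> J i F l" for F
    using y J_mono[of "F - {u}" F i l for u]
    unfolding cobd_def null_cochains_def
    by (auto intro!: pm.vs.subspace_sum[OF J_subspace] eps_mult_mem[OF J_subspace] J_0)
  then show ?thesis using y cobd_cochains by (auto simp: null_cochains_def)
qed

lemma null_sub_cocycles: "null_cochains i j l \<subseteq> cocycles i j l"
  using cobd_null by (auto simp: cocycles_def null_cochains_def)

lemma coboundaries_sub_cocycles: "coboundaries i j l \<subseteq> cocycles i j l"
proof
  fix x assume "x \<in> coboundaries i j l"
  then obtain y w where x: "x = cobd n y + w" "y \<in> cochains (j - 1) l" "w \<in> null_cochains i j l"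
    unfolding coboundaries_def by blast
  have "cobd n y \<in> cochains j l" using cobd_cochains[OF x(2)] by simp
  moreover have "cobd n (cobd n y) \<in> null_cochains i (j + 1) l"
    unfolding cobd_cobd by (rule fam.vs.subspace_0[OF null_cochains_subspace])
  ultimately have "cobd n y \<in> cocycles i j l" by (simp add: cocycles_def)
  then show "x \<in> cocycles i j l"
    using x null_sub_cocycles fam.vs.subspace_add[OF cocycles_subspace] by blast
qed

lemma null_sub_coboundaries: "null_cochains i j l \<subseteq> coboundaries i j l"
proof
  fix w assume "w \<in> null_cochains i j l"
  then have "cobd n 0 + w \<in> coboundaries i j l"
    unfolding coboundaries_def using fam.vs.subspace_0[OF cochains_subspace] by blast
  then show "w \<in> coboundaries i j l" by (simp add: cobd_zero)
qed

lemma mul_cochains: "t \<in> homog n 1 \<Longrightarrow> y \<in> cochains j l \<Longrightarrow> mul t y \<in> cochains j (l + 1)"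
  using homog_mult[of t n 1 _ l] by (auto simp: cochains_def mul_def add.commute)

lemma mul_null:
  assumes t: "t \<in> homog n 1" and y: "y \<in> null_cochains i j l"
  shows "mul t y \<in> null_cochains i j (l + 1)"
proof -
  have "t * y F \<in> J i F (l + 1)" for F
    using linear_mult_gr_ideal[OF t _ down_closed_star[OF down_closed]] y
    unfolding null_cochains_def J_def by blast
  then show ?thesis using mul_cochains[OF t] y by (simp add: null_cochains_def mul_def)
qed

lemma contr_cochains: "v \<in> {1..n} \<Longrightarrow> y \<in> cochains j l \<Longrightarrow> contr n v y \<in> cochains (j - 1) l"
proof -
  assume v: "v \<in> {1..n}" and y: "y \<in> cochains j l"
  have "F \<subseteq> {1..n} \<and> int (card F) = j - 1" if nz: "contr n v y F \<noteq> 0" for F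
  proof -
    have F: "F \<subseteq> {1..n}" "v \<notin> F" "y (insert v F) \<noteq> 0"
      using nz by (auto simp: contr_def split: if_splits)
    then have "int (card (insert v F)) = j" using y by (auto simp: cochains_def)
    then show ?thesis using F finite_subset[OF F(1)] by auto
  qed
  moreover have "contr n v y F \<in> homog n l" for F
    using y unfolding contr_def cochains_def by (auto intro!: eps_mult_mem[OF homog_subspace] homog_0)
  ultimately show ?thesis by (auto simp: cochains_def)
qed

text \<open>\<open>contr\<close> moves a value from \<open>insert v F\<close> to \<open>F\<close>,
  against the inclusion of \<open>J i F l\<close> in \<open>J i (insert v F) l\<close>. The factor
  \<open>Var v\<close> carries the larger space back into the smaller one, one degree
  higher.\<close>

lemma contr_null:
  assumes v: "v \<in> {1..n}" and y: "y \<in> null_cochains i j l"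
  shows "mul (Var v) (contr n v y) \<in> null_cochains i (j - 1) (l + 1)"
proof -
  have "Var v * contr n v y F \<in> J i F (l + 1)" for F
  proof (cases "v \<in> F \<or> \<not> F \<subseteq> {1..n}")
    case True
    then show ?thesis by (simp add: contr_def J_0)
  next
    case False
    have "y (insert v F) \<in> J i (insert v F) l" using y by (simp add: null_cochains_def)
    then have "Var v * y (insert v F) \<in> J i F (l + 1)"
      unfolding J_def by (rule Var_mult_gr_ideal[OF v]) (simp add: mem_star)
    then have "eps v (insert v F) * (Var v * y (insert v F)) \<in> J i F (l + 1)"
      by (rule eps_mult_mem[OF J_subspace])
    then show ?thesis using False by (simp add: contr_def mult.left_commute)
  qed
  moreover have "mul (Var v) (contr n v y) \<in> cochains (j - 1) (l + 1)"
    using mul_cochains[OF Var_homog[OF v] contr_cochains[OF v]] y by (simp add: null_cochains_def)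
  ultimately show ?thesis by (simp add: null_cochains_def mul_def)
qed

lemma Var_mul_cocycle:
  assumes v: "v \<in> {1..n}" and z: "z \<in> cocycles i j l"
  shows "mul (Var v) z \<in> coboundaries i j (l + 1)"
proof -
  have zC: "z \<in> cochains j l" using z by (simp add: cocycles_def)
  have "z F = cobd n (contr n v z) F + contr n v (cobd n z) F" for F
  proof (cases "F \<subseteq> {1..n}")
    case True
    then show ?thesis using contr_homotopy[OF _ v] by metis
  next
    case False
    then show ?thesis using zC by (auto simp: cobd_def contr_def cochains_def)
  qed
  then have "mul (Var v) z = cobd n (mul (Var v) (contr n v z)) + mul (Var v) (contr n v (cobd n z))"
    unfolding cobd_mul by (auto simp: mul_def distrib_left)
  moreover have "mul (Var v) (contr n v z) \<in> cochains (j - 1) (l + 1)"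
    by (rule mul_cochains[OF Var_homog[OF v] contr_cochains[OF v zC]])
  moreover have "mul (Var v) (contr n v (cobd n z)) \<in> null_cochains i j (l + 1)"
    using contr_null[OF v, of "cobd n z" i "j + 1" l] z by (simp add: cocycles_def)
  ultimately show ?thesis unfolding coboundaries_def by blast
qed

lemma linear_mul_cocycle:
  assumes t: "t \<in> homog n 1" and z: "z \<in> cocycles i j l"
  shows "mul t z \<in> coboundaries i j (l + 1)"
proof -
  have "mul t z = (\<Sum>v=1..n. family_scale (lookup t (single v 1)) (mul (Var v) z))"
    by (subst linear_form_expand[OF t])
      (auto simp: mul_def family_scale_def sum_apply_fun sum_distrib_right smul_mult_left)
  also have "\<dots> \<in> coboundaries i j (l + 1)"
    by (intro fam.vs.subspace_sum[OF coboundaries_subspace] fam.vs.subspace_scale[OF coboundaries_subspace]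
        Var_mul_cocycle[OF _ z])
  finally show ?thesis .
qed

lemma null_cochains_Suc:
  assumes i: "i < length \<theta>s" and y: "y \<in> null_cochains (Suc i) j l"
  obtains p w where "p \<in> null_cochains i j l" "w \<in> cochains j (l - 1)" "y = p + mul (\<theta>s ! i) w"
proof -
  have yC: "y \<in> cochains j l" using y by (simp add: null_cochains_def)
  have "\<exists>p w. p \<in> J i F l \<and> w \<in> homog n (l - 1) \<and> y F = p + \<theta>s ! i * w" for F
    using y mem_J_Suc[OF i, of "y F" F l] unfolding null_cochains_def by blast
  then obtain p w where pw: "\<And>F. p F \<in> J i F l" "\<And>F. w F \<in> homog n (l - 1)"
      "\<And>F. y F = p F + \<theta>s ! i * w F"
    by metis
  \<comment> \<open>The pointwise choices are reset to \<open>0\<close> where \<open>y\<close>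
    vanishes; otherwise they need not be supported on sets of size \<open>j\<close>.\<close>
  define p' where "p' F = (if y F = 0 then 0 else p F)" for F
  define w' where "w' F = (if y F = 0 then 0 else w F)" for F
  have "p F \<in> homog n l" for F using pw(1) J_homog by blast
  then have "p' \<in> null_cochains i j l"
    using yC pw(1) by (auto simp: null_cochains_def cochains_def p'_def J_0 homog_0)
  moreover have "w' \<in> cochains j (l - 1)"
    using yC pw(2) by (auto simp: cochains_def w'_def homog_0)
  moreover have "y F = p' F + \<theta>s ! i * w' F" for F
    using pw(3)[of F] by (simp add: p'_def w'_def)
  then have "y = p' + mul (\<theta>s ! i) w'" by (intro ext) (simp add: mul_def)
  ultimately show thesis by (rule that)
qed

lemma null_sub_null_Suc: "null_cochains i j l \<subseteq> null_cochains (Suc i) j l"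
  unfolding null_cochains_def using J_Suc by blast

lemma mul_null_Suc:
  assumes "i < length \<theta>s" "w \<in> cochains j (l - 1)"
  shows "mul (\<theta>s ! i) w \<in> null_cochains (Suc i) j l"
proof -
  have "mul (\<theta>s ! i) w \<in> cochains j l"
    using mul_cochains[OF nth_linear[OF assms(1)] assms(2)] by simp
  moreover have "\<theta>s ! i * w F \<in> J (Suc i) F l" for F
    using mult_J_Suc[OF assms(1)] assms(2) by (auto simp: cochains_def)
  ultimately show ?thesis by (simp add: null_cochains_def mul_def)
qed

text \<open>For \<open>j \<ge> 1\<close> only nonempty index sets carry values, and on their stars
  the next parameter is regular.\<close>

lemma null_cochains_regular:
  assumes i: "i < length \<theta>s" and j: "j \<ge> 1" and y: "y \<in> cochains j l"
    and \<theta>y: "mul (\<theta>s ! i) y \<in> null_cochains i j (l + 1)"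
  shows "y \<in> null_cochains i j l"
proof -
  have "y F \<in> J i F l" for F
  proof (cases "y F = 0")
    case True
    then show ?thesis by (simp add: J_0)
  next
    case False
    then have F: "F \<subseteq> {1..n}" "int (card F) = j" using y by (auto simp: cochains_def)
    then have "F \<noteq> {}" using j by auto
    moreover have "\<theta>s ! i * y F \<in> gr_ideal n (star \<Delta> F) (set (take i \<theta>s)) (l + 1)"
      using \<theta>y by (auto simp: null_cochains_def mul_def J_def)
    moreover have "y F \<in> homog n l" using y by (simp add: cochains_def)
    ultimately show ?thesis using regular[OF i F(1)] unfolding J_def regular_on_def by blast
  qed
  then show ?thesis using y by (simp add: null_cochains_def)
qed

section \<open>Effect on cohomology of dividing out one more parameter\<close>

lemma cocycles_fin_spanned: "fam.fin_spanned (cocycles i j l)"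
  by (rule fam.fin_spanned_mono[OF cochains_fin_spanned cocycles_sub_cochains])

lemmas cocycles_add = fam.vs.subspace_add[OF cocycles_subspace]
  and cocycles_diff = fam.vs.subspace_diff[OF cocycles_subspace]
  and coboundaries_add = fam.vs.subspace_add[OF coboundaries_subspace]
  and null_add = fam.vs.subspace_add[OF null_cochains_subspace]
  and null_diff = fam.vs.subspace_diff[OF null_cochains_subspace]
  and null_scale = fam.vs.subspace_scale[OF null_cochains_subspace]
  and cochains_diff = fam.vs.subspace_diff[OF cochains_subspace]

text \<open>Injectivity of the map in cohomology from stage \<open>i\<close> to stage
  \<open>Suc i\<close>. In \<open>z = p + \<theta> u\<close> the cochain
  \<open>\<theta> (cobd n u)\<close> is null, so \<open>u\<close> is a cocycle by regularity in
  position \<open>j + 1\<close>, and a parameter times a cocycle is a coboundary.\<close>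

lemma cocycles_cap_null_Suc:
  assumes i: "i < length \<theta>s" and j: "j \<ge> 0"
    and z: "z \<in> cocycles i j l" "z \<in> null_cochains (Suc i) j l"
  shows "z \<in> coboundaries i j l"
proof -
  obtain p u where pu: "p \<in> null_cochains i j l" "u \<in> cochains j (l - 1)" "z = p + mul (\<theta>s ! i) u"
    by (rule null_cochains_Suc[OF i z(2)])
  have "cobd n z - cobd n p \<in> null_cochains i (j + 1) l"
    using z(1) cobd_null[OF pu(1)] null_diff by (simp add: cocycles_def)
  then have "mul (\<theta>s ! i) (cobd n u) \<in> null_cochains i (j + 1) (l - 1 + 1)"
    by (simp add: pu(3) cobd_add cobd_mul)
  then have "cobd n u \<in> null_cochains i (j + 1) (l - 1)"
    using null_cochains_regular[OF i _ cobd_cochains[OF pu(2)]] j by simp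
  then have "u \<in> cocycles i j (l - 1)" using pu(2) by (simp add: cocycles_def)
  from linear_mul_cocycle[OF nth_linear[OF i] this] have "mul (\<theta>s ! i) u \<in> coboundaries i j l" by simp
  then show ?thesis using pu(1,3) null_sub_coboundaries coboundaries_add by blast
qed

lemma coboundaries_Suc:
  assumes i: "i < length \<theta>s"
  shows "x \<in> coboundaries (Suc i) j l \<longleftrightarrow>
    (\<exists>b\<in>coboundaries i j l. \<exists>w\<in>null_cochains (Suc i) j l. x = b + w)"
proof
  assume "x \<in> coboundaries (Suc i) j l"
  then obtain y w where x: "x = cobd n y + w" "y \<in> cochains (j - 1) l" "w \<in> null_cochains (Suc i) j l"
    unfolding coboundaries_def by blast
  have "cobd n y + 0 \<in> coboundaries i j l"
    unfolding coboundaries_def using x(2) fam.vs.subspace_0[OF null_cochains_subspace] by blast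
  then show "\<exists>b\<in>coboundaries i j l. \<exists>w\<in>null_cochains (Suc i) j l. x = b + w" using x by auto
next
  assume "\<exists>b\<in>coboundaries i j l. \<exists>w\<in>null_cochains (Suc i) j l. x = b + w"
  then obtain y w w' where x: "x = (cobd n y + w) + w'" "y \<in> cochains (j - 1) l"
      "w \<in> null_cochains i j l" "w' \<in> null_cochains (Suc i) j l"
    unfolding coboundaries_def by blast
  have "x = cobd n y + (w + w')" "w + w' \<in> null_cochains (Suc i) j l"
    using x(1) null_add[OF subsetD[OF null_sub_null_Suc x(3)] x(4)] by (simp_all add: add.assoc)
  then show "x \<in> coboundaries (Suc i) j l" unfolding coboundaries_def using x(2) by blast
qed

text \<open>Modulo \<open>coboundaries (Suc i) j l\<close> this is the image of the cohomology of
  stage \<open>i\<close> in that of stage \<open>Suc i\<close>. It cuts the latter into the two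
  summands of the recursion for \<open>h\<close>.\<close>

definition cocycle_sums :: "nat \<Rightarrow> int \<Rightarrow> int \<Rightarrow> (nat set \<Rightarrow> 'k mpoly) set" where
  "cocycle_sums i j l = {z + w | z w. z \<in> cocycles i j l \<and> w \<in> null_cochains (Suc i) j l}"

lemma cocycle_sums_subspace: "fam.vs.subspace (cocycle_sums i j l)"
  unfolding cocycle_sums_def
  by (rule fam.vs.subspace_sums[OF cocycles_subspace null_cochains_subspace])

lemma cocycle_sums_sub:
  shows "cocycle_sums i j l \<subseteq> cocycles (Suc i) j l"
proof -
  have "cocycles i j l \<subseteq> cocycles (Suc i) j l"
    using null_sub_null_Suc by (auto simp: cocycles_def)
  then show ?thesis
    unfolding cocycle_sums_def using null_sub_cocycles cocycles_add by blast
qed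

text \<open>The relation \<open>?G\<close> is the connecting map: it divides \<open>cobd n z\<close>
  by the parameter, which raises the position and lowers the degree. It is onto because a parameter
  times a cocycle is a coboundary, and its kernel is the image of stage \<open>i\<close>.\<close>

lemma dim_cocycles_Suc:
  assumes i: "i < length \<theta>s" and j: "j \<ge> 0"
  shows "int (fam.vs.dim (cocycles (Suc i) j l)) - int (fam.vs.dim (cocycle_sums i j l)) = h i (j + 1) (l - 1)"
  unfolding h_def
proof (rule fam_fam.relates_dim)
  let ?\<theta> = "\<theta>s ! i"
  let ?G = "\<lambda>z w. cobd n z - mul ?\<theta> w \<in> null_cochains i (j + 1) l"
  show "fam_fam.relates (cocycles (Suc i) j l) (cocycle_sums i j l)
      (cocycles i (j + 1) (l - 1)) (coboundaries i (j + 1) (l - 1)) ?G"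
    unfolding fam_fam.relates_def
  proof (intro conjI allI impI ballI)
    fix z w z' w' c assume "?G z w" "?G z' w'"
    then have "(cobd n z - mul ?\<theta> w) + family_scale c (cobd n z' - mul ?\<theta> w') \<in> null_cochains i (j + 1) l"
      by (intro null_add null_scale)
    then show "?G (z + family_scale c z') (w + family_scale c w')"
      by (simp add: cobd_add cobd_scale mul_add mul_scale fam.vs.scale_right_diff_distrib algebra_simps)
  next
    fix z assume z: "z \<in> cocycles (Suc i) j l"
    then have "cobd n z \<in> null_cochains (Suc i) (j + 1) l" by (simp add: cocycles_def)
    then obtain p w where pw: "p \<in> null_cochains i (j + 1) l" "w \<in> cochains (j + 1) (l - 1)"
        "cobd n z = p + mul ?\<theta> w"
      by (rule null_cochains_Suc[OF i])
    have "cobd n p + mul ?\<theta> (cobd n w) = 0"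
      using arg_cong[OF pw(3), of "cobd n"] by (simp add: cobd_cobd cobd_add cobd_mul)
    then have "mul ?\<theta> (cobd n w) = - cobd n p" by (metis add.inverse_unique)
    then have "mul ?\<theta> (cobd n w) \<in> null_cochains i (j + 1 + 1) (l - 1 + 1)"
      using cobd_null[OF pw(1)] fam.vs.subspace_neg[OF null_cochains_subspace] by simp
    then have "cobd n w \<in> null_cochains i (j + 1 + 1) (l - 1)"
      using null_cochains_regular[OF i _ cobd_cochains[OF pw(2)]] j by simp
    then have "w \<in> cocycles i (j + 1) (l - 1)" using pw(2) by (simp add: cocycles_def)
    moreover have "?G z w" using pw by simp
    ultimately show "\<exists>w\<in>cocycles i (j + 1) (l - 1). ?G z w" by blast
  next
    fix w assume w: "w \<in> cocycles i (j + 1) (l - 1)"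
    from linear_mul_cocycle[OF nth_linear[OF i] w]
    have "mul ?\<theta> w \<in> coboundaries i (j + 1) l" by simp
    then obtain z p where zp: "mul ?\<theta> w = cobd n z + p" "z \<in> cochains j l" "p \<in> null_cochains i (j + 1) l"
      unfolding coboundaries_def by auto
    have eq: "cobd n z - mul ?\<theta> w = - p" using zp(1) by simp
    then have G: "?G z w" using zp(3) fam.vs.subspace_neg[OF null_cochains_subspace] by simp
    have "w \<in> cochains (j + 1) (l - 1)" using w by (simp add: cocycles_def)
    from mul_null_Suc[OF i this] G null_sub_null_Suc
    have "(cobd n z - mul ?\<theta> w) + mul ?\<theta> w \<in> null_cochains (Suc i) (j + 1) l"
      by (intro null_add) auto
    then have "z \<in> cocycles (Suc i) j l" using zp(2) by (simp add: cocycles_def)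
    then show "\<exists>z\<in>cocycles (Suc i) j l. ?G z w" using G by blast
  next
    fix z w assume z: "z \<in> cocycles (Suc i) j l" and w: "w \<in> cocycles i (j + 1) (l - 1)" and G: "?G z w"
    show "z \<in> cocycle_sums i j l \<longleftrightarrow> w \<in> coboundaries i (j + 1) (l - 1)"
    proof
      assume "z \<in> cocycle_sums i j l"
      then obtain z' p where zp: "z = z' + p" "z' \<in> cocycles i j l" "p \<in> null_cochains (Suc i) j l"
        unfolding cocycle_sums_def by blast
      obtain q u where qu: "q \<in> null_cochains i j l" "u \<in> cochains j (l - 1)" "p = q + mul ?\<theta> u"
        by (rule null_cochains_Suc[OF i zp(3)])
      have "(cobd n z' + cobd n q) - (cobd n z - mul ?\<theta> w) \<in> null_cochains i (j + 1) l"
        using zp(2) cobd_null[OF qu(1)] by (intro null_diff[OF _ G] null_add) (auto simp: cocycles_def)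
      also have "(cobd n z' + cobd n q) - (cobd n z - mul ?\<theta> w) = mul ?\<theta> (w - cobd n u)"
        by (simp add: zp(1) qu(3) cobd_add cobd_mul mul_diff)
      finally have "mul ?\<theta> (w - cobd n u) \<in> null_cochains i (j + 1) (l - 1 + 1)" by simp
      moreover have "w - cobd n u \<in> cochains (j + 1) (l - 1)"
        using w cobd_cochains[OF qu(2)] by (intro cochains_diff) (auto simp: cocycles_def)
      ultimately have "w - cobd n u \<in> null_cochains i (j + 1) (l - 1)"
        using null_cochains_regular[OF i] j by simp
      moreover have "w = cobd n u + (w - cobd n u)" by simp
      ultimately show "w \<in> coboundaries i (j + 1) (l - 1)"
        unfolding coboundaries_def using qu(2) by (simp only: add_diff_cancel_right') blast
    next
      assume "w \<in> coboundaries i (j + 1) (l - 1)"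
      then obtain u p where up: "w = cobd n u + p" "u \<in> cochains j (l - 1)" "p \<in> null_cochains i (j + 1) (l - 1)"
        unfolding coboundaries_def by auto
      \<comment> \<open>Subtracting \<open>mul ?\<theta> u\<close> changes \<open>z\<close> only by
        a cochain null at stage \<open>Suc i\<close>, yet turns it into a cocycle of stage
        \<open>i\<close>.\<close>
      have \<theta>u: "mul ?\<theta> u \<in> null_cochains (Suc i) j l" by (rule mul_null_Suc[OF i up(2)])
      have "mul ?\<theta> p \<in> null_cochains i (j + 1) l"
        using mul_null[OF nth_linear[OF i] up(3)] by simp
      with G have "(cobd n z - mul ?\<theta> w) + mul ?\<theta> p \<in> null_cochains i (j + 1) l" by (rule null_add)
      then have "cobd n (z - mul ?\<theta> u) \<in> null_cochains i (j + 1) l"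
        by (simp add: up(1) mul_add cobd_diff cobd_mul)
      moreover have "z - mul ?\<theta> u \<in> cochains j l"
        using z \<theta>u null_sub_cochains by (intro cochains_diff) (auto simp: cocycles_def)
      ultimately have "z - mul ?\<theta> u \<in> cocycles i j l" by (simp add: cocycles_def)
      moreover have "z = (z - mul ?\<theta> u) + mul ?\<theta> u" by simp
      ultimately show "z \<in> cocycle_sums i j l" unfolding cocycle_sums_def using \<theta>u by blast
    qed
  qed (fact cocycles_subspace cocycle_sums_subspace cocycle_sums_sub cocycles_fin_spanned
      coboundaries_subspace coboundaries_sub_cocycles)+
qed

text \<open>The image just cut out has the full dimension \<open>h i j l\<close>, since by
  \<open>cocycles_cap_null_Suc\<close> nothing of the cohomology of stage \<open>i\<close> is
  lost.\<close>

lemma dim_cocycle_sums: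
  assumes i: "i < length \<theta>s" and j: "j \<ge> 0"
  shows "int (fam.vs.dim (cocycle_sums i j l)) - int (fam.vs.dim (coboundaries (Suc i) j l)) = h i j l"
  unfolding h_def
proof (rule fam_fam.relates_dim)
  let ?G = "\<lambda>z w. z - w \<in> null_cochains (Suc i) j l"
  show "fam_fam.relates (cocycle_sums i j l) (coboundaries (Suc i) j l)
      (cocycles i j l) (coboundaries i j l) ?G"
    unfolding fam_fam.relates_def
  proof (intro conjI allI impI ballI)
    fix z w z' w' c assume "?G z w" "?G z' w'"
    then have "(z - w) + family_scale c (z' - w') \<in> null_cochains (Suc i) j l"
      by (intro null_add null_scale)
    then show "?G (z + family_scale c z') (w + family_scale c w')"
      by (simp add: fam.vs.scale_right_diff_distrib algebra_simps)
  next
    fix z assume "z \<in> cocycle_sums i j l"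
    then obtain w p where "w \<in> cocycles i j l" "p \<in> null_cochains (Suc i) j l" "z = w + p"
      unfolding cocycle_sums_def by blast
    moreover then have "?G z w" by simp
    ultimately show "\<exists>w\<in>cocycles i j l. ?G z w" by blast
  next
    fix w assume "w \<in> cocycles i j l"
    moreover have "w = w + 0" by simp
    ultimately have "w \<in> cocycle_sums i j l"
      unfolding cocycle_sums_def using fam.vs.subspace_0[OF null_cochains_subspace] by blast
    then show "\<exists>z\<in>cocycle_sums i j l. ?G z w"
      using fam.vs.subspace_0[OF null_cochains_subspace] by (metis diff_self)
  next
    fix z w assume z: "z \<in> cocycle_sums i j l" and w: "w \<in> cocycles i j l" and G: "?G z w"
    show "z \<in> coboundaries (Suc i) j l \<longleftrightarrow> w \<in> coboundaries i j l"
    proof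
      assume "z \<in> coboundaries (Suc i) j l"
      then obtain b p where bp: "b \<in> coboundaries i j l" "p \<in> null_cochains (Suc i) j l" "z = b + p"
        unfolding coboundaries_Suc[OF i] by blast
      have "p - (z - w) \<in> null_cochains (Suc i) j l" using bp(2) G by (rule null_diff)
      then have "w - b \<in> null_cochains (Suc i) j l" by (simp add: bp(3))
      moreover have "w - b \<in> cocycles i j l"
        using w bp(1) coboundaries_sub_cocycles by (intro cocycles_diff) auto
      ultimately have "w - b \<in> coboundaries i j l" using cocycles_cap_null_Suc[OF i j] by blast
      then have "(w - b) + b \<in> coboundaries i j l" using bp(1) by (rule coboundaries_add)
      then show "w \<in> coboundaries i j l" by simp
    next
      assume "w \<in> coboundaries i j l"
      moreover have "z = w + (z - w)" by simp
      ultimately show "z \<in> coboundaries (Suc i) j l" unfolding coboundaries_Suc[OF i] using G by blast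
    qed
  next
    show "coboundaries (Suc i) j l \<subseteq> cocycle_sums i j l"
      unfolding cocycle_sums_def coboundaries_Suc[OF i] subset_iff
      using coboundaries_sub_cocycles by blast
    show "fam.fin_spanned (cocycle_sums i j l)"
      by (rule fam.fin_spanned_mono[OF cocycles_fin_spanned cocycle_sums_sub])
  qed (fact cocycles_subspace cocycle_sums_subspace cocycles_fin_spanned
      coboundaries_subspace coboundaries_sub_cocycles)+
qed

lemma h_Suc:
  assumes "i < length \<theta>s" "j \<ge> 0"
  shows "h (Suc i) j l = h i j l + h i (j + 1) (l - 1)"
  using dim_cocycles_Suc[OF assms, of l] dim_cocycle_sums[OF assms, of l] unfolding h_def[of "Suc i"]
  by linarith

section \<open>Position 0: kernels and Hilbert functions\<close>

definition at_empty :: "'k mpoly \<Rightarrow> nat set \<Rightarrow> 'k mpoly" where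
  "at_empty u F = (if F = {} then u else 0)"

text \<open>Unfolding the coboundary at singletons: the polynomials that vanish on the star of every
  vertex modulo the first \<open>i\<close> parameters. Modulo \<open>J i {} l\<close> they form the
  cohomology in position 0.\<close>

definition kernel :: "nat \<Rightarrow> int \<Rightarrow> 'k mpoly set" where
  "kernel i l = {u \<in> homog n l. at_empty u \<in> cocycles i 0 l}"

text \<open>The Hilbert function of the face ring modulo the first \<open>i\<close>
  parameters.\<close>

definition quot_dim :: "nat \<Rightarrow> int \<Rightarrow> int" where
  "quot_dim i l = int (pm.vs.dim (homog n l :: 'k mpoly set)) - int (pm.vs.dim (J i {} l))"

lemma at_empty_lin: "at_empty (u + smul c u') = at_empty u + family_scale c (at_empty u')"
  by (rule ext) (simp add: at_empty_def family_scale_def)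

lemma at_empty_add: "at_empty (u + u') = at_empty u + at_empty u'"
  and at_empty_scale: "at_empty (smul c u) = family_scale c (at_empty u)"
  and at_empty_0: "at_empty 0 = 0"
  and at_empty_mul: "mul t (at_empty u) = at_empty (t * u)"
  by (auto simp: at_empty_def family_scale_def mul_def)

lemma at_empty_cochains: "at_empty u \<in> cochains 0 l \<longleftrightarrow> u \<in> homog n l"
  by (auto simp: cochains_def at_empty_def homog_0 split: if_splits)

lemma cochains_0_at_empty:
  assumes "y \<in> cochains 0 l"
  shows "y = at_empty (y {})"
proof
  fix F
  show "y F = at_empty (y {}) F"
  proof (cases "y F = 0 \<or> F = {}")
    case False
    then have "F \<subseteq> {1..n}" "card F = 0" using assms by (auto simp: cochains_def)
    then show ?thesis using False finite_subset[of F "{1..n}"] by simp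
  qed (auto simp: at_empty_def)
qed

lemma cochains_negative: "y \<in> cochains (-1) l \<Longrightarrow> y = 0"
  by (rule ext) (auto simp: cochains_def)

lemma coboundaries_0: "coboundaries i 0 l = null_cochains i 0 l"
proof
  show "coboundaries i 0 l \<subseteq> null_cochains i 0 l"
  proof
    fix x assume "x \<in> coboundaries i 0 l"
    then obtain y w where "x = cobd n y + w" "y \<in> cochains (-1) l" "w \<in> null_cochains i 0 l"
      unfolding coboundaries_def by auto
    then show "x \<in> null_cochains i 0 l" using cochains_negative[of y l] by (simp add: cobd_zero)
  qed
qed (rule null_sub_coboundaries)

lemma at_empty_null: "at_empty u \<in> null_cochains i 0 l \<longleftrightarrow> u \<in> J i {} l"
proof -
  have "u \<in> homog n l" if "u \<in> J i {} l" using that J_homog by blast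
  moreover have "(\<forall>F. at_empty u F \<in> J i F l) \<longleftrightarrow> u \<in> J i {} l"
    by (metis at_empty_def J_0)
  ultimately show ?thesis by (auto simp: null_cochains_def at_empty_cochains)
qed

lemma kernel_subspace: "pm.vs.subspace (kernel i l)"
  using cocycles_subspace[of i 0 l] unfolding kernel_def fam.vs.subspace_def
  by (intro pm.vs.subspaceI)
    (auto simp: at_empty_add at_empty_scale at_empty_0 homog_0 homog_add homog_smul)

lemma kernel_sub: "kernel i l \<subseteq> homog n l"
  by (auto simp: kernel_def)

lemma J_sub_kernel: "J i {} l \<subseteq> kernel i l"
  using J_homog at_empty_null null_sub_cocycles by (fastforce simp: kernel_def)

lemma kernel_fin_spanned: "pm.fin_spanned (kernel i l)"
  by (rule pm.fin_spanned_mono[OF homog_fin_spanned kernel_sub])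

lemma h_0_eq_kernel: "h i 0 l = int (pm.vs.dim (kernel i l)) - int (pm.vs.dim (J i {} l))"
  unfolding h_def
proof (rule fam_pm.relates_dim)
  show "fam_pm.relates (cocycles i 0 l) (coboundaries i 0 l) (kernel i l) (J i {} l) (\<lambda>y u. y = at_empty u)"
    unfolding fam_pm.relates_def
  proof (intro conjI allI impI ballI)
    fix z assume z: "z \<in> cocycles i 0 l"
    then have eq: "z = at_empty (z {})"
      using cochains_0_at_empty[of z l] unfolding cocycles_def by blast
    then have "at_empty (z {}) \<in> cocycles i 0 l" using z by metis
    then have "z {} \<in> kernel i l"
      using at_empty_cochains unfolding kernel_def cocycles_def by blast
    with eq show "\<exists>w\<in>kernel i l. z = at_empty w" by blast
  qed (insert kernel_subspace[of i l] kernel_fin_spanned[of i l], auto simp: at_empty_lin coboundaries_0 at_empty_null cocycles_subspace null_cochains_subspace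
      J_subspace cocycles_fin_spanned
      kernel_def dest: subsetD[OF null_sub_cocycles] subsetD[OF J_sub_kernel, unfolded kernel_def])
qed

lemma Var_mult_kernel:
  assumes "u \<in> kernel i l" "v \<in> {1..n}"
  shows "Var v * u \<in> J i {} (l + 1)"
  using Var_mul_cocycle[OF assms(2), of "at_empty u" i 0 l] assms(1)
  by (simp add: kernel_def at_empty_mul coboundaries_0 at_empty_null)

text \<open>One direction holds because parameters kill cohomology. Conversely, if the parameter
  sends \<open>u\<close> to zero, it also sends the coboundary of \<open>u\<close> to zero; that
  coboundary sits in position 1, where the parameter is regular.\<close>

lemma mem_kernel_iff:
  assumes i: "i < length \<theta>s"
  shows "u \<in> kernel i l \<longleftrightarrow> u \<in> homog n l \<and> \<theta>s ! i * u \<in> J i {} (l + 1)"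
proof
  assume u: "u \<in> kernel i l"
  then have "mul (\<theta>s ! i) (at_empty u) \<in> coboundaries i 0 (l + 1)"
    by (intro linear_mul_cocycle nth_linear i) (simp add: kernel_def)
  then show "u \<in> homog n l \<and> \<theta>s ! i * u \<in> J i {} (l + 1)"
    using u by (simp add: kernel_def at_empty_mul coboundaries_0 at_empty_null)
next
  assume u: "u \<in> homog n l \<and> \<theta>s ! i * u \<in> J i {} (l + 1)"
  then have uC: "at_empty u \<in> cochains 0 l" by (simp add: at_empty_cochains)
  have "mul (\<theta>s ! i) (at_empty u) \<in> null_cochains i 0 (l + 1)"
    using u by (simp add: at_empty_mul at_empty_null)
  then have "mul (\<theta>s ! i) (cobd n (at_empty u)) \<in> null_cochains i (0 + 1) (l + 1)"
    unfolding cobd_mul[symmetric] by (rule cobd_null)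
  then have "cobd n (at_empty u) \<in> null_cochains i (0 + 1) l"
    by (rule null_cochains_regular[OF i _ cobd_cochains[OF uC], rotated]) simp
  then show "u \<in> kernel i l" using u uC by (simp add: kernel_def cocycles_def)
qed

lemma J_fin_spanned: "pm.fin_spanned (J i F l)"
  by (rule pm.fin_spanned_mono[OF homog_fin_spanned J_homog])

text \<open>Multiplication by the parameter maps \<open>homog n (l - 1)\<close> onto
  \<open>J (Suc i) {} l\<close> modulo \<open>J i {} l\<close>, with kernel
  \<open>kernel i (l - 1)\<close>.\<close>

lemma dim_J_Suc:
  assumes i: "i < length \<theta>s"
  shows "int (pm.vs.dim (J (Suc i) {} l)) - int (pm.vs.dim (J i {} l))
    = int (pm.vs.dim (homog n (l - 1) :: 'k mpoly set)) - int (pm.vs.dim (kernel i (l - 1)))"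
proof (rule pm_pm.relates_dim)
  let ?\<theta> = "\<theta>s ! i"
  let ?G = "\<lambda>a w. a - ?\<theta> * w \<in> J i {} l"
  show "pm_pm.relates (J (Suc i) {} l) (J i {} l) (homog n (l - 1)) (kernel i (l - 1)) ?G"
    unfolding pm_pm.relates_def
  proof (intro conjI allI impI ballI)
    fix z w z' w' c assume "?G z w" "?G z' w'"
    then have "(z - ?\<theta> * w) + smul c (z' - ?\<theta> * w') \<in> J i {} l" by (intro J_add J_smul)
    then show "?G (z + smul c z') (w + smul c w')"
      by (simp add: pm.vs.scale_right_diff_distrib distrib_left smul_mult_right algebra_simps)
  next
    fix z assume "z \<in> J (Suc i) {} l"
    then obtain p w where "p \<in> J i {} l" "w \<in> homog n (l - 1)" "z = p + ?\<theta> * w"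
      by (rule mem_J_Suc[OF i])
    then have "?G z w" by simp
    then show "\<exists>w\<in>homog n (l - 1). ?G z w" using \<open>w \<in> _\<close> by blast
  next
    fix w :: "'k mpoly" assume "w \<in> homog n (l - 1)"
    then show "\<exists>z\<in>J (Suc i) {} l. ?G z w"
      using mult_J_Suc[OF i] by (intro bexI[of _ "?\<theta> * w"]) (auto simp: J_0)
  next
    fix z w assume "w \<in> homog n (l - 1)" and G: "?G z w"
    then have "w \<in> kernel i (l - 1) \<longleftrightarrow> ?\<theta> * w \<in> J i {} l" by (simp add: mem_kernel_iff[OF i])
    also have "\<dots> \<longleftrightarrow> z \<in> J i {} l"
      using J_add[OF G, of "?\<theta> * w"] J_diff[OF _ G, of z] by auto
    finally show "z \<in> J i {} l \<longleftrightarrow> w \<in> kernel i (l - 1)" by blast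
  qed (fact J_subspace J_Suc J_fin_spanned homog_subspace kernel_subspace kernel_sub homog_fin_spanned)+
qed

lemma quot_dim_Suc:
  assumes "i < length \<theta>s"
  shows "quot_dim (Suc i) l = quot_dim i l - quot_dim i (l - 1) + h i 0 (l - 1)"
  using dim_J_Suc[OF assms, of l] h_0_eq_kernel[of i "l - 1"] unfolding quot_dim_def by linarith

lemma h_0_le_quot_dim: "h i 0 l \<le> quot_dim i l"
  using pm.dim_subset_le[OF homog_fin_spanned kernel_subspace kernel_sub, of i l]
  unfolding quot_dim_def h_0_eq_kernel by linarith

section \<open>Exactness in nonzero polynomial degree\<close>

lemma mem_J_0: "p \<in> J 0 F l \<longleftrightarrow> p \<in> homog n l \<and> (\<forall>a. keys a \<union> F \<in> \<Delta> \<longrightarrow> lookup p a = 0)"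
  unfolding J_def take_0 list.set gr_ideal_empty nonface_def homog_def supported_on_iff mem_star by blast

text \<open>Without parameters the complex splits according to monomials. A monomial of nonzero
  degree has a vertex in its support, and the cone operator with that apex contracts its summand;
  the minimum serves as a definite choice of apex.\<close>

lemma exact_degree_nonzero:
  assumes l: "l \<noteq> 0"
  shows "cocycles 0 j l \<subseteq> coboundaries 0 j l"
proof
  fix y assume y: "y \<in> cocycles 0 j l"
  then have yC: "y \<in> cochains j l" by (simp add: cocycles_def)
  define v where "v a = Min (keys a)" for a :: "nat \<Rightarrow>\<^sub>0 nat"
  have v: "v a \<in> keys a" "v a \<in> {1..n}" if "a \<in> mons n l" for a
  proof -
    have "keys a \<noteq> {}" using that l by (auto simp: mons_def mon_degree_def)
    then show "v a \<in> keys a" unfolding v_def by (rule Min_in[rotated]) simp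
    then show "v a \<in> {1..n}" using that by (auto simp: mons_def)
  qed
  define s where "s F = (\<Sum>a\<in>mons n l. single a (contr n (v a) (\<lambda>G. lookup (y G) a) F))" for F
  have ls: "lookup (s F) a = (if a \<in> mons n l then contr n (v a) (\<lambda>G. lookup (y G) a) F else 0)" for F a
    unfolding s_def using finite_mons by (simp add: lookup_sum lookup_single when_def)
  have sC: "s \<in> cochains (j - 1) l"
  proof -
    have "F \<subseteq> {1..n} \<and> int (card F) = j - 1" if nz: "s F \<noteq> 0" for F
    proof -
      obtain a where "lookup (s F) a \<noteq> 0" using nz by (metis poly_mapping_eqI lookup_zero)
      then have a: "a \<in> mons n l" "contr n (v a) (\<lambda>G. lookup (y G) a) F \<noteq> 0"
        by (auto simp: ls split: if_splits)
      then have F: "v a \<notin> F" "F \<subseteq> {1..n}" "y (insert (v a) F) \<noteq> 0"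
        by (auto simp: contr_def split: if_splits)
      then have "int (card (insert (v a) F)) = j" using yC by (auto simp: cochains_def)
      then show ?thesis using F finite_subset[OF F(2)] by auto
    qed
    then show ?thesis by (auto simp: cochains_def homog_def supported_on_iff ls)
  qed
  have "y F - cobd n s F \<in> J 0 F l" for F
    unfolding mem_J_0
  proof (intro conjI allI impI)
    show "y F - cobd n s F \<in> homog n l"
      using yC cobd_cochains[OF sC] by (intro homog_diff) (auto simp: cochains_def)
    fix a :: "nat \<Rightarrow>\<^sub>0 nat" assume aF: "keys a \<union> F \<in> \<Delta>"
    show "lookup (y F - cobd n s F) a = 0"
    proof (cases "a \<in> mons n l")
      case False
      then show ?thesis using \<open>y F - cobd n s F \<in> homog n l\<close> by (simp add: homog_def supported_on_iff)
    next
      case True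
      let ?y = "\<lambda>G. lookup (y G) a"
      have F: "F \<subseteq> {1..n}" using aF faces_subset by blast
      have "lookup (cobd n s F) a = cobd n (contr n (v a) ?y) F"
        unfolding lookup_cobd using True by (simp add: ls)
      then have "lookup (y F - cobd n s F) a = contr n (v a) (cobd n ?y) F"
        using contr_homotopy[OF F v(2)[OF True], of ?y] by (simp add: lookup_minus algebra_simps)
      \<comment> \<open>Adding \<open>v a\<close> to \<open>F\<close> does not change
        \<open>keys a \<union> F\<close>, so the coefficient at \<open>a\<close> is tested at
        \<open>insert (v a) F\<close> as well, and the cocycle condition there makes it
        zero.\<close>
      also have "\<dots> = 0"
      proof -
        have "cobd n y (insert (v a) F) \<in> J 0 (insert (v a) F) l"
          using y by (simp add: cocycles_def null_cochains_def)
        moreover have "keys a \<union> insert (v a) F = keys a \<union> F" using v(1)[OF True] by blast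
        ultimately have "lookup (cobd n y (insert (v a) F)) a = 0" using aF by (simp add: mem_J_0)
        then show ?thesis by (simp add: contr_def lookup_cobd)
      qed
      finally show ?thesis .
    qed
  qed
  moreover have "y - cobd n s \<in> cochains j l"
    using yC cobd_cochains[OF sC] by (intro cochains_diff) auto
  ultimately have "y - cobd n s \<in> null_cochains 0 j l" by (simp add: null_cochains_def)
  moreover have "y = cobd n s + (y - cobd n s)" by simp
  ultimately show "y \<in> coboundaries 0 j l" unfolding coboundaries_def using sC by blast
qed

lemma h_zero_degree_nonzero: "l \<noteq> 0 \<Longrightarrow> h 0 j l = 0"
  using exact_degree_nonzero[of l j] coboundaries_sub_cocycles[of 0 j l] unfolding h_def by simp

end

section \<open>Simplicial homology\<close>

lemma pairing_zero_left: "pairing 0 q = 0"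
  by (simp add: pairing_def)

lemma pairing_sum_left: "pairing (\<Sum>x\<in>A. f x) q = (\<Sum>x\<in>A. pairing (f x) q)"
  by (induction A rule: infinite_finite_induct) (auto simp: pairing_add_left pairing_zero_left)

lemma pairing_single_left: "pairing (single x a) q = a * lookup q x"
  by (cases "a = 0") (auto simp: pairing_def)

lemma pairing_single_right: "pairing p (single x 1) = lookup p x"
proof -
  have "pairing p (single x 1) = (\<Sum>y\<in>keys p. if y = x then lookup p x else 0)"
    unfolding pairing_def by (rule sum.cong) (auto simp: lookup_single when_def)
  then show ?thesis by (simp add: in_keys_iff)
qed

text \<open>Adjointness of boundary and coboundary. Summing over all subsets avoids any reference to
  the support of \<open>c\<close>.\<close>

lemma pairing_boundary:
  assumes "keys c \<subseteq> Pow {1..n}"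
  shows "pairing (boundary c) e = (\<Sum>F\<in>Pow {1..n}. lookup c F * cobd n (lookup e) F)"
proof -
  have "pairing (boundary c) e = (\<Sum>F\<in>keys c. lookup c F * cobd n (lookup e) F)"
    unfolding boundary_def pairing_sum_left
  proof (rule sum.cong[OF refl])
    fix F assume "F \<in> keys c"
    then have "F \<subseteq> {1..n}" using assms by blast
    then show "(\<Sum>v\<in>F. pairing (single (F - {v}) ((-1) ^ card {u \<in> F. u < v} * lookup c F)) e)
        = lookup c F * cobd n (lookup e) F"
      by (simp add: pairing_single_left cobd_def eps_def sum_distrib_left algebra_simps)
  qed
  also have "\<dots> = (\<Sum>F\<in>Pow {1..n}. lookup c F * cobd n (lookup e) F)"
    using assms by (intro sum.mono_neutral_left) (auto simp: in_keys_iff)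
  finally show ?thesis .
qed

lemma lookup_boundary:
  "keys c \<subseteq> Pow {1..n} \<Longrightarrow>
    lookup (boundary c) G = (\<Sum>F\<in>Pow {1..n}. lookup c F * cobd n (lookup (single G 1)) F)"
  using pairing_boundary[of c n "single G 1"] by (simp add: pairing_single_right)

context partition_complex
begin

section \<open>Reduced homology by dimensions of subspaces\<close>

lemma chains_eq: "chains \<Delta> i = supported_on (faces \<Delta> i)"
  by (simp add: chains_def supported_on_def)

lemma faces_Pow: "faces \<Delta> i \<subseteq> Pow {1..n}"
  using faces_subset by (auto simp: faces_def)

lemma finite_faces: "finite (faces \<Delta> i)"
  using faces_Pow finite_subset by (metis finite_Pow_iff finite_atLeastAtMost)

lemma chains_keys: "c \<in> chains \<Delta> i \<Longrightarrow> keys c \<subseteq> Pow {1..n}"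
  using faces_Pow by (auto simp: chains_def)

lemma mem_faces: "F \<in> faces \<Delta> i \<longleftrightarrow> F \<in> \<Delta> \<and> int (card F) = i + 1"
  by (auto simp: faces_def face_dim_def)

lemma face_delete:
  assumes "F \<in> faces \<Delta> i" "u \<in> F"
  shows "F - {u} \<in> faces \<Delta> (i - 1)"
proof -
  have "finite F" using assms(1) faces_Pow finite_subset[of F "{1..n}"] by blast
  then have card: "card F = Suc (card (F - {u}))" using assms(2) by (rule card.remove)
  have "F \<in> \<Delta>" using assms(1) by (simp add: mem_faces)
  then have "F - {u} \<in> \<Delta>" using down_closed unfolding down_closed_def by blast
  then show ?thesis using assms(1) card by (simp add: mem_faces)
qed

abbreviation "cycles i \<equiv> {c \<in> chains \<Delta> i. boundary c = 0} :: (nat set \<Rightarrow>\<^sub>0 'k) set"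
abbreviation "boundaries i \<equiv> boundary ` chains \<Delta> (i + 1) :: (nat set \<Rightarrow>\<^sub>0 'k) set"

lemma boundary_chains: "c \<in> chains \<Delta> i \<Longrightarrow> boundary c \<in> chains \<Delta> (i - 1)"
  unfolding boundary_def chains_eq
  by (intro pm.vs.subspace_sum[OF subspace_supported_on])
    (auto simp: supported_on_def intro: face_delete)

lemma boundary_lin:
  assumes "c \<in> chains \<Delta> i" "c' \<in> chains \<Delta> i"
  shows "boundary (c + smul a c') = boundary c + smul a (boundary (c' :: nat set \<Rightarrow>\<^sub>0 'k))"
proof (rule poly_mapping_eqI)
  fix G
  have "c + smul a c' \<in> chains \<Delta> i"
    using assms unfolding chains_eq
    by (intro pm.vs.subspace_add pm.vs.subspace_scale subspace_supported_on)
  then show "lookup (boundary (c + smul a c')) G = lookup (boundary c + smul a (boundary c')) G"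
    using assms
    by (simp add: lookup_boundary[OF chains_keys] lookup_add lookup_map_times distrib_right
        sum.distrib sum_distrib_left mult.assoc)
qed

lemma boundary_0: "boundary 0 = 0"
  by (simp add: boundary_def)

lemma boundary_add: "c \<in> chains \<Delta> i \<Longrightarrow> c' \<in> chains \<Delta> i \<Longrightarrow>
    boundary (c + c') = boundary c + boundary (c' :: nat set \<Rightarrow>\<^sub>0 'k)"
  using boundary_lin[of c i c' 1] by (simp add: pm.vs.scale_one)

lemma boundary_smul: "c \<in> chains \<Delta> i \<Longrightarrow> boundary (smul a c) = smul a (boundary (c :: nat set \<Rightarrow>\<^sub>0 'k))"
  using boundary_lin[of 0 i c a] by (simp add: boundary_0 chains_def)

lemma chains_subspace: "pm.vs.subspace (chains \<Delta> i)"
  unfolding chains_eq by (rule subspace_supported_on)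

lemma cycles_subspace: "pm.vs.subspace (cycles i)"
  using chains_subspace[of i] unfolding pm.vs.subspace_def
  by (auto simp: boundary_add boundary_smul boundary_0)

lemma boundaries_subspace: "pm.vs.subspace (boundaries i)"
proof (rule pm.vs.subspaceI)
  show "0 \<in> boundaries i" using boundary_0 pm.vs.subspace_0[OF chains_subspace] by (metis imageI)
  show "x + y \<in> boundaries i" if "x \<in> boundaries i" "y \<in> boundaries i" for x y
  proof -
    obtain c c' where c: "c \<in> chains \<Delta> (i + 1)" "x = boundary c" "c' \<in> chains \<Delta> (i + 1)" "y = boundary c'"
      using \<open>x \<in> _\<close> \<open>y \<in> _\<close> by blast
    then have "x + y = boundary (c + c')" by (simp add: boundary_add)
    then show ?thesis using pm.vs.subspace_add[OF chains_subspace c(1,3)] by blast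
  qed
  show "smul a x \<in> boundaries i" if "x \<in> boundaries i" for a x
  proof -
    obtain c where c: "c \<in> chains \<Delta> (i + 1)" "x = boundary c" using \<open>x \<in> _\<close> by blast
    then have "smul a x = boundary (smul a c)" by (simp add: boundary_smul)
    then show ?thesis using pm.vs.subspace_scale[OF chains_subspace c(1), of a] by blast
  qed
qed

text \<open>Moving both boundaries across the pairing turns each coefficient into a pairing with
  \<open>cobd n (cobd n _)\<close>, which vanishes.\<close>

lemma boundary_boundary:
  fixes c :: "nat set \<Rightarrow>\<^sub>0 'k"
  assumes "c \<in> chains \<Delta> i"
  shows "boundary (boundary c) = 0"
proof (rule poly_mapping_eqI)
  fix G
  define f where "f = cobd n (lookup (single G (1::'k)))"
  define e where "e = (\<Sum>F\<in>Pow {1..n}. single F (f F))"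
  have e: "lookup e = f"
  proof
    fix F
    have "lookup e F = (if F \<in> Pow {1..n} then f F else 0)"
      unfolding e_def by (simp add: lookup_sum lookup_single when_def)
    then show "lookup e F = f F" by (auto simp: f_def cobd_def)
  qed
  have bc: "keys (boundary c) \<subseteq> Pow {1..n}" using chains_keys[OF boundary_chains[OF assms]] .
  have "lookup (boundary (boundary c)) G = (\<Sum>F\<in>Pow {1..n}. lookup (boundary c) F * f F)"
    unfolding f_def by (rule lookup_boundary[OF bc])
  also have "\<dots> = pairing (boundary c) e"
    using pairing_eq[OF _ bc, of e] by (simp add: e)
  also have "\<dots> = (\<Sum>F\<in>Pow {1..n}. lookup c F * cobd n (lookup e) F)"
    by (rule pairing_boundary[OF chains_keys[OF assms]])
  also have "\<dots> = 0" by (simp add: e f_def cobd_cobd)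
  finally show "lookup (boundary (boundary c)) G = lookup 0 G" by simp
qed

lemma boundaries_sub_cycles: "boundaries i \<subseteq> cycles i"
  using boundary_boundary boundary_chains[of _ "i + 1"] by auto

lemma cycles_fin_spanned: "pm.fin_spanned (cycles i)"
  by (rule pm.fin_spanned_mono[OF fin_spanned_supported_on[OF finite_faces]])
    (auto simp: chains_eq)

lemma betti_eq: "int (betti TYPE('k) \<Delta> i) = int (pm.vs.dim (cycles i)) - int (pm.vs.dim (boundaries i))"
proof -
  let ?M = "cycle_space \<Delta> i :: ('k, nat set \<Rightarrow>\<^sub>0 'k) module"
  have carr: "carrier ?M = cycles i" by (simp add: cycle_space_def)
  note cl = pm.vs.subspace_0[OF cycles_subspace[of i]] pm.vs.subspace_add[OF cycles_subspace[of i]]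
    pm.vs.subspace_scale[OF cycles_subspace[of i]] pm.vs.subspace_neg[OF cycles_subspace[of i]]
  interpret M: abelian_group ?M
  proof (rule abelian_groupI)
    show "\<exists>y\<in>carrier ?M. y \<oplus>\<^bsub>?M\<^esub> x = \<zero>\<^bsub>?M\<^esub>" if "x \<in> carrier ?M" for x
      using cl(4)[of x] that by (intro bexI[of _ "- x"]) (simp_all add: cycle_space_def)
  qed (use cl in \<open>simp_all add: cycle_space_def ac_simps\<close>)
  have cring: "cring (class_ring :: 'k ring)"
    using class_field unfolding field_def domain_def by blast
  interpret M: Module.module "class_ring :: 'k ring" ?M
    by (rule Module.moduleI) (use cl cring M.abelian_group_axioms in
      \<open>simp_all add: cycle_space_def pm.vs.scale_left_distrib pm.vs.scale_right_distrib\<close>)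
  have sub: "submodule class_ring (boundaries i) ?M"
    unfolding submodule_def
    using M.module_axioms boundaries_sub_cycles[of i] boundaries_subspace[of i]
    by (auto simp: cycle_space_def pm.vs.subspace_def)
  have minus: "a \<ominus>\<^bsub>?M\<^esub> b = a - b" if "a \<in> cycles i" "b \<in> cycles i" for a b
  proof -
    have "\<ominus>\<^bsub>?M\<^esub> b = - b"
    proof (rule M.minus_equality)
      show "- b \<oplus>\<^bsub>?M\<^esub> b = \<zero>\<^bsub>?M\<^esub>" by (simp add: cycle_space_def)
      show "b \<in> carrier ?M" unfolding carr by (rule that(2))
      show "- b \<in> carrier ?M" unfolding carr by (rule cl(4)[OF that(2)])
    qed
    then show ?thesis by (simp add: a_minus_def cycle_space_def)
  qed
  interpret Q: quotient_by_submodule "class_ring :: 'k ring" ?M "boundaries i"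
    by (rule quotient_by_submodule.intro[OF M.module_axioms], rule quotient_by_submodule_axioms.intro, rule sub)
  have "k_dim (quot_module ?M (boundaries i)) = pm.vs.dim (cycles i) - pm.vs.dim (boundaries i)"
  proof (rule pm.k_dim_eq_dim_diff[OF cycles_subspace cycles_fin_spanned boundaries_subspace boundaries_sub_cycles,
        where \<phi> = "\<lambda>a. boundaries i +>\<^bsub>?M\<^esub> a"])
    show "carrier (quot_module ?M (boundaries i)) = (\<lambda>a. boundaries i +>\<^bsub>?M\<^esub> a) ` cycles i"
      using Q.carrier_quot_module carr by simp
    show "\<zero>\<^bsub>quot_module ?M (boundaries i)\<^esub> = boundaries i +>\<^bsub>?M\<^esub> 0"
      using Q.zero_quot_module by (simp add: cycle_space_def)
    fix a b :: "nat set \<Rightarrow>\<^sub>0 'k" and c :: 'k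
    assume a: "a \<in> cycles i"
    show "c \<odot>\<^bsub>quot_module ?M (boundaries i)\<^esub> (boundaries i +>\<^bsub>?M\<^esub> a) = boundaries i +>\<^bsub>?M\<^esub> smul c a"
      using Q.smult_quot_module[of c a] a carr by (simp add: cycle_space_def)
    assume b: "b \<in> cycles i"
    show "(boundaries i +>\<^bsub>?M\<^esub> a) \<oplus>\<^bsub>quot_module ?M (boundaries i)\<^esub> (boundaries i +>\<^bsub>?M\<^esub> b) = boundaries i +>\<^bsub>?M\<^esub> (a + b)"
      using Q.add_quot_module[of a b] a b carr by (simp add: cycle_space_def)
    show "(boundaries i +>\<^bsub>?M\<^esub> a = boundaries i +>\<^bsub>?M\<^esub> b) = (a - b \<in> boundaries i)"
      using Q.coset_eq_iff[of a b] a b carr minus[OF a b] by simp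
  qed
  then show ?thesis
    using pm.dim_subset_le[OF cycles_fin_spanned boundaries_subspace boundaries_sub_cycles, of i]
    unfolding betti_def reduced_homology_def by simp
qed

section \<open>Simplicial cohomology and duality\<close>

definition simp_cocycles :: "int \<Rightarrow> (nat set \<Rightarrow>\<^sub>0 'k) set" where
  "simp_cocycles i = {e \<in> chains \<Delta> i. \<forall>F\<in>faces \<Delta> (i + 1). cobd n (lookup e) F = 0}"

text \<open>Equality with the coboundary is asked on faces only: \<open>cobd\<close> belongs to the
  full simplex and may be nonzero on nonfaces.\<close>

definition simp_coboundaries :: "int \<Rightarrow> (nat set \<Rightarrow>\<^sub>0 'k) set" where
  "simp_coboundaries i =
    {e \<in> chains \<Delta> i. \<exists>e'\<in>chains \<Delta> (i - 1). \<forall>F\<in>faces \<Delta> i. lookup e F = cobd n (lookup e') F}"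

lemma simp_cocycles_annih: "simp_cocycles i = annih (faces \<Delta> i) (boundaries i)"
proof (rule Set.set_eqI)
  fix e
  have "(\<forall>F\<in>faces \<Delta> (i + 1). cobd n (lookup e) F = 0) \<longleftrightarrow> (\<forall>p\<in>boundaries i. pairing p e = 0)"
  proof
    assume L: "\<forall>F\<in>faces \<Delta> (i + 1). cobd n (lookup e) F = 0"
    have "pairing (boundary c) e = 0" if c: "c \<in> chains \<Delta> (i + 1)" for c
    proof -
      have "lookup c F * cobd n (lookup e) F = 0" for F
        using L c by (cases "F \<in> faces \<Delta> (i + 1)") (auto simp: chains_eq supported_on_iff)
      then show ?thesis by (simp add: pairing_boundary[OF chains_keys[OF c]])
    qed
    then show "\<forall>p\<in>boundaries i. pairing p e = 0" by blast
  next
    assume R: "\<forall>p\<in>boundaries i. pairing p e = 0"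
    show "\<forall>F\<in>faces \<Delta> (i + 1). cobd n (lookup e) F = 0"
    proof
      fix F assume F: "F \<in> faces \<Delta> (i + 1)"
      then have c: "single F 1 \<in> chains \<Delta> (i + 1)" by (simp add: chains_def)
      have "(\<Sum>G\<in>Pow {1..n}. lookup (single F 1) G * cobd n (lookup e) G)
          = (\<Sum>G\<in>Pow {1..n}. if G = F then cobd n (lookup e) F else 0)"
        by (rule sum.cong) (auto simp: lookup_single when_def)
      also have "\<dots> = cobd n (lookup e) F" using F faces_Pow by auto
      finally have "cobd n (lookup e) F = pairing (boundary (single F 1)) e"
        by (simp add: pairing_boundary[OF chains_keys[OF c]])
      then show "cobd n (lookup e) F = 0" using R c by auto
    qed
  qed
  then show "e \<in> simp_cocycles i \<longleftrightarrow> e \<in> annih (faces \<Delta> i) (boundaries i)"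
    by (simp add: simp_cocycles_def annih_def chains_eq)
qed

lemma simp_coboundary_exists:
  fixes e' :: "nat set \<Rightarrow>\<^sub>0 'k"
  shows "\<exists>e\<in>chains \<Delta> i. \<forall>F\<in>faces \<Delta> i. lookup e F = cobd n (lookup e') F"
proof -
  define e where "e = (\<Sum>F\<in>faces \<Delta> i. single F (cobd n (lookup e') F))"
  have "lookup e F = (if F \<in> faces \<Delta> i then cobd n (lookup e') F else 0)" for F
    unfolding e_def using finite_faces by (simp add: lookup_sum lookup_single when_def)
  then show ?thesis by (intro bexI[of _ e]) (simp_all add: chains_eq supported_on_iff)
qed

text \<open>By adjointness, pairing with a coboundary of \<open>e'\<close> is pairing the boundary
  with \<open>e'\<close>; the indicators of the faces one dimension lower detect every coefficient
  of the boundary.\<close>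

lemma cycles_annih: "cycles i = annih (faces \<Delta> i) (simp_coboundaries i)"
proof (rule Set.set_eqI)
  fix c :: "nat set \<Rightarrow>\<^sub>0 'k"
  have pair: "pairing e c = pairing (boundary c) e'"
    if c: "c \<in> chains \<Delta> i" and e: "e \<in> chains \<Delta> i" "\<And>F. F \<in> faces \<Delta> i \<Longrightarrow> lookup e F = cobd n (lookup e') F" for e e'
  proof -
    have "pairing e c = (\<Sum>F\<in>faces \<Delta> i. lookup e F * lookup c F)"
      using e(1) by (intro pairing_eq[OF finite_faces]) (simp add: chains_def)
    also have "\<dots> = (\<Sum>F\<in>faces \<Delta> i. lookup c F * cobd n (lookup e') F)"
      by (intro sum.cong) (simp_all add: e(2))
    also have "\<dots> = (\<Sum>F\<in>Pow {1..n}. lookup c F * cobd n (lookup e') F)"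
      using c faces_Pow by (intro sum.mono_neutral_left) (auto simp: chains_eq supported_on_iff)
    also have "\<dots> = pairing (boundary c) e'" by (simp add: pairing_boundary[OF chains_keys[OF c]])
    finally show ?thesis .
  qed
  show "c \<in> cycles i \<longleftrightarrow> c \<in> annih (faces \<Delta> i) (simp_coboundaries i)"
  proof
    assume c: "c \<in> cycles i"
    have "pairing e c = 0" if "e \<in> simp_coboundaries i" for e
    proof -
      obtain e' where "e \<in> chains \<Delta> i" "\<forall>F\<in>faces \<Delta> i. lookup e F = cobd n (lookup e') F"
        using \<open>e \<in> simp_coboundaries i\<close> unfolding simp_coboundaries_def by blast
      then show ?thesis using pair[of e e'] c by (simp add: pairing_zero_left)
    qed
    then show "c \<in> annih (faces \<Delta> i) (simp_coboundaries i)" using c by (simp add: annih_def chains_eq)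
  next
    assume c: "c \<in> annih (faces \<Delta> i) (simp_coboundaries i)"
    then have cC: "c \<in> chains \<Delta> i" by (simp add: annih_def chains_eq)
    have "boundary c = 0"
    proof (rule poly_mapping_eqI)
      fix G
      show "lookup (boundary c) G = lookup 0 G"
      proof (cases "G \<in> faces \<Delta> (i - 1)")
        case False
        then show ?thesis using boundary_chains[OF cC] by (simp add: chains_eq supported_on_iff)
      next
        case True
        then have G: "single G (1::'k) \<in> chains \<Delta> (i - 1)" by (simp add: chains_def)
        obtain e where e: "e \<in> chains \<Delta> i" "\<forall>F\<in>faces \<Delta> i. lookup e F = cobd n (lookup (single G (1::'k))) F"
          using simp_coboundary_exists[of i "single G 1"] by blast
        then have "e \<in> simp_coboundaries i" using G unfolding simp_coboundaries_def by blast
        then have "pairing e c = 0" using c by (simp add: annih_def)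
        then show ?thesis using pair[OF cC e(1)] e(2) by (simp add: pairing_single_right)
      qed
    qed
    then show "c \<in> cycles i" using cC by simp
  qed
qed

lemma simp_coboundaries_subspace: "pm.vs.subspace (simp_coboundaries i)"
proof (rule pm.vs.subspaceI)
  show "0 \<in> simp_coboundaries i"
    unfolding simp_coboundaries_def using pm.vs.subspace_0[OF chains_subspace]
    by (auto intro!: bexI[of _ 0] simp: cobd_def)
  show "x + y \<in> simp_coboundaries i" if x: "x \<in> simp_coboundaries i" and y: "y \<in> simp_coboundaries i" for x y
  proof -
    obtain x' y' where xy: "x' \<in> chains \<Delta> (i - 1)" "\<forall>F\<in>faces \<Delta> i. lookup x F = cobd n (lookup x') F"
      "y' \<in> chains \<Delta> (i - 1)" "\<forall>F\<in>faces \<Delta> i. lookup y F = cobd n (lookup y') F"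
      "x \<in> chains \<Delta> i" "y \<in> chains \<Delta> i"
      using x y unfolding simp_coboundaries_def by blast
    have "x' + y' \<in> chains \<Delta> (i - 1)" "x + y \<in> chains \<Delta> i"
      using xy pm.vs.subspace_add[OF chains_subspace] by blast+
    moreover have "\<forall>F\<in>faces \<Delta> i. lookup (x + y) F = cobd n (lookup (x' + y')) F"
      using xy by (simp add: lookup_add cobd_def distrib_left sum.distrib)
    ultimately show ?thesis unfolding simp_coboundaries_def by blast
  qed
  show "smul a x \<in> simp_coboundaries i" if x: "x \<in> simp_coboundaries i" for a x
  proof -
    obtain x' where xy: "x' \<in> chains \<Delta> (i - 1)" "\<forall>F\<in>faces \<Delta> i. lookup x F = cobd n (lookup x') F"
      "x \<in> chains \<Delta> i"
      using x unfolding simp_coboundaries_def by blast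
    have "smul a x' \<in> chains \<Delta> (i - 1)" "smul a x \<in> chains \<Delta> i"
      using xy pm.vs.subspace_scale[OF chains_subspace] by blast+
    moreover have "\<forall>F\<in>faces \<Delta> i. lookup (smul a x) F = cobd n (lookup (smul a x')) F"
      using xy by (simp add: lookup_map_times cobd_def sum_distrib_left mult.left_commute)
    ultimately show ?thesis unfolding simp_coboundaries_def by blast
  qed
qed

text \<open>Betti numbers are defined by homology, while the partition complex produces cohomology.
  Cocycles annihilate boundaries and cycles annihilate coboundaries, and each such pair of
  dimensions adds up to the number of faces.\<close>

lemma betti_eq_cohomology:
  "int (betti TYPE('k) \<Delta> i) = int (pm.vs.dim (simp_cocycles i)) - int (pm.vs.dim (simp_coboundaries i))"
proof -
  have "boundaries i \<subseteq> supported_on (faces \<Delta> i)"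
    using boundaries_sub_cycles[of i] by (auto simp: chains_eq)
  from dim_annih[OF finite_faces this boundaries_subspace]
  have "pm.vs.dim (simp_cocycles i) + pm.vs.dim (boundaries i) = card (faces \<Delta> i)"
    by (simp add: simp_cocycles_annih)
  moreover have "simp_coboundaries i \<subseteq> supported_on (faces \<Delta> i)"
    by (auto simp: simp_coboundaries_def chains_eq)
  from dim_annih[OF finite_faces this simp_coboundaries_subspace]
  have "pm.vs.dim (cycles i) + pm.vs.dim (simp_coboundaries i) = card (faces \<Delta> i)"
    by (simp add: cycles_annih)
  ultimately show ?thesis unfolding betti_eq by linarith
qed

section \<open>Degree 0 of the partition complex\<close>

lemma single_homog_0: "single 0 c \<in> homog n 0"
  by (simp add: homog_def mons_0 supported_on_def)

lemma mem_J_0_0: "p \<in> J 0 F 0 \<longleftrightarrow> p \<in> homog n 0 \<and> (F \<in> \<Delta> \<longrightarrow> lookup p 0 = 0)"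
proof -
  have "(\<forall>a. keys a \<union> F \<in> \<Delta> \<longrightarrow> lookup p a = 0) \<longleftrightarrow> (F \<in> \<Delta> \<longrightarrow> lookup p 0 = 0)" if "p \<in> homog n 0"
  proof -
    have "lookup p a = 0" if "a \<noteq> 0" for a
      using \<open>p \<in> homog n 0\<close> that by (simp add: homog_def mons_0 supported_on_iff)
    then show ?thesis by (metis keys_zero Un_empty_left)
  qed
  then show ?thesis unfolding mem_J_0 by blast
qed

lemma null_cochains_0_0:
  "y \<in> null_cochains 0 j 0 \<longleftrightarrow> y \<in> cochains j 0 \<and> (\<forall>F\<in>faces \<Delta> (j - 1). lookup (y F) 0 = 0)"
proof
  assume "y \<in> null_cochains 0 j 0"
  then show "y \<in> cochains j 0 \<and> (\<forall>F\<in>faces \<Delta> (j - 1). lookup (y F) 0 = 0)"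
    by (auto simp: null_cochains_def mem_J_0_0 mem_faces)
next
  assume y: "y \<in> cochains j 0 \<and> (\<forall>F\<in>faces \<Delta> (j - 1). lookup (y F) 0 = 0)"
  have "y F \<in> J 0 F 0" for F
    using y by (cases "y F = 0") (auto simp: J_0, auto simp: mem_J_0_0 cochains_def mem_faces)
  then show "y \<in> null_cochains 0 j 0" using y by (simp add: null_cochains_def)
qed

definition const_cochain :: "int \<Rightarrow> (nat set \<Rightarrow>\<^sub>0 'k) \<Rightarrow> nat set \<Rightarrow> 'k mpoly" where
  "const_cochain j e F = single 0 (lookup e F)"

lemma const_cochain_mem: "e \<in> chains \<Delta> (j - 1) \<Longrightarrow> const_cochain j e \<in> cochains j 0"
proof -
  assume e: "e \<in> chains \<Delta> (j - 1)"
  have "F \<subseteq> {1..n} \<and> int (card F) = j" if "const_cochain j e F \<noteq> 0" for F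
  proof -
    have "lookup e F \<noteq> 0" using that by (auto simp: const_cochain_def)
    then have "F \<in> faces \<Delta> (j - 1)" using e by (auto simp: chains_eq supported_on_iff)
    then show ?thesis using faces_subset by (auto simp: mem_faces)
  qed
  then show ?thesis by (auto simp: cochains_def const_cochain_def single_homog_0)
qed

lemma cobd_cong_faces:
  assumes "F \<in> faces \<Delta> i" "\<And>G. G \<in> faces \<Delta> (i - 1) \<Longrightarrow> f G = g G"
  shows "cobd n f F = cobd n g F"
  using assms(2)[OF face_delete[OF assms(1)]] by (simp add: cobd_def)

text \<open>The relation compares constant coefficients on faces of size \<open>j\<close>, that is,
  of dimension \<open>j - 1\<close>. At nonfaces a cochain of the partition complex may take any
  constant, since such values are null, so a relation is more convenient than a map.\<close>

lemma h_0_0: "h 0 j 0 = int (betti TYPE('k) \<Delta> (j - 1))"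
  unfolding h_def betti_eq_cohomology
proof (rule fam_pm.relates_dim)
  let ?X = "faces \<Delta> (j - 1)"
  let ?G = "\<lambda>y e. \<forall>F\<in>?X. lookup e F = lookup (y F) (0 :: nat \<Rightarrow>\<^sub>0 nat)"
  have Zc: "y \<in> cocycles 0 j 0 \<longleftrightarrow> y \<in> cochains j 0 \<and> (\<forall>F\<in>faces \<Delta> j. cobd n (\<lambda>G. lookup (y G) 0) F = 0)" for y
    unfolding cocycles_def null_cochains_0_0 using cobd_cochains by (auto simp: lookup_cobd)
  have Gcobd: "cobd n (\<lambda>G. lookup (y G) 0) F = cobd n (lookup e) F" if "?G y e" "F \<in> faces \<Delta> j" for y e F
    by (rule cobd_cong_faces[OF that(2)]) (use that(1) in simp)
  show "fam_pm.relates (cocycles 0 j 0) (coboundaries 0 j 0) (simp_cocycles (j - 1)) (simp_coboundaries (j - 1)) ?G"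
    unfolding fam_pm.relates_def
  proof (intro conjI allI impI ballI)
    fix z z' :: "nat set \<Rightarrow> 'k mpoly" and w w' :: "nat set \<Rightarrow>\<^sub>0 'k" and c F
    assume "?G z w" "?G z' w'" "F \<in> ?X"
    then show "lookup (w + smul c w') F = lookup ((z + family_scale c z') F) 0"
      by (simp add: lookup_add lookup_map_times family_scale_def)
  next
    fix z assume z: "z \<in> cocycles 0 j 0"
    define e where "e = (\<Sum>F\<in>?X. single F (lookup (z F) 0))"
    have "lookup e F = (if F \<in> ?X then lookup (z F) 0 else 0)" for F
      unfolding e_def using finite_faces by (simp add: lookup_sum lookup_single when_def)
    then have e: "e \<in> chains \<Delta> (j - 1)" "?G z e" by (auto simp: chains_eq supported_on_iff)
    then have "e \<in> simp_cocycles (j - 1)"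
      using z Gcobd[OF e(2)] by (simp add: simp_cocycles_def Zc)
    then show "\<exists>w\<in>simp_cocycles (j - 1). ?G z w" using e(2) by blast
  next
    fix e assume e: "e \<in> simp_cocycles (j - 1)"
    then have eC: "e \<in> chains \<Delta> (j - 1)" by (simp add: simp_cocycles_def)
    have G: "?G (const_cochain j e) e" by (simp add: const_cochain_def)
    then have "const_cochain j e \<in> cocycles 0 j 0"
      using e Gcobd[OF G] const_cochain_mem[OF eC] by (simp add: simp_cocycles_def Zc)
    then show "\<exists>z\<in>cocycles 0 j 0. ?G z e" using G by blast
  next
    fix z e assume z: "z \<in> cocycles 0 j 0" and e: "e \<in> simp_cocycles (j - 1)" and G: "?G z e"
    have zC: "z \<in> cochains j 0" using z by (simp add: cocycles_def)
    have eC: "e \<in> chains \<Delta> (j - 1)" using e by (simp add: simp_cocycles_def)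
    show "z \<in> coboundaries 0 j 0 \<longleftrightarrow> e \<in> simp_coboundaries (j - 1)"
    proof
      assume "z \<in> coboundaries 0 j 0"
      then obtain y w where y: "z = cobd n y + w" "y \<in> cochains (j - 1) 0" "w \<in> null_cochains 0 j 0"
        unfolding coboundaries_def by blast
      define e' where "e' = (\<Sum>F\<in>faces \<Delta> (j - 1 - 1). single F (lookup (y F) 0))"
      have le': "lookup e' F = (if F \<in> faces \<Delta> (j - 1 - 1) then lookup (y F) 0 else 0)" for F
        unfolding e'_def using finite_faces by (simp add: lookup_sum lookup_single when_def)
      then have "e' \<in> chains \<Delta> (j - 1 - 1)" by (simp add: chains_eq supported_on_iff)
      moreover have "lookup e F = cobd n (lookup e') F" if F: "F \<in> ?X" for F
      proof -
        have "lookup e F = cobd n (\<lambda>G. lookup (y G) 0) F"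
          using G y(3) F by (simp add: y(1) lookup_add lookup_cobd null_cochains_0_0)
        also have "\<dots> = cobd n (lookup e') F"
          by (rule cobd_cong_faces[OF F]) (simp add: le')
        finally show ?thesis .
      qed
      ultimately show "e \<in> simp_coboundaries (j - 1)" unfolding simp_coboundaries_def using eC by blast
    next
      assume "e \<in> simp_coboundaries (j - 1)"
      then obtain e' where e': "e' \<in> chains \<Delta> (j - 1 - 1)" "\<forall>F\<in>?X. lookup e F = cobd n (lookup e') F"
        unfolding simp_coboundaries_def by blast
      let ?y = "const_cochain (j - 1) e'"
      have y: "?y \<in> cochains (j - 1) 0" by (rule const_cochain_mem[OF e'(1)])
      have "lookup ((z - cobd n ?y) F) 0 = 0" if F: "F \<in> ?X" for F
        using G e'(2) F by (simp add: lookup_minus lookup_cobd const_cochain_def)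
      moreover have "z - cobd n ?y \<in> cochains j 0"
        using zC cobd_cochains[OF y] by (intro cochains_diff) auto
      ultimately have "z - cobd n ?y \<in> null_cochains 0 j 0" unfolding null_cochains_0_0 by blast
      moreover have "z = cobd n ?y + (z - cobd n ?y)" by simp
      ultimately show "z \<in> coboundaries 0 j 0" unfolding coboundaries_def using y by blast
    qed
  next
    show "pm.vs.subspace (simp_cocycles (j - 1))"
      unfolding simp_cocycles_annih by (rule subspace_annih)
    show "pm.fin_spanned (simp_cocycles (j - 1))"
      by (rule pm.fin_spanned_mono[OF fin_spanned_supported_on[OF finite_faces]])
        (auto simp: simp_cocycles_def chains_eq)
    show "simp_coboundaries (j - 1) \<subseteq> simp_cocycles (j - 1)"
    proof
      fix e assume e: "e \<in> simp_coboundaries (j - 1)"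
      then obtain e' where e': "\<forall>F\<in>?X. lookup e F = cobd n (lookup e') F"
        unfolding simp_coboundaries_def by blast
      have "cobd n (lookup e) F = 0" if F: "F \<in> faces \<Delta> j" for F
      proof -
        have "cobd n (lookup e) F = cobd n (cobd n (lookup e')) F"
          by (rule cobd_cong_faces[OF F]) (use e' in simp)
        then show ?thesis by (simp add: cobd_cobd)
      qed
      then show "e \<in> simp_cocycles (j - 1)"
        using e by (simp add: simp_cocycles_def simp_coboundaries_def)
    qed
  qed (fact cocycles_subspace coboundaries_subspace coboundaries_sub_cocycles cocycles_fin_spanned
      simp_coboundaries_subspace)+
qed

text \<open>Both terms of \<open>h_Suc\<close> have the same \<open>j + l\<close>, hence the same
  Betti number, and their coefficients add up by Pascal's rule. The recursion raises
  \<open>j\<close>, so the induction needs all positions.\<close>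

lemma h_eq:
  assumes "i \<le> length \<theta>s" "j \<ge> 0"
  shows "h i j l = (if l < 0 then 0 else int (i choose nat l) * int (betti TYPE('k) \<Delta> (j + l - 1)))"
  using assms
proof (induction i arbitrary: j l)
  case 0
  show ?case
  proof (cases "l = 0")
    case True
    then show ?thesis by (simp add: h_0_0)
  next
    case False
    then show ?thesis by (simp add: h_zero_degree_nonzero binomial_eq_0)
  qed
next
  case (Suc i)
  have "h (Suc i) j l = h i j l + h i (j + 1) (l - 1)" using Suc.prems by (intro h_Suc) auto
  also have "\<dots> = (if l < 0 then 0 else int (i choose nat l) * int (betti TYPE('k) \<Delta> (j + l - 1))) +
      (if l - 1 < 0 then 0 else int (i choose nat (l - 1)) * int (betti TYPE('k) \<Delta> (j + 1 + (l - 1) - 1)))"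
    using Suc by simp
  also have "\<dots> = (if l < 0 then 0 else int (Suc i choose nat l) * int (betti TYPE('k) \<Delta> (j + l - 1)))"
  proof (cases "l \<ge> 1")
    case True
    define k where "k = nat (l - 1)"
    have "l = int k + 1" using True by (simp add: k_def)
    then show ?thesis by (simp add: nat_add_distrib algebra_simps)
  qed (auto simp: not_le)
  finally show ?case .
qed

section \<open>Hilbert functions of the successive quotients\<close>

definition alt_sum :: "nat \<Rightarrow> int" where
  "alt_sum l = (\<Sum>s<l. (-1) ^ (l - s - 1) * int (betti TYPE('k) \<Delta> (int s - 1)))"

lemma alt_sum_Suc: "alt_sum (Suc l) = int (betti TYPE('k) \<Delta> (int l - 1)) - alt_sum l"
proof -
  have "(\<Sum>s<l. (-1) ^ (Suc l - s - 1) * int (betti TYPE('k) \<Delta> (int s - 1))) = - alt_sum l"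
    unfolding alt_sum_def sum_negf[symmetric]
  proof (rule sum.cong[OF refl])
    fix s assume "s \<in> {..<l}"
    then have "Suc l - s - 1 = Suc (l - s - 1)" by auto
    then show "(-1) ^ (Suc l - s - 1) * int (betti TYPE('k) \<Delta> (int s - 1))
        = - ((-1) ^ (l - s - 1) * int (betti TYPE('k) \<Delta> (int s - 1)))" by simp
  qed
  then show ?thesis by (simp add: alt_sum_def[of "Suc l"])
qed

lemma quot_dim_neg: "l < 0 \<Longrightarrow> quot_dim i l = 0"
proof -
  assume "l < 0"
  then have "mons n l = {}" by (auto simp: mons_def)
  then have "homog n l = ({0} :: 'k mpoly set)" by (auto simp: homog_def supported_on_def)
  moreover then have "J i {} l = {0}" using J_homog[of i "{}" l] J_0[of i "{}" l] by auto
  ultimately show ?thesis by (simp add: quot_dim_def)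
qed

text \<open>Dividing by a regular element would multiply the series by \<open>1 - fps_X\<close>; the
  kernel adds a binomial multiple of a Betti number. That number is
  \<open>alt_sum l + alt_sum (l - 1)\<close> for \<open>l \<ge> 1\<close>, so the corrections
  accumulate by Pascal's rule.\<close>

lemma quot_dim_fps:
  assumes "i \<le> length \<theta>s"
  shows "quot_dim i (int l) =
    fps_nth ((1 - fps_X) ^ i * Abs_fps (\<lambda>k. quot_dim 0 (int k))) l + int (i choose l) * alt_sum l"
  using assms
proof (induction i arbitrary: l)
  case 0
  then show ?case by (cases l) (simp_all add: alt_sum_def)
next
  case (Suc i)
  let ?f = "(1 - fps_X) ^ i * Abs_fps (\<lambda>k. quot_dim 0 (int k))"
  have i: "i < length \<theta>s" using Suc.prems by simp
  have f: "(1 - fps_X) ^ Suc i * Abs_fps (\<lambda>k. quot_dim 0 (int k)) = ?f - fps_X * ?f"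
    by (simp add: algebra_simps)
  show ?case
  proof (cases l)
    case 0
    have "h i 0 (-1) = 0" using h_eq[of i 0 "-1"] Suc.prems by simp
    then show ?thesis
      using quot_dim_Suc[OF i, of 0] Suc.IH[of 0] Suc.prems
      by (simp add: 0 f quot_dim_neg alt_sum_def)
  next
    case (Suc k)
    have "h i 0 (int k) = int (i choose k) * int (betti TYPE('k) \<Delta> (int k - 1))"
      using h_eq[of i 0 "int k"] i by simp
    moreover have "quot_dim (Suc i) (int l) = quot_dim i (int l) - quot_dim i (int k) + h i 0 (int k)"
      using quot_dim_Suc[OF i, of "int l"] by (simp add: Suc)
    ultimately have "quot_dim (Suc i) (int l) = (fps_nth ?f l - fps_nth ?f k) + int (i choose l) * alt_sum l
        - int (i choose k) * alt_sum k + int (i choose k) * int (betti TYPE('k) \<Delta> (int k - 1))"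
      using Suc.IH[of l] Suc.IH[of k] i by simp
    also have "fps_nth ?f l - fps_nth ?f k = fps_nth (?f - fps_X * ?f) l"
      by (simp add: Suc)
    also have "fps_nth (?f - fps_X * ?f) l + int (i choose l) * alt_sum l
        - int (i choose k) * alt_sum k + int (i choose k) * int (betti TYPE('k) \<Delta> (int k - 1))
      = fps_nth (?f - fps_X * ?f) l + int (Suc i choose l) * alt_sum l"
      by (simp add: Suc alt_sum_Suc algebra_simps)
    finally show ?thesis unfolding f .
  qed
qed

end

section \<open>The \<open>h\<close>-vector\<close>

definition supp_mons :: "nat \<Rightarrow> nat set \<Rightarrow> nat \<Rightarrow> (nat \<Rightarrow>\<^sub>0 nat) set" where
  "supp_mons n F k = {m \<in> mons n (int k). keys m = F}"

lemma finite_supp_mons: "finite (supp_mons n F k)"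
  unfolding supp_mons_def using finite_mons by simp

lemma supp_mons_insert_Suc:
  assumes "insert v F \<subseteq> {1..n}" "v \<notin> F"
  shows "supp_mons n (insert v F) (Suc k) = (\<lambda>m. single v 1 + m) ` (supp_mons n F k \<union> supp_mons n (insert v F) k)"
proof
  show "(\<lambda>m. single v 1 + m) ` (supp_mons n F k \<union> supp_mons n (insert v F) k) \<subseteq> supp_mons n (insert v F) (Suc k)"
    using assms by (auto simp: supp_mons_def mons_def keys_add_nat mon_degree_add mon_degree_single)
  show "supp_mons n (insert v F) (Suc k) \<subseteq> (\<lambda>m. single v 1 + m) ` (supp_mons n F k \<union> supp_mons n (insert v F) k)"
  proof
    fix m assume m: "m \<in> supp_mons n (insert v F) (Suc k)"
    define m' where "m' = m - single v 1"
    have "v \<in> keys m" using m by (simp add: supp_mons_def)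
    then have eq: "m = single v 1 + m'"
      unfolding m'_def
      by (intro poly_mapping_eqI) (auto simp: lookup_add lookup_minus lookup_single when_def in_keys_iff)
    then have "keys m = insert v (keys m')" "mon_degree m = Suc (mon_degree m')"
      by (simp_all add: keys_add_nat mon_degree_add mon_degree_single)
    then have "keys m' = F \<or> keys m' = insert v F" "mon_degree m' = k" "keys m' \<subseteq> {1..n}"
      using m assms by (auto simp: supp_mons_def mons_def)
    then have "m' \<in> supp_mons n F k \<union> supp_mons n (insert v F) k" by (auto simp: supp_mons_def mons_def)
    then show "m \<in> (\<lambda>m. single v 1 + m) ` (supp_mons n F k \<union> supp_mons n (insert v F) k)"
      using eq by blast
  qed
qed

lemma card_supp_mons_insert_Suc:
  assumes "insert v F \<subseteq> {1..n}" "v \<notin> F"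
  shows "card (supp_mons n (insert v F) (Suc k)) = card (supp_mons n F k) + card (supp_mons n (insert v F) k)"
proof -
  have "card (supp_mons n (insert v F) (Suc k)) = card (supp_mons n F k \<union> supp_mons n (insert v F) k)"
    unfolding supp_mons_insert_Suc[OF assms] by (rule card_image) (simp add: inj_on_def)
  also have "\<dots> = card (supp_mons n F k) + card (supp_mons n (insert v F) k)"
    using assms(2) by (intro card_Un_disjoint finite_supp_mons) (auto simp: supp_mons_def)
  finally show ?thesis .
qed

lemma supp_mons_0: "supp_mons n F 0 = (if F = {} then {0} else {})"
  by (auto simp: supp_mons_def mons_0)

definition supp_series :: "nat \<Rightarrow> nat set \<Rightarrow> int fps" where
  "supp_series n F = Abs_fps (\<lambda>k. int (card (supp_mons n F k)))"

text \<open>Removing one factor of the new variable from a monomial of support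
  \<open>insert v F\<close> leaves a monomial of support \<open>F\<close> or of the same
  support.\<close>

lemma supp_series_insert:
  assumes "insert v F \<subseteq> {1..n}" "v \<notin> F"
  shows "(1 - fps_X) * supp_series n (insert v F) = fps_X * supp_series n F"
proof (rule fps_ext)
  fix k
  show "fps_nth ((1 - fps_X) * supp_series n (insert v F)) k = fps_nth (fps_X * supp_series n F) k"
    by (cases k) (simp_all add: supp_series_def left_diff_distrib supp_mons_0 card_supp_mons_insert_Suc[OF assms])
qed

text \<open>The series is the power \<open>(X / (1 - X)) ^ card F\<close>, one geometric series for
  each variable of the support, written without division.\<close>

lemma supp_series_eq:
  assumes "F \<subseteq> {1..n}"
  shows "(1 - fps_X) ^ card F * supp_series n F = fps_X ^ card F"
  using finite_subset[OF assms finite_atLeastAtMost] assms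
proof (induction F rule: finite_induct)
  case empty
  have "supp_mons n {} (Suc k) = {}" for k
    by (auto simp: supp_mons_def mons_def mon_degree_def simp del: of_nat_sum)
  then have "supp_series n {} = 1"
    by (intro fps_ext) (auto simp: supp_series_def supp_mons_0 neq0_conv[symmetric] gr0_conv_Suc simp del: neq0_conv
        dest!: not0_implies_Suc)
  then show ?case by simp
next
  case (insert v F)
  have "(1 - fps_X) ^ card (insert v F) * supp_series n (insert v F)
      = (1 - fps_X) ^ card F * ((1 - fps_X) * supp_series n (insert v F))"
    using insert.hyps by (simp add: mult.assoc mult.left_commute)
  also have "\<dots> = fps_X * ((1 - fps_X) ^ card F * supp_series n F)"
    by (simp only: supp_series_insert[OF insert.prems insert.hyps(2)] mult.left_commute)
  also have "\<dots> = fps_X ^ card (insert v F)"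
    using insert by simp
  finally show ?case .
qed

text \<open>Reversing the coefficients of \<open>x - 1\<close> gives \<open>1 - x\<close>, and
  reversal is multiplicative. This links the descending powers in the definition of the
  \<open>h\<close>-vector with the ascending ones of the Hilbert series.\<close>

lemma coeff_shifted_power:
  assumes "k \<le> N"
  shows "poly.coeff ([:-1, 1:] ^ N :: int poly) (N - k) = fps_nth ((1 - fps_X) ^ N) k"
proof -
  have deg: "Polynomial.degree ([:-1, 1:] ^ N :: int poly) = N" by (simp add: degree_power_eq)
  have "reflect_poly [:-1, 1 :: int:] = [:1, -1:]" by (simp add: reflect_poly_def)
  then have "[:1, -1 :: int:] ^ N = reflect_poly ([:-1, 1:] ^ N)" by (simp add: reflect_poly_power)
  then have "poly.coeff ([:1, -1 :: int:] ^ N) k = poly.coeff ([:-1, 1:] ^ N) (N - k)"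
    using assms by (simp add: coeff_reflect_poly deg)
  moreover have "fps_of_poly ([:1, -1 :: int:] ^ N) = (1 - fps_X) ^ N"
    by (simp add: fps_of_poly_power fps_of_poly_pCons flip: fps_const_neg)
  ultimately show ?thesis by (metis fps_of_poly_nth)
qed

section \<open>The Hilbert series of the face ring\<close>

context partition_complex
begin

lemma finite_complex: "finite \<Delta>"
  using faces_subset finite_subset by (metis finite_Pow_iff finite_atLeastAtMost)

lemma card_face_le:
  assumes "complex_dim \<Delta> = int d - 1" "F \<in> \<Delta>"
  shows "card F \<le> d"
proof -
  have "face_dim F \<le> complex_dim \<Delta>" unfolding complex_dim_def using assms(2) finite_complex by simp
  then show ?thesis using assms(1) by (simp add: face_dim_def)
qed

lemma quot_dim_0: "quot_dim 0 (int k) = (\<Sum>F\<in>\<Delta>. int (card (supp_mons n F k)))"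
proof -
  let ?bad = "{m \<in> mons n (int k). keys m \<notin> \<Delta>}" and ?good = "{m \<in> mons n (int k). keys m \<in> \<Delta>}"
  have "J 0 {} (int k) = supported_on ?bad"
    unfolding J_def take_0 list.set gr_ideal_empty star_empty nonface_def ..
  then have "pm.vs.dim (J 0 {} (int k)) = card ?bad"
    using dim_supported_on[of ?bad] finite_mons by simp
  moreover have "pm.vs.dim (homog n (int k) :: 'k mpoly set) = card (mons n (int k))"
    unfolding homog_def by (rule dim_supported_on[OF finite_mons])
  moreover have "card (mons n (int k)) = card ?bad + card ?good"
    using finite_mons by (subst card_Un_disjoint[symmetric]) (auto intro!: arg_cong[where f = card])
  moreover have "?good = (\<Union>F\<in>\<Delta>. supp_mons n F k)" by (auto simp: supp_mons_def)
  then have "card ?good = (\<Sum>F\<in>\<Delta>. card (supp_mons n F k))"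
    using finite_complex finite_supp_mons by (simp add: card_UN_disjoint supp_mons_def disjoint_iff)
  ultimately show ?thesis by (simp add: quot_dim_def)
qed

text \<open>Sorting monomials by their support writes the Hilbert series as a sum over faces; after
  clearing denominators a face contributes according to its size alone, which brings in the
  \<open>f\<close>-numbers.\<close>

lemma hilbert_numerator:
  assumes d: "complex_dim \<Delta> = int d - 1" and j: "j \<le> d"
  shows "fps_nth ((1 - fps_X) ^ d * Abs_fps (\<lambda>k. quot_dim 0 (int k))) j = h_num \<Delta> d j"
proof -
  have "Abs_fps (\<lambda>k. quot_dim 0 (int k)) = (\<Sum>F\<in>\<Delta>. supp_series n F)"
    by (rule fps_ext) (simp add: quot_dim_0 fps_sum_nth supp_series_def)
  then have "(1 - fps_X) ^ d * Abs_fps (\<lambda>k. quot_dim 0 (int k)) = (\<Sum>F\<in>\<Delta>. (1 - fps_X) ^ d * supp_series n F)"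
    by (simp add: sum_distrib_left)
  also have "\<dots> = (\<Sum>F\<in>\<Delta>. fps_X ^ card F * (1 - fps_X) ^ (d - card F))"
  proof (rule sum.cong[OF refl])
    fix F assume F: "F \<in> \<Delta>"
    have "(1 - fps_X) ^ d * supp_series n F
        = (1 - fps_X) ^ (d - card F) * ((1 - fps_X) ^ card F * supp_series n F)"
      by (simp only: mult.assoc[symmetric] power_add[symmetric] le_add_diff_inverse2[OF card_face_le[OF d F]])
    also have "(1 - fps_X) ^ card F * supp_series n F = fps_X ^ card F"
      by (rule supp_series_eq) (use F faces_subset in blast)
    finally show "(1 - fps_X) ^ d * supp_series n F = fps_X ^ card F * (1 - fps_X) ^ (d - card F)"
      by (simp only: mult.commute)
  qed
  also have "\<dots> = (\<Sum>i\<le>d. \<Sum>F\<in>{F \<in> \<Delta>. card F = i}. fps_X ^ card F * (1 - fps_X) ^ (d - card F))"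
    using card_face_le[OF d] by (intro sum.group[symmetric] finite_complex) auto
  also have "\<dots> = (\<Sum>i\<le>d. of_nat (f_num \<Delta> (int i - 1)) * (fps_X ^ i * (1 - fps_X) ^ (d - i)))"
  proof (rule sum.cong[OF refl])
    fix i
    have "{F \<in> \<Delta>. card F = i} = faces \<Delta> (int i - 1)" by (auto simp: mem_faces)
    then show "(\<Sum>F\<in>{F \<in> \<Delta>. card F = i}. fps_X ^ card F * (1 - fps_X) ^ (d - card F)) =
        of_nat (f_num \<Delta> (int i - 1)) * (fps_X ^ i * (1 - fps_X :: int fps) ^ (d - i))"
    proof -
      have "(\<Sum>F\<in>{F \<in> \<Delta>. card F = i}. fps_X ^ card F * (1 - fps_X) ^ (d - card F)) =
          (\<Sum>F\<in>{F \<in> \<Delta>. card F = i}. fps_X ^ i * (1 - fps_X :: int fps) ^ (d - i))"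
        by (rule sum.cong) auto
      then show ?thesis using \<open>_ = faces \<Delta> (int i - 1)\<close> by (simp add: f_num_def)
    qed
  qed
  finally have "fps_nth ((1 - fps_X) ^ d * Abs_fps (\<lambda>k. quot_dim 0 (int k))) j =
      (\<Sum>i\<le>d. int (f_num \<Delta> (int i - 1)) * fps_nth (fps_X ^ i * (1 - fps_X) ^ (d - i)) j)"
    by (simp add: fps_sum_nth fps_mult_left_const_nth flip: fps_of_nat)
  also have "\<dots> = (\<Sum>i\<le>d. int (f_num \<Delta> (int i - 1)) * poly.coeff ([:-1, 1:] ^ (d - i)) (d - j))"
  proof (rule sum.cong[OF refl])
    fix i assume i: "i \<in> {..d}"
    have "fps_nth (fps_X ^ i * (1 - fps_X) ^ (d - i)) j = poly.coeff ([:-1, 1:] ^ (d - i) :: int poly) (d - j)"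
    proof (cases "j < i")
      \<comment> \<open>Here \<open>d - i < d - j\<close>, so the coefficient lies beyond the
        degree, matching the vanishing of the shifted series below index \<open>i\<close>.\<close>
      case True
      have "Polynomial.degree ([:-1, 1:] ^ (d - i) :: int poly) < d - j"
        using True i j by (simp add: degree_power_eq)
      then show ?thesis using True by (simp add: fps_X_power_mult_nth coeff_eq_0)
    next
      case False
      then have "d - j = (d - i) - (j - i)" using i j by auto
      then show ?thesis using False coeff_shifted_power[of "j - i" "d - i"] j by (simp add: fps_X_power_mult_nth)
    qed
    then show "int (f_num \<Delta> (int i - 1)) * fps_nth (fps_X ^ i * (1 - fps_X) ^ (d - i)) j =
        int (f_num \<Delta> (int i - 1)) * poly.coeff ([:-1, 1:] ^ (d - i)) (d - j)" by simp
  qed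
  also have "\<dots> = h_num \<Delta> d j"
    by (simp add: h_num_def h_poly_def coeff_sum)
  finally show ?thesis .
qed

lemma quot_dim_eq_h':
  assumes "complex_dim \<Delta> = int d - 1" "length \<theta>s = d" "j \<le> d"
  shows "quot_dim d (int j) = h'_num TYPE('k) \<Delta> d j"
  using quot_dim_fps[of d j] assms hilbert_numerator[of d j]
  by (simp add: h'_num_def alt_sum_def)

lemma h_le_quot_dim:
  assumes "length \<theta>s = d"
  shows "int (d choose j) * int (betti TYPE('k) \<Delta> (int j - 1)) \<le> quot_dim d (int j)"
  using h_0_le_quot_dim[of d "int j"] h_eq[of d 0 "int j"] assms by simp

end

section \<open>Stanley--Reisner modules\<close>

lemma carrier_poly_ring: "p \<in> carrier (poly_ring n) \<longleftrightarrow> (\<forall>m\<in>keys p. keys m \<subseteq> {1..n})"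
  by (simp add: poly_ring_def)

lemma carrier_eq_supported: "carrier (poly_ring n) = supported_on {m. keys m \<subseteq> {1..n}}"
  by (auto simp: poly_ring_def supported_on_def)

lemma carrier_subspace: "pm.vs.subspace (carrier (poly_ring n))"
  unfolding carrier_eq_supported by (rule subspace_supported_on)

lemmas carrier_0 = pm.vs.subspace_0[OF carrier_subspace]
  and carrier_add = pm.vs.subspace_add[OF carrier_subspace]
  and carrier_diff = pm.vs.subspace_diff[OF carrier_subspace]
  and carrier_neg = pm.vs.subspace_neg[OF carrier_subspace]
  and carrier_smul = pm.vs.subspace_scale[OF carrier_subspace]

lemma carrier_mult:
  assumes "p \<in> carrier (poly_ring n)" "q \<in> carrier (poly_ring n)"
  shows "p * q \<in> carrier (poly_ring n)"
  unfolding carrier_poly_ring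
proof
  fix m assume "m \<in> keys (p * q)"
  then obtain a b where "a \<in> keys p" "b \<in> keys q" "m = a + b" using keys_mult[of p q] by blast
  then show "keys m \<subseteq> {1..n}" using assms by (auto simp: carrier_poly_ring keys_add_nat)
qed

lemma carrier_1: "1 \<in> carrier (poly_ring n)"
  by (simp add: carrier_poly_ring)

lemma homog_sub_carrier: "homog n l \<subseteq> carrier (poly_ring n)"
  unfolding homog_def carrier_eq_supported supported_on_def mons_def by blast

lemma poly_component_eq: "poly_component n j = homog n (int j)"
  by (auto simp: poly_component_def homog_def supported_on_def carrier_poly_ring mons_def)

lemma Const_mult: "Const c * p = smul c p"
  by (simp add: Const_def smul_conv)

lemma Const_carrier: "Const c \<in> carrier (poly_ring n)"
  by (simp add: Const_def carrier_poly_ring)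

lemma Var_carrier: "v \<in> {1..n} \<Longrightarrow> Var v \<in> carrier (poly_ring n)"
  using Var_homog homog_sub_carrier by blast

lemma poly_ring_simps:
  "monoid.mult (poly_ring n) = (*)" "monoid.one (poly_ring n) = 1"
  "ring.zero (poly_ring n) = 0" "ring.add (poly_ring n) = (+)"
  by (simp_all add: poly_ring_def)

lemma regular_module_simps:
  "carrier (regular_module n) = carrier (poly_ring n)" "ring.zero (regular_module n) = 0"
  "ring.add (regular_module n) = (+)" "module.smult (regular_module n) = (*)"
  by (simp_all add: regular_module_def)

lemma cring_poly_ring: "cring (poly_ring n :: 'k::field mpoly ring)"
proof (rule cringI)
  show "abelian_group (poly_ring n :: 'k mpoly ring)"
    by (rule abelian_groupI)
      (auto simp: poly_ring_simps carrier_add carrier_0 ac_simps intro!: bexI[OF _ carrier_neg])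
  show "comm_monoid (poly_ring n :: 'k mpoly ring)"
    by (rule comm_monoidI) (auto simp: poly_ring_simps carrier_mult carrier_1 ac_simps)
qed (simp add: poly_ring_simps distrib_right)

lemma abelian_group_regular: "abelian_group (regular_module n :: ('k::field mpoly, 'k mpoly) module)"
  by (rule abelian_groupI)
    (auto simp: regular_module_simps carrier_add carrier_0 ac_simps intro!: bexI[OF _ carrier_neg])

lemma module_regular: "Module.module (poly_ring n :: 'k::field mpoly ring) (regular_module n)"
  by (rule Module.moduleI)
    (auto simp: cring_poly_ring abelian_group_regular regular_module_simps poly_ring_simps carrier_mult
      distrib_left distrib_right mult.assoc)

lemma regular_minus:
  assumes "a \<in> carrier (poly_ring n)" "b \<in> carrier (poly_ring n)"
  shows "a \<ominus>\<^bsub>regular_module n\<^esub> b = a - b"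
proof -
  interpret abelian_group "regular_module n" by (rule abelian_group_regular)
  have "\<ominus>\<^bsub>regular_module n\<^esub> b = - b"
    by (rule minus_equality) (use assms carrier_neg in \<open>auto simp: regular_module_simps\<close>)
  then show ?thesis by (simp add: a_minus_def regular_module_simps)
qed

text \<open>Closure of an ideal under arbitrary multipliers is reduced by this to closure under the
  variables.\<close>

lemma monomial_induct:
  assumes V: "pm.vs.subspace V" "(1 :: 'k::field mpoly) \<in> V"
    and Var: "\<And>v p. v \<in> {1..n} \<Longrightarrow> p \<in> V \<Longrightarrow> Var v * p \<in> V"
  shows "carrier (poly_ring n) \<subseteq> V"
proof
  fix p :: "'k mpoly" assume p: "p \<in> carrier (poly_ring n)"
  have mon: "single a 1 \<in> V" if "keys a \<subseteq> {1..n}" for a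
    using that
  proof (induction "mon_degree a" arbitrary: a rule: less_induct)
    case less
    show ?case
    proof (cases "a = 0")
      case True
      then show ?thesis using V(2) by simp
    next
      case False
      then obtain v where v: "v \<in> keys a" by fastforce
      define b where "b = a - single v 1"
      have a: "a = single v 1 + b"
        using v unfolding b_def
        by (intro poly_mapping_eqI) (auto simp: lookup_add lookup_minus lookup_single when_def in_keys_iff)
      have "keys b \<subseteq> {1..n}" "mon_degree b < mon_degree a" "v \<in> {1..n}"
        using less.prems v unfolding a by (auto simp: keys_add_nat mon_degree_add mon_degree_single)
      then have "Var v * single b 1 \<in> V" using less.hyps Var by blast
      then show ?thesis by (simp add: Var_def mult_single a)
    qed
  qed
  have "p = (\<Sum>x\<in>keys p. smul (lookup p x) (single x 1))"
    by (rule supported_on_expand) (auto simp: supported_on_def)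
  also have "\<dots> \<in> V"
    using p mon by (intro pm.vs.subspace_sum[OF V(1)] pm.vs.subspace_scale[OF V(1)]) (auto simp: carrier_poly_ring)
  finally show "p \<in> V" .
qed

section \<open>Ungraded ideals and the Stanley-Reisner ideal\<close>

definition full_ideal :: "nat \<Rightarrow> nat set set \<Rightarrow> 'k::field mpoly set \<Rightarrow> 'k mpoly set" where
  "full_ideal n \<Gamma> U = pm.vs.span (\<Union>l. gr_ideal n \<Gamma> U l)"

lemma full_ideal_subspace: "pm.vs.subspace (full_ideal n \<Gamma> U)"
  unfolding full_ideal_def by (rule pm.vs.subspace_span)

lemma gr_sub_full: "gr_ideal n \<Gamma> U l \<subseteq> full_ideal n \<Gamma> U"
proof
  fix p :: "'a mpoly" assume "p \<in> gr_ideal n \<Gamma> U l"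
  then have "p \<in> (\<Union>l. gr_ideal n \<Gamma> U l)" by blast
  then show "p \<in> full_ideal n \<Gamma> U" unfolding full_ideal_def by (rule pm.vs.span_base)
qed

lemma full_ideal_sub_carrier: "U \<subseteq> homog n 1 \<Longrightarrow> full_ideal n \<Gamma> U \<subseteq> carrier (poly_ring n)"
  unfolding full_ideal_def
  by (rule pm.vs.span_minimal[OF UN_least carrier_subspace])
    (rule subset_trans[OF gr_ideal_homog homog_sub_carrier])

lemma Var_mult_full_ideal:
  assumes "down_closed \<Gamma>" "v \<in> {1..n}" "p \<in> full_ideal n \<Gamma> U"
  shows "Var v * p \<in> full_ideal n \<Gamma> U"
proof -
  have "full_ideal n \<Gamma> U \<subseteq> {p. Var v * p \<in> full_ideal n \<Gamma> U}"
    unfolding full_ideal_def[of n \<Gamma> U]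
  proof (rule pm.vs.span_minimal)
    show "(\<Union>l. gr_ideal n \<Gamma> U l) \<subseteq> {p. Var v * p \<in> pm.vs.span (\<Union>l. gr_ideal n \<Gamma> U l)}"
    proof
      fix p assume "p \<in> (\<Union>l. gr_ideal n \<Gamma> U l)"
      then obtain l where "p \<in> gr_ideal n \<Gamma> U l" by blast
      then have "Var v * p \<in> gr_ideal n \<Gamma> U (l + 1)"
        using Var_mult_gr_ideal[OF assms(2)] down_closed_insert[OF assms(1)] by blast
      then show "p \<in> {p. Var v * p \<in> pm.vs.span (\<Union>l. gr_ideal n \<Gamma> U l)}"
        using gr_sub_full[of n \<Gamma> U "l + 1"] unfolding full_ideal_def by blast
    qed
    show "pm.vs.subspace {p. Var v * p \<in> pm.vs.span (\<Union>l. gr_ideal n \<Gamma> U l)}"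
      by (rule pm.vs.subspaceI)
        (auto simp: distrib_left smul_mult_right intro: pm.vs.span_zero pm.vs.span_add pm.vs.span_scale)
  qed
  with assms(3) show ?thesis by blast
qed

lemma mult_full_ideal:
  assumes "down_closed \<Gamma>" "r \<in> carrier (poly_ring n)" "p \<in> full_ideal n \<Gamma> U"
  shows "r * p \<in> full_ideal n \<Gamma> U"
proof -
  have "carrier (poly_ring n) \<subseteq> {r. r * p \<in> full_ideal n \<Gamma> U}"
  proof (rule monomial_induct)
    show "pm.vs.subspace {r. r * p \<in> full_ideal n \<Gamma> U}"
      using pm.vs.subspace_0[OF full_ideal_subspace] pm.vs.subspace_add[OF full_ideal_subspace]
        pm.vs.subspace_scale[OF full_ideal_subspace]
      by (intro pm.vs.subspaceI) (auto simp: distrib_right smul_mult_left)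
    show "1 \<in> {r. r * p \<in> full_ideal n \<Gamma> U}" using assms(3) by simp
    show "Var v * r \<in> {r. r * p \<in> full_ideal n \<Gamma> U}"
      if "v \<in> {1..n}" "r \<in> {r. r * p \<in> full_ideal n \<Gamma> U}" for v r
      using Var_mult_full_ideal[OF assms(1) that(1), of "r * p" U] that(2) by (simp add: mult.assoc)
  qed
  with assms(2) show ?thesis by blast
qed

lemma linear_mult_full_ideal:
  assumes "down_closed \<Gamma>" "t \<in> U" "q \<in> carrier (poly_ring n)"
  shows "t * q \<in> full_ideal n \<Gamma> U"
proof -
  have "t * 1 \<in> full_ideal n \<Gamma> U"
    using gr_sub_full mult_gr_ideal[OF assms(2), of 1 n 1] by (force simp: homog_def supported_on_def mons_def mon_degree_def)
  then have "q * t \<in> full_ideal n \<Gamma> U" using mult_full_ideal[OF assms(1,3)] by simp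
  then show ?thesis by (simp add: mult.commute)
qed

text \<open>The projection to degree \<open>l\<close> is linear, sends each graded piece to itself
  or to zero, and fixes \<open>p\<close>.\<close>

lemma full_ideal_homog:
  assumes U: "U \<subseteq> homog n 1" and p: "p \<in> full_ideal n \<Gamma> U" "p \<in> homog n l"
  shows "p \<in> gr_ideal n \<Gamma> U l"
proof -
  define part where "part q = (\<Sum>a\<in>mons n l. single a (lookup q a))" for q :: "'a mpoly"
  have lp: "lookup (part q) a = (if a \<in> mons n l then lookup q a else 0)" for q a
    unfolding part_def using finite_mons by (simp add: lookup_sum lookup_single when_def)
  have add: "part (q + q') = part q + part q'" and scale: "part (smul c q) = smul c (part q)" for q q' c
    by (rule poly_mapping_eqI; simp add: lp lookup_add lookup_map_times)+
  have zero: "part 0 = 0" by (rule poly_mapping_eqI) (simp add: lp)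
  have part_homog: "part q = (if l' = l then q else 0)" if "q \<in> homog n l'" for q l'
    using that by (intro poly_mapping_eqI) (auto simp: lp homog_def supported_on_iff, auto simp: mons_def)
  have "full_ideal n \<Gamma> U \<subseteq> {q. part q \<in> gr_ideal n \<Gamma> U l}"
    unfolding full_ideal_def
  proof (rule pm.vs.span_minimal)
    show "(\<Union>l. gr_ideal n \<Gamma> U l) \<subseteq> {q. part q \<in> gr_ideal n \<Gamma> U l}"
    proof
      fix q assume "q \<in> (\<Union>l. gr_ideal n \<Gamma> U l)"
      then obtain l' where q: "q \<in> gr_ideal n \<Gamma> U l'" by blast
      then have "q \<in> homog n l'" using gr_ideal_homog[OF U] by blast
      then show "q \<in> {q. part q \<in> gr_ideal n \<Gamma> U l}"
        using part_homog[of q l'] q by (auto simp: gr_ideal_0)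
    qed
    show "pm.vs.subspace {q. part q \<in> gr_ideal n \<Gamma> U l}"
      by (rule pm.vs.subspaceI) (auto simp: add scale zero intro: gr_ideal_0 gr_ideal_add gr_ideal_smul)
  qed
  then have "part p \<in> gr_ideal n \<Gamma> U l" using p(1) by blast
  then show ?thesis using part_homog[OF p(2)] by simp
qed

lemma full_ideal_mono: "U \<subseteq> U' \<Longrightarrow> full_ideal n \<Gamma> U \<subseteq> full_ideal n \<Gamma> U'"
  unfolding full_ideal_def by (intro pm.vs.span_mono UN_mono gr_ideal_mono) auto

lemma full_ideal_span_cong:
  assumes "pm.vs.span U = pm.vs.span U'"
  shows "full_ideal n \<Gamma> U = full_ideal n \<Gamma> U'"
proof -
  have "gr_ideal n \<Gamma> U l = gr_ideal n \<Gamma> U' l" for l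
    using gr_ideal_span_cong[of U U'] gr_ideal_span_cong[of U' U] assms pm.vs.span_superset by blast
  then show ?thesis by (simp add: full_ideal_def)
qed

lemma ideal_poly_ringI:
  fixes I :: "'k::field mpoly set"
  assumes "pm.vs.subspace I" "I \<subseteq> carrier (poly_ring n)"
    "\<And>r p. r \<in> carrier (poly_ring n) \<Longrightarrow> p \<in> I \<Longrightarrow> r * p \<in> I"
  shows "ideal I (poly_ring n)"
proof -
  interpret cring "poly_ring n :: 'k mpoly ring" by (rule cring_poly_ring)
  show ?thesis
  proof (rule idealI)
    show "ring (poly_ring n :: 'k mpoly ring)" by (rule ring_axioms)
    show "subgroup I (add_monoid (poly_ring n))"
    proof (rule group.subgroupI[OF a_group])
      show "inv\<^bsub>add_monoid (poly_ring n)\<^esub> a \<in> I" if a: "a \<in> I" for a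
      proof -
        have "\<ominus>\<^bsub>poly_ring n\<^esub> a = - a"
          by (rule minus_equality) (use a assms(2) carrier_neg in \<open>auto simp: poly_ring_simps\<close>)
        then show ?thesis using pm.vs.subspace_neg[OF assms(1) a] by (simp add: a_inv_def)
      qed
    qed (use assms(2) pm.vs.subspace_0[OF assms(1)] pm.vs.subspace_add[OF assms(1)] in \<open>auto simp: poly_ring_simps\<close>)
    show "x \<otimes>\<^bsub>poly_ring n\<^esub> a \<in> I" if "a \<in> I" "x \<in> carrier (poly_ring n)" for a x
      using assms(3)[OF that(2,1)] by (simp add: poly_ring_simps)
    show "a \<otimes>\<^bsub>poly_ring n\<^esub> x \<in> I" if "a \<in> I" "x \<in> carrier (poly_ring n)" for a x
      using assms(3)[OF that(2,1)] by (simp add: poly_ring_simps mult.commute)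
  qed
qed

lemma prod_Var: "finite F \<Longrightarrow> \<exists>a. (\<Prod>i\<in>F. Var i) = (single a 1 :: 'k::field mpoly) \<and> keys a = F \<and> (\<forall>i\<in>F. lookup a i = 1)"
proof (induction F rule: finite_induct)
  case empty
  then show ?case by (intro exI[of _ 0]) simp
next
  case (insert v F)
  then obtain a where a: "(\<Prod>i\<in>F. Var i) = (single a 1 :: 'k mpoly)" "keys a = F" "\<forall>i\<in>F. lookup a i = 1" by blast
  have "lookup a v = 0" using a(2) insert.hyps by (auto simp: in_keys_iff)
  then show ?case
    using a insert.hyps
    by (intro exI[of _ "single v 1 + a"])
      (auto simp: Var_def mult_single keys_add_nat lookup_add lookup_single when_def)
qed

text \<open>A monomial whose support is a nonface is divisible by the squarefree monomial of its
  support, which is one of the generators.\<close>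

lemma SR_ideal_eq:
  assumes "down_closed \<Delta>"
  shows "SR_ideal n \<Delta> = (full_ideal n \<Delta> {} :: 'k::field mpoly set)"
proof -
  interpret cring "poly_ring n :: 'k mpoly ring" by (rule cring_poly_ring)
  let ?S = "{\<Prod>i\<in>F. Var i | F. F \<subseteq> {1..n} \<and> F \<notin> \<Delta>} :: 'k mpoly set"
  have S: "p \<in> full_ideal n \<Delta> {}" if p: "p \<in> ?S" for p
  proof -
    obtain F where F: "p = (\<Prod>i\<in>F. Var i)" "F \<subseteq> {1..n}" "F \<notin> \<Delta>" using p by blast
    then obtain a where a: "p = single a 1" "keys a = F" using prod_Var finite_subset[OF F(2)] by blast
    then have "p \<in> nonface n \<Delta> (int (mon_degree a))"
      using F by (auto simp: nonface_def supported_on_def mons_def)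
    then show ?thesis using nonface_gr_ideal gr_sub_full by blast
  qed
  have SC: "?S \<subseteq> carrier (poly_ring n)" using S full_ideal_sub_carrier[of "{}" n \<Delta>] by blast
  have id: "ideal (SR_ideal n \<Delta> :: 'k mpoly set) (poly_ring n)"
    unfolding SR_ideal_def by (rule genideal_ideal[OF SC])
  have gen: "?S \<subseteq> SR_ideal n \<Delta>" unfolding SR_ideal_def by (rule genideal_self[OF SC])
  show ?thesis
  proof
    show "SR_ideal n \<Delta> \<subseteq> (full_ideal n \<Delta> {} :: 'k mpoly set)"
      unfolding SR_ideal_def
    proof (rule genideal_minimal[OF ideal_poly_ringI])
      show "full_ideal n \<Delta> {} \<subseteq> (carrier (poly_ring n) :: 'k mpoly set)"
        by (rule full_ideal_sub_carrier) simp
      show "?S \<subseteq> full_ideal n \<Delta> {}" by (rule subsetI) (rule S)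
    qed (fact full_ideal_subspace mult_full_ideal[OF assms])+
    have mon: "single a c \<in> SR_ideal n \<Delta>" if a: "keys a \<subseteq> {1..n}" "keys a \<notin> \<Delta>" for a and c :: 'k
    proof -
      obtain b where b: "(\<Prod>i\<in>keys a. Var i) = (single b 1 :: 'k mpoly)" "keys b = keys a" "\<forall>i\<in>keys a. lookup b i = 1"
        using prod_Var[of "keys a"] by auto
      \<comment> \<open>Subtraction of exponents is truncated; the identity holds because
        \<open>b\<close> is \<open>1\<close> on the support of \<open>a\<close> and \<open>0\<close>
        elsewhere.\<close>
      have eq: "a = (a - b) + b"
      proof (rule poly_mapping_eqI)
        fix i
        show "lookup a i = lookup (a - b + b) i"
        proof (cases "i \<in> keys a")
          case True
          then have "lookup a i \<ge> 1" "lookup b i = 1" using b(3) by (auto simp: in_keys_iff)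
          then show ?thesis by (simp add: lookup_add lookup_minus)
        next
          case False
          then have "lookup a i = 0" "lookup b i = 0" using b(2) by (auto simp: in_keys_iff)
          then show ?thesis by (simp add: lookup_add lookup_minus)
        qed
      qed
      have "keys (a - b) \<subseteq> keys a" by (auto simp: in_keys_iff lookup_minus)
      then have "keys (a - b) \<subseteq> {1..n}" using a(1) by (rule subset_trans)
      then have "single (a - b) c \<in> carrier (poly_ring n)" by (simp add: carrier_poly_ring)
      moreover have "(\<Prod>i\<in>keys a. Var i) \<in> ?S" using a by blast
      then have "single b 1 \<in> (SR_ideal n \<Delta> :: 'k mpoly set)" using gen b(1) by auto
      ultimately have "single (a - b) c * single b 1 \<in> SR_ideal n \<Delta>"
        using ideal.I_l_closed[OF id] by (simp add: poly_ring_simps)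
      then have "single (a - b + b) c \<in> SR_ideal n \<Delta>" by (simp add: mult_single)
      then show ?thesis by (simp flip: eq)
    qed
    have sub: "pm.vs.subspace (SR_ideal n \<Delta> :: 'k mpoly set)"
    proof (rule pm.vs.subspaceI)
      show "0 \<in> (SR_ideal n \<Delta> :: 'k mpoly set)"
        using additive_subgroup.zero_closed[OF ideal.axioms(1)[OF id]] by (simp add: poly_ring_simps)
      show "x + y \<in> SR_ideal n \<Delta>" if "x \<in> SR_ideal n \<Delta>" "y \<in> SR_ideal n \<Delta>" for x y :: "'k mpoly"
        using additive_subgroup.a_closed[OF ideal.axioms(1)[OF id] that] by (simp add: poly_ring_simps)
      show "smul c x \<in> SR_ideal n \<Delta>" if "x \<in> SR_ideal n \<Delta>" for c and x :: "'k mpoly"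
        using ideal.I_l_closed[OF id that Const_carrier] by (simp add: poly_ring_simps Const_mult)
    qed
    show "(full_ideal n \<Delta> {} :: 'k mpoly set) \<subseteq> SR_ideal n \<Delta>"
      unfolding full_ideal_def gr_ideal_empty
    proof (rule pm.vs.span_minimal[OF _ sub], rule subsetI)
      fix p :: "'k mpoly" assume "p \<in> (\<Union>l. nonface n \<Delta> l)"
      then obtain l where p: "p \<in> nonface n \<Delta> l" by blast
      have "p = (\<Sum>x\<in>keys p. smul (lookup p x) (single x 1))"
        by (rule supported_on_expand) (auto simp: supported_on_def)
      also have "\<dots> \<in> SR_ideal n \<Delta>"
      proof (intro pm.vs.subspace_sum[OF sub] pm.vs.subspace_scale[OF sub] mon)
        fix x assume "x \<in> keys p"
        then show "keys x \<subseteq> {1..n}" "keys x \<notin> \<Delta>" using p by (auto simp: nonface_def supported_on_def mons_def)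
      qed
      finally show "p \<in> SR_ideal n \<Delta>" .
    qed
  qed
qed

section \<open>The face ring as a module, through representatives\<close>

locale face_ring =
  fixes n :: nat and \<Delta> :: "nat set set" and field_type :: "'k::field itself"
  assumes down_closed: "down_closed \<Delta>"
begin

abbreviation "R \<equiv> poly_ring n :: 'k mpoly ring"
abbreviation "S \<equiv> regular_module n :: ('k mpoly, 'k mpoly) module"
abbreviation "A \<equiv> SR_module n \<Delta> :: ('k mpoly, 'k mpoly set) module"

definition cls :: "'k mpoly \<Rightarrow> 'k mpoly set" where
  "cls p = SR_ideal n \<Delta> +>\<^bsub>S\<^esub> p"

lemma SR_ideal_eq': "SR_ideal n \<Delta> = (full_ideal n \<Delta> {} :: 'k mpoly set)"
  by (rule SR_ideal_eq[OF down_closed])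

lemma quotient_SR: "quotient_by_submodule R S (SR_ideal n \<Delta>)"
proof (rule quotient_by_submodule.intro[OF module_regular], rule quotient_by_submodule_axioms.intro)
  show "submodule R (SR_ideal n \<Delta>) S"
    unfolding submodule_def SR_ideal_eq'
    using module_regular full_ideal_sub_carrier[of "{}" n \<Delta>] pm.vs.subspace_0[OF full_ideal_subspace]
      pm.vs.subspace_add[OF full_ideal_subspace] mult_full_ideal[OF down_closed]
    by (auto simp: regular_module_simps)
qed

lemma A_carrier: "carrier A = cls ` carrier R"
  using quotient_by_submodule.carrier_quot_module[OF quotient_SR]
  by (simp add: SR_module_def cls_def regular_module_simps)

lemma A_zero: "\<zero>\<^bsub>A\<^esub> = cls 0"
  using quotient_by_submodule.zero_quot_module[OF quotient_SR]
  by (simp add: SR_module_def cls_def regular_module_simps)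

lemma A_add: "p \<in> carrier R \<Longrightarrow> q \<in> carrier R \<Longrightarrow> cls p \<oplus>\<^bsub>A\<^esub> cls q = cls (p + q)"
  using quotient_by_submodule.add_quot_module[OF quotient_SR]
  by (simp add: SR_module_def cls_def regular_module_simps)

lemma A_smult: "r \<in> carrier R \<Longrightarrow> p \<in> carrier R \<Longrightarrow> r \<odot>\<^bsub>A\<^esub> cls p = cls (r * p)"
  using quotient_by_submodule.smult_quot_module[OF quotient_SR]
  by (simp add: SR_module_def cls_def regular_module_simps)

lemma cls_eq_iff: "p \<in> carrier R \<Longrightarrow> q \<in> carrier R \<Longrightarrow> cls p = cls q \<longleftrightarrow> p - q \<in> full_ideal n \<Delta> {}"
  using quotient_by_submodule.coset_eq_iff[OF quotient_SR, of p q]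
  by (simp add: cls_def regular_module_simps regular_minus SR_ideal_eq')

lemma module_A: "Module.module R A"
  using quotient_by_submodule.module_quot_module[OF quotient_SR] by (simp add: SR_module_def)

lemma A_minus:
  assumes p: "p \<in> carrier R" and q: "q \<in> carrier R"
  shows "cls p \<ominus>\<^bsub>A\<^esub> cls q = cls (p - q)"
proof -
  interpret Module.module R A by (rule module_A)
  have "\<ominus>\<^bsub>A\<^esub> cls q = cls (- q)"
    by (rule M.minus_equality) (use q carrier_neg[OF q] in \<open>auto simp: A_add A_zero A_carrier\<close>)
  then show ?thesis using p carrier_neg[OF q] by (simp add: a_minus_def A_add)
qed

lemma submodule_full_ideal:
  assumes U: "U \<subseteq> homog n 1"
  shows "submodule R (cls ` full_ideal n \<Delta> U) A"
proof -
  have sub: "full_ideal n \<Delta> U \<subseteq> carrier R" by (rule full_ideal_sub_carrier[OF U])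
  show ?thesis
    unfolding submodule_def
  proof (intro conjI allI impI)
    show "cls ` full_ideal n \<Delta> U \<subseteq> carrier A" using sub A_carrier by blast
    show "\<zero>\<^bsub>A\<^esub> \<in> cls ` full_ideal n \<Delta> U"
      unfolding A_zero using pm.vs.subspace_0[OF full_ideal_subspace] by (rule imageI)
    show "x \<oplus>\<^bsub>A\<^esub> y \<in> cls ` full_ideal n \<Delta> U"
      if x: "x \<in> cls ` full_ideal n \<Delta> U" and y: "y \<in> cls ` full_ideal n \<Delta> U" for x y
    proof -
      obtain p q where p: "p \<in> full_ideal n \<Delta> U" "x = cls p" and q: "q \<in> full_ideal n \<Delta> U" "y = cls q"
        using x y by blast
      have "x \<oplus>\<^bsub>A\<^esub> y = cls (p + q)" using p q sub A_add by blast
      then show ?thesis using pm.vs.subspace_add[OF full_ideal_subspace p(1) q(1)] by simp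
    qed
    show "r \<odot>\<^bsub>A\<^esub> x \<in> cls ` full_ideal n \<Delta> U" if r: "r \<in> carrier R" and x: "x \<in> cls ` full_ideal n \<Delta> U" for r x
    proof -
      obtain p where p: "p \<in> full_ideal n \<Delta> U" "x = cls p" using x by blast
      have "r \<odot>\<^bsub>A\<^esub> x = cls (r * p)" using p r sub A_smult by blast
      then show ?thesis using mult_full_ideal[OF down_closed r p(1)] by simp
    qed
  qed (rule module_A)
qed

text \<open>Turns the span in the module record into an ideal of polynomials, so that colon modules
  and socles become membership statements about representatives.\<close>

lemma ideal_times_eq:
  assumes U: "U \<subseteq> homog n 1"
  shows "ideal_times R U A = cls ` full_ideal n \<Delta> U"
proof -
  interpret A: Module.module R A by (rule module_A)
  have UC: "U \<subseteq> carrier R" using U homog_sub_carrier by blast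
  let ?G = "{t \<odot>\<^bsub>A\<^esub> m | t m. t \<in> U \<and> m \<in> carrier A}"
  let ?V = "{p \<in> carrier R. cls p \<in> A.span ?G}"
  have G: "x \<in> cls ` full_ideal n \<Delta> U" if x: "x \<in> ?G" for x
  proof -
    obtain t q where tq: "t \<in> U" "q \<in> carrier R" "x = t \<odot>\<^bsub>A\<^esub> cls q" using x unfolding A_carrier by blast
    then have "x = cls (t * q)" using UC A_smult by blast
    then show ?thesis using linear_mult_full_ideal[OF down_closed tq(1,2)] by simp
  qed
  have GC: "?G \<subseteq> carrier A" using UC by auto
  have span_sub: "submodule R (A.span ?G) A" by (rule A.span_is_submodule[OF GC])
  have own: "?G \<subseteq> A.span ?G" by (rule A.in_own_span[OF GC])
  have "A.span ?G \<subseteq> cls ` full_ideal n \<Delta> U"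
    by (rule A.span_is_subset[OF subsetI submodule_full_ideal[OF U]]) (rule G)
  moreover have "full_ideal n \<Delta> U \<subseteq> ?V"
  proof -
    have sp: "pm.vs.subspace ?V"
    proof (rule pm.vs.subspaceI)
      show "0 \<in> ?V"
        using carrier_0 submodule.zero_closed[OF span_sub] by (simp add: A_zero)
      show "p + q \<in> ?V"
        if "p \<in> ?V" "q \<in> ?V" for p q
        using that carrier_add submodule.m_closed[OF span_sub, of "cls p" "cls q"] by (auto simp: A_add)
      show "smul c p \<in> ?V" if "p \<in> ?V" for c p
        using that carrier_smul[of p n c] submodule.smult_closed[OF span_sub Const_carrier, of "cls p" c]
        by (auto simp: A_smult Const_carrier Const_mult)
    qed
    have "gr_ideal n \<Delta> U l \<subseteq> ?V" for l
    proof (rule gr_ideal_least[OF _ _ sp])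
      show "nonface n \<Delta> l \<subseteq> ?V"
      proof
        fix p :: "'k mpoly" assume "p \<in> nonface n \<Delta> l"
        then have p: "p \<in> full_ideal n \<Delta> {}" using nonface_gr_ideal gr_sub_full by blast
        then have pC: "p \<in> carrier R" using full_ideal_sub_carrier[of "{}" n \<Delta>] by blast
        have "cls p = \<zero>\<^bsub>A\<^esub>" using cls_eq_iff[OF pC carrier_0] p by (simp add: A_zero)
        then show "p \<in> ?V"
          using pC submodule.zero_closed[OF span_sub] by simp
      qed
      fix u q :: "'k mpoly" assume u: "u \<in> U" and q: "q \<in> homog n (l - 1)"
      then have uq: "u \<in> carrier R" "q \<in> carrier R" using UC homog_sub_carrier by blast+
      have "cls q \<in> carrier A" unfolding A_carrier using uq(2) by (rule imageI)
      then have "cls (u * q) \<in> ?G" using u A_smult[OF uq, symmetric] by blast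
      then show "u * q \<in> ?V" using own carrier_mult[OF uq] by blast
    qed
    then show ?thesis unfolding full_ideal_def by (intro pm.vs.span_minimal[OF UN_least sp])
  qed
  ultimately show ?thesis unfolding ideal_times_def by blast
qed

lemma cls_mem_ideal_times:
  assumes U: "U \<subseteq> homog n 1" and p: "p \<in> carrier R"
  shows "cls p \<in> ideal_times R U A \<longleftrightarrow> p \<in> full_ideal n \<Delta> U"
proof
  assume "cls p \<in> ideal_times R U A"
  then obtain p' where p': "p' \<in> full_ideal n \<Delta> U" "cls p = cls p'" unfolding ideal_times_eq[OF U] by blast
  then have "p' \<in> carrier R" using full_ideal_sub_carrier[OF U] by blast
  then have "p - p' \<in> full_ideal n \<Delta> {}" using cls_eq_iff[OF p] p'(2) by blast
  then have "p - p' \<in> full_ideal n \<Delta> U" using full_ideal_mono[of "{}" U] by blast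
  from pm.vs.subspace_add[OF full_ideal_subspace this p'(1)] show "p \<in> full_ideal n \<Delta> U" by simp
qed (simp add: ideal_times_eq[OF U])

lemma max_ideal_contains_linear:
  assumes t: "t \<in> homog n 1"
  shows "t \<in> (max_ideal n :: 'k mpoly set)"
proof -
  interpret cring R by (rule cring_poly_ring)
  have VC: "Var ` {1..n} \<subseteq> carrier R" using Var_carrier by blast
  have id: "ideal (max_ideal n) R" unfolding max_ideal_def by (rule genideal_ideal[OF VC])
  have gen: "Var ` {1..n} \<subseteq> (max_ideal n :: 'k mpoly set)" unfolding max_ideal_def by (rule genideal_self[OF VC])
  have 0: "0 \<in> (max_ideal n :: 'k mpoly set)"
    using additive_subgroup.zero_closed[OF ideal.axioms(1)[OF id]] by (simp add: poly_ring_simps)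
  have add: "x + y \<in> max_ideal n" if "x \<in> max_ideal n" "y \<in> max_ideal n" for x y :: "'k mpoly"
    using additive_subgroup.a_closed[OF ideal.axioms(1)[OF id] that] by (simp add: poly_ring_simps)
  have "smul c (Var v) \<in> max_ideal n" if "v \<in> {1..n}" for c :: 'k and v
  proof -
    have "Var v \<in> (max_ideal n :: 'k mpoly set)" using gen that by blast
    from ideal.I_l_closed[OF id this Const_carrier, of c] show ?thesis
      by (simp add: poly_ring_simps Const_mult)
  qed
  then have sums: "(\<Sum>v\<in>X. smul (lookup t (single v 1)) (Var v)) \<in> max_ideal n" if "X \<subseteq> {1..n}" for X
    using that by (induction X rule: infinite_finite_induct) (auto intro: 0 add)
  show ?thesis by (subst linear_form_expand[OF t]) (rule sums[OF subset_refl])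
qed

text \<open>The multipliers that send \<open>p\<close> into the ideal form an ideal themselves, so
  it is enough that they include the variables.\<close>

lemma max_ideal_mult:
  assumes t: "t \<in> max_ideal n" and V: "\<And>v. v \<in> {1..n} \<Longrightarrow> Var v * p \<in> full_ideal n \<Delta> U"
  shows "t * (p :: 'k mpoly) \<in> full_ideal n \<Delta> U"
proof -
  interpret cring R by (rule cring_poly_ring)
  let ?I = "{t \<in> carrier R. t * p \<in> full_ideal n \<Delta> U}"
  have "ideal ?I R"
  proof (rule ideal_poly_ringI)
    show "pm.vs.subspace ?I"
      using pm.vs.subspace_0[OF full_ideal_subspace] pm.vs.subspace_add[OF full_ideal_subspace]
        pm.vs.subspace_scale[OF full_ideal_subspace]
      by (intro pm.vs.subspaceI)
        (auto simp: distrib_right smul_mult_left carrier_0 carrier_add carrier_smul)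
    show "r * q \<in> ?I" if "r \<in> carrier R" "q \<in> ?I" for r q
      using that mult_full_ideal[OF down_closed, of r n "q * p" U] by (simp add: carrier_mult mult.assoc)
  qed blast
  then have "max_ideal n \<subseteq> ?I"
    unfolding max_ideal_def by (rule genideal_minimal) (use V Var_carrier in blast)
  then show ?thesis using t by blast
qed

text \<open>The parameter condition depends only on the generated ideal and the number of
  generators, and both survive a change of basis.\<close>

lemma hsop_admissible:
  assumes hs: "hsop n A \<theta>s" and lin: "set \<theta>s \<subseteq> homog n 1" and adm: "admissible n \<theta>s ts"
  shows "hsop n A ts"
proof -
  have ts: "set ts \<subseteq> homog n 1" "length ts = length \<theta>s" "pm.vs.span (set ts) = pm.vs.span (set \<theta>s)"
    using adm by (auto simp: admissible_def)
  have "ideal_times R (set ts) A = ideal_times R (set \<theta>s) A"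
    unfolding ideal_times_eq[OF ts(1)] ideal_times_eq[OF lin] full_ideal_span_cong[OF ts(3)] ..
  moreover have "t \<in> max_ideal n \<and> (\<exists>j. t \<in> poly_component n j)" if "t \<in> set ts" for t
    using that ts(1) max_ideal_contains_linear poly_component_eq[of n 1] by auto
  ultimately show ?thesis using hs ts(2) unfolding hsop_def by simp
qed

lemma buchsbaum_weakly_regular:
  assumes B: "buchsbaum_module n A" and hs: "hsop n A \<theta>s" and lin: "set \<theta>s \<subseteq> homog n 1"
    and adm: "admissible n \<theta>s (us @ t # rest)"
  shows "weakly_regular_on n \<Delta> (set us) t"
  unfolding weakly_regular_on_def
proof (intro allI ballI impI)
  fix l q v assume q: "q \<in> homog n l" and tq: "t * q \<in> gr_ideal n \<Delta> (set us) (l + 1)" and v: "v \<in> {1..n}"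
  let ?N = "ideal_times R (set us) A"
  have us: "set us \<subseteq> homog n 1" and t: "t \<in> homog n 1" using adm by (auto simp: admissible_def)
  have "colon A (ideal_times R (set (take i ts)) A) {ts ! i} = colon A (ideal_times R (set (take i ts)) A) (max_ideal n)"
    if "hsop n A ts" "i < length ts" for ts i
    using B that unfolding buchsbaum_module_def by blast
  \<comment> \<open>At index \<open>length us\<close> the preceding elements are exactly
    \<open>us\<close> and the element itself is \<open>t\<close>.\<close>
  from this[OF hsop_admissible[OF hs lin adm], of "length us"]
  have colon: "colon A ?N {t} = colon A ?N (max_ideal n)" by simp
  have qC: "q \<in> carrier R" and tC: "t \<in> carrier R" using q t homog_sub_carrier by blast+
  have "t \<odot>\<^bsub>A\<^esub> cls q \<in> ?N"
    unfolding A_smult[OF tC qC] cls_mem_ideal_times[OF us carrier_mult[OF tC qC]]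
    using tq gr_sub_full by blast
  then have "cls q \<in> colon A ?N {t}" using qC A_carrier by (simp add: colon_def)
  then have "cls q \<in> colon A ?N (max_ideal n)" unfolding colon .
  then have "Var v \<odot>\<^bsub>A\<^esub> cls q \<in> ?N"
    using max_ideal_contains_linear[OF Var_homog[OF v]] by (simp add: colon_def)
  then have "Var v * q \<in> full_ideal n \<Delta> (set us)"
    unfolding A_smult[OF Var_carrier[OF v] qC] cls_mem_ideal_times[OF us carrier_mult[OF Var_carrier[OF v] qC]] .
  moreover have "Var v * q \<in> homog n (l + 1)"
    using homog_mult[OF Var_homog[OF v] q] by (simp add: add.commute)
  ultimately show "Var v * q \<in> gr_ideal n \<Delta> (set us) (l + 1)" by (rule full_ideal_homog[OF us])
qed

section \<open>The socle of the quotient by the parameters\<close>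

context
  fixes \<theta>s :: "'k mpoly list"
  assumes lin: "set \<theta>s \<subseteq> homog n 1"
begin

abbreviation "N \<equiv> ideal_times R (set \<theta>s) A"
abbreviation "Q \<equiv> SR_quot n \<Delta> \<theta>s"

definition cls' :: "'k mpoly \<Rightarrow> 'k mpoly set set" where
  "cls' p = N +>\<^bsub>A\<^esub> cls p"

lemma quotient_N: "quotient_by_submodule R A N"
  by (rule quotient_by_submodule.intro[OF module_A], rule quotient_by_submodule_axioms.intro)
    (simp add: ideal_times_eq[OF lin] submodule_full_ideal[OF lin])

lemma cls_carrier: "p \<in> carrier R \<Longrightarrow> cls p \<in> carrier A"
  by (simp add: A_carrier)

lemma Q_carrier: "carrier Q = cls' ` carrier R"
  using quotient_by_submodule.carrier_quot_module[OF quotient_N]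
  by (simp add: SR_quot_def cls'_def A_carrier image_image)

lemma Q_zero: "\<zero>\<^bsub>Q\<^esub> = cls' 0"
  using quotient_by_submodule.zero_quot_module[OF quotient_N] by (simp add: SR_quot_def cls'_def A_zero)

lemma Q_add: "p \<in> carrier R \<Longrightarrow> q \<in> carrier R \<Longrightarrow> cls' p \<oplus>\<^bsub>Q\<^esub> cls' q = cls' (p + q)"
  using quotient_by_submodule.add_quot_module[OF quotient_N cls_carrier cls_carrier]
  by (simp add: SR_quot_def cls'_def A_add)

lemma Q_smult: "r \<in> carrier R \<Longrightarrow> p \<in> carrier R \<Longrightarrow> r \<odot>\<^bsub>Q\<^esub> cls' p = cls' (r * p)"
  using quotient_by_submodule.smult_quot_module[OF quotient_N _ cls_carrier]
  by (simp add: SR_quot_def cls'_def A_smult)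

lemma cls'_eq_iff:
  assumes "p \<in> carrier R" "q \<in> carrier R"
  shows "cls' p = cls' q \<longleftrightarrow> p - q \<in> full_ideal n \<Delta> (set \<theta>s)"
  using quotient_by_submodule.coset_eq_iff[OF quotient_N cls_carrier cls_carrier, OF assms]
  by (simp add: cls'_def A_minus assms cls_mem_ideal_times[OF lin] carrier_diff)

definition socle_reps :: "int \<Rightarrow> 'k mpoly set" where
  "socle_reps l = {p \<in> homog n l. \<forall>v\<in>{1..n}. Var v * p \<in> gr_ideal n \<Delta> (set \<theta>s) (l + 1)}"

lemma socle_reps_subspace: "pm.vs.subspace (socle_reps l)"
  unfolding socle_reps_def
  by (rule pm.vs.subspaceI)
    (auto simp: homog_0 homog_add homog_smul distrib_left smul_mult_right gr_ideal_0 intro: gr_ideal_add gr_ideal_smul)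

lemma gr_sub_socle_reps: "gr_ideal n \<Delta> (set \<theta>s) l \<subseteq> socle_reps l"
proof
  fix p assume p: "p \<in> gr_ideal n \<Delta> (set \<theta>s) l"
  then have "p \<in> homog n l" using gr_ideal_homog[OF lin] by blast
  moreover have "Var v * p \<in> gr_ideal n \<Delta> (set \<theta>s) (l + 1)" if "v \<in> {1..n}" for v
    using linear_mult_gr_ideal[OF Var_homog[OF that] p down_closed] .
  ultimately show "p \<in> socle_reps l" by (simp add: socle_reps_def)
qed

text \<open>Annihilation by the maximal ideal may be tested on variables, and since \<open>p\<close>
  is homogeneous, membership of \<open>Var v * p\<close> in the full ideal may be tested in its
  single degree.\<close>

lemma socle_image:
  "socle n Q \<inter> SR_quot_component n \<Delta> \<theta>s j = cls' ` socle_reps (int j)"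
proof -
  have comp: "SR_quot_component n \<Delta> \<theta>s j = cls' ` homog n (int j)"
    by (simp add: SR_quot_component_def SR_component_def poly_component_eq image_image cls'_def cls_def)
  have eq0: "cls' q = \<zero>\<^bsub>Q\<^esub> \<longleftrightarrow> q \<in> full_ideal n \<Delta> (set \<theta>s)" if "q \<in> carrier R" for q
    using cls'_eq_iff[OF that carrier_0] by (simp add: Q_zero)
  have max_carrier: "t \<in> carrier R" if "t \<in> max_ideal n" for t
  proof -
    interpret cring R by (rule cring_poly_ring)
    have "Var ` {1..n} \<subseteq> carrier R" using Var_carrier by blast
    from genideal_ideal[OF this] have "ideal (max_ideal n) R" unfolding max_ideal_def .
    then show ?thesis using ideal.Icarr that by metis
  qed
  have "cls' p \<in> socle n Q \<longleftrightarrow> p \<in> socle_reps (int j)" if p: "p \<in> homog n (int j)" for p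
  proof -
    have pC: "p \<in> carrier R" using p homog_sub_carrier by blast
    have smult0: "t \<odot>\<^bsub>Q\<^esub> cls' p = \<zero>\<^bsub>Q\<^esub> \<longleftrightarrow> t * p \<in> full_ideal n \<Delta> (set \<theta>s)" if "t \<in> carrier R" for t
      using that pC by (simp add: Q_smult eq0 carrier_mult)
    show ?thesis
    proof
      assume soc: "cls' p \<in> socle n Q"
      have "Var v * p \<in> gr_ideal n \<Delta> (set \<theta>s) (int j + 1)" if v: "v \<in> {1..n}" for v
      proof (rule full_ideal_homog[OF lin])
        have "Var v \<in> (max_ideal n :: 'k mpoly set)" by (rule max_ideal_contains_linear[OF Var_homog[OF v]])
        then have "Var v \<odot>\<^bsub>Q\<^esub> cls' p = \<zero>\<^bsub>Q\<^esub>" using soc by (simp add: socle_def)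
        then show "Var v * p \<in> full_ideal n \<Delta> (set \<theta>s)" using smult0[OF Var_carrier[OF v]] by blast
        show "Var v * p \<in> homog n (int j + 1)"
          using homog_mult[OF Var_homog[OF v] p] by (simp add: add.commute)
      qed
      then show "p \<in> socle_reps (int j)" using p by (simp add: socle_reps_def)
    next
      assume "p \<in> socle_reps (int j)"
      then have "Var v * p \<in> full_ideal n \<Delta> (set \<theta>s)" if "v \<in> {1..n}" for v
        using that gr_sub_full unfolding socle_reps_def by blast
      then have "t * p \<in> full_ideal n \<Delta> (set \<theta>s)" if "t \<in> max_ideal n" for t
        using max_ideal_mult[OF that] by blast
      then show "cls' p \<in> socle n Q"
        using smult0 max_carrier pC by (auto simp: socle_def Q_carrier)
    qed
  qed
  moreover have "socle_reps (int j) \<subseteq> homog n (int j)" by (auto simp: socle_reps_def)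
  ultimately show ?thesis unfolding comp by blast
qed

lemma k_dim_socle:
  "k_dim (socle_component n \<Delta> \<theta>s j) =
    pm.vs.dim (socle_reps (int j)) - pm.vs.dim (gr_ideal n \<Delta> (set \<theta>s) (int j))"
proof -
  have C: "p \<in> carrier R" if "p \<in> socle_reps (int j)" for p
    using that homog_sub_carrier unfolding socle_reps_def by blast
  have "pm.fin_spanned (socle_reps (int j))"
    by (rule pm.fin_spanned_mono[OF homog_fin_spanned]) (auto simp: socle_reps_def)
  then show ?thesis
  proof (rule pm.k_dim_eq_dim_diff[OF socle_reps_subspace _ gr_ideal_subspace gr_sub_socle_reps, where \<phi> = cls'])
    show "carrier (socle_component n \<Delta> \<theta>s j) = cls' ` socle_reps (int j)"
      by (simp add: socle_component_def k_space_def socle_image)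
    show "\<zero>\<^bsub>socle_component n \<Delta> \<theta>s j\<^esub> = cls' 0"
      by (simp add: socle_component_def k_space_def Q_zero)
    fix a b c assume a: "a \<in> socle_reps (int j)"
    show "c \<odot>\<^bsub>socle_component n \<Delta> \<theta>s j\<^esub> cls' a = cls' (smul c a)"
      using C[OF a] by (simp add: socle_component_def k_space_def Q_smult Const_carrier Const_mult)
    assume b: "b \<in> socle_reps (int j)"
    show "cls' a \<oplus>\<^bsub>socle_component n \<Delta> \<theta>s j\<^esub> cls' b = cls' (a + b)"
      using C[OF a] C[OF b] by (simp add: socle_component_def k_space_def Q_add)
    have "a - b \<in> homog n (int j)" using a b homog_diff by (auto simp: socle_reps_def)
    then show "(cls' a = cls' b) = (a - b \<in> gr_ideal n \<Delta> (set \<theta>s) (int j))"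
      using cls'_eq_iff[OF C[OF a] C[OF b]] full_ideal_homog[OF lin] gr_sub_full by blast
  qed
qed

end

end

theorem theorem3p5:
  fixes n d :: nat
    and \<Delta> :: "nat set set"
    and \<theta>s :: "'k::field mpoly list"
  assumes "infinite (UNIV :: 'k set)"
    and "simplicial_complex n \<Delta>"
    and "complex_dim \<Delta> = int d - 1"
    and "buchsbaum_complex TYPE('k) n \<Delta>"
    and "length \<theta>s = d"
    and "lsop n (SR_module n \<Delta>) \<theta>s"
  shows "\<forall>j\<le>d.
    k_dim (socle_component n \<Delta> \<theta>s j) \<ge> (d choose j) * betti TYPE('k) \<Delta> (int j - 1) \<and>
    h'_num TYPE('k) \<Delta> d j \<ge> int (d choose j) * int (betti TYPE('k) \<Delta> (int j - 1)) \<and>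
    h_num \<Delta> d j \<ge> int (d choose j) *
      (\<Sum>i\<le>j. (-1) ^ (j - i) * int (betti TYPE('k) \<Delta> (int i - 1)))"
proof -
  have sc: "\<Delta> \<subseteq> Pow {1..n}" "{} \<in> \<Delta>" "down_closed \<Delta>"
    using assms(2) by (auto simp: simplicial_complex_def down_closed_def)
  have lin: "set \<theta>s \<subseteq> homog n 1" and hs: "hsop n (SR_module n \<Delta>) \<theta>s"
    using assms(6) poly_component_eq[of n 1] by (auto simp: lsop_def)
  interpret F: face_ring n \<Delta> "TYPE('k)" by unfold_locales (rule sc(3))
  have weak: "weakly_regular_on n \<Delta> (set us) t" if "admissible n \<theta>s (us @ t # rest)" for us t rest
    using F.buchsbaum_weakly_regular[OF _ hs lin that] assms(4) unfolding buchsbaum_complex_def by blast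
  interpret P: partition_complex n \<Delta> \<theta>s
  proof
    fix i F assume i: "i < length \<theta>s" and F: "F \<subseteq> {1..n}" "F \<noteq> {}"
    have "\<theta>s = take i \<theta>s @ \<theta>s ! i # drop (Suc i) \<theta>s" by (rule id_take_nth_drop[OF i])
    then have adm: "admissible n \<theta>s (take i \<theta>s @ \<theta>s ! i # drop (Suc i) \<theta>s)"
      using lin by (simp add: admissible_def)
    show "regular_on n (star \<Delta> F) (set (take i \<theta>s)) (\<theta>s ! i)"
      by (rule regular_on_all_stars[OF sc(3) F _ adm]) (rule weak)
  qed (use sc lin in auto)
  show ?thesis
  proof (intro allI impI)
    fix j assume j: "j \<le> d"
    let ?b = "\<lambda>i. int (betti TYPE('k) \<Delta> (int i - 1))"
    have J: "P.J d {} l = gr_ideal n \<Delta> (set \<theta>s) l" for l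
      using assms(5) by (simp add: P.J_def star_empty)
    \<comment> \<open>After all \<open>d\<close> parameters the kernel is still annihilated by every
      variable, hence consists of socle representatives; this inclusion gives the lower
      bound.\<close>
    have "P.kernel d (int j) \<subseteq> F.socle_reps \<theta>s (int j)"
      using P.Var_mult_kernel[of _ d "int j"] P.kernel_sub
      unfolding F.socle_reps_def[OF lin] J by blast
    moreover have "pm.fin_spanned (F.socle_reps \<theta>s (int j))"
      by (rule pm.fin_spanned_mono[OF homog_fin_spanned[of n "int j"]]) (auto simp: F.socle_reps_def[OF lin])
    ultimately have "pm.vs.dim (P.kernel d (int j)) \<le> pm.vs.dim (F.socle_reps \<theta>s (int j))"
      by (intro pm.dim_subset_le P.kernel_subspace)
    moreover have "int (d choose j) * ?b j
        = int (pm.vs.dim (P.kernel d (int j))) - int (pm.vs.dim (gr_ideal n \<Delta> (set \<theta>s) (int j)))"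
      using P.h_0_eq_kernel[of d "int j"] P.h_eq[of d 0 "int j"] assms(5) by (simp add: J)
    ultimately have "int ((d choose j) * betti TYPE('k) \<Delta> (int j - 1)) \<le> int (k_dim (socle_component n \<Delta> \<theta>s j))"
      unfolding F.k_dim_socle[OF lin] by simp
    then have 1: "(d choose j) * betti TYPE('k) \<Delta> (int j - 1) \<le> k_dim (socle_component n \<Delta> \<theta>s j)"
      by (simp only: of_nat_le_iff)
    have 2: "int (d choose j) * ?b j \<le> h'_num TYPE('k) \<Delta> d j"
      using P.h_le_quot_dim[OF assms(5), of j] unfolding P.quot_dim_eq_h'[OF assms(3,5) j] .
    \<comment> \<open>Splitting off the top term turns the bound for \<open>h'\<close> into the one
      for \<open>h\<close>: the remaining terms are the negative of the correction in
      \<open>h'_num\<close>.\<close>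
    have "(\<Sum>i\<le>j. (-1) ^ (j - i) * ?b i) = ?b j + (\<Sum>i<j. (-1) ^ (j - i) * ?b i)"
      by (simp add: lessThan_Suc_atMost[symmetric])
    also have "(\<Sum>i<j. (-1) ^ (j - i) * ?b i) = - (\<Sum>i<j. (-1) ^ (j - i - 1) * ?b i)"
      unfolding sum_negf[symmetric]
    proof (rule sum.cong[OF refl])
      fix i assume "i \<in> {..<j}"
      then have "j - i = Suc (j - i - 1)" by auto
      then have "(-1 :: int) ^ (j - i) = - ((-1) ^ (j - i - 1))" by (metis mult_minus1 power_Suc)
      then show "(-1) ^ (j - i) * ?b i = - ((-1) ^ (j - i - 1) * ?b i)" by simp
    qed
    finally have sum: "(\<Sum>i\<le>j. (-1) ^ (j - i) * ?b i) = ?b j - (\<Sum>i<j. (-1) ^ (j - i - 1) * ?b i)" by simp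
    have "int (d choose j) * (\<Sum>i\<le>j. (-1) ^ (j - i) * ?b i) \<le> h_num \<Delta> d j"
      using 2 unfolding sum h'_num_def by (simp add: right_diff_distrib)
    with 1 2 show "k_dim (socle_component n \<Delta> \<theta>s j) \<ge> (d choose j) * betti TYPE('k) \<Delta> (int j - 1) \<and>
        h'_num TYPE('k) \<Delta> d j \<ge> int (d choose j) * ?b j \<and>
        h_num \<Delta> d j \<ge> int (d choose j) * (\<Sum>i\<le>j. (-1) ^ (j - i) * ?b i)"
      by blast
  qed
qed

end
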